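(* Let $\sigma$ be a Kubo–Ando operator mean with representing operator monotone function $f$, and let $\alpha:=f'(1)$, assumed to satisfy $0<\alpha<1$. Then for every pair of positive semidefinite $n\times n$ matrices $A,B$, $$\lim_{p\searrow0}(A^p\sigma B^p)^{1/p}=P_0\exp\{(1-\alpha)P_0(\log A)P_0+\alpha P_0(\log B)P_0\},$$ where $P_0:=s(A)\wedge s(B)$.
   Context: A Kubo–Ando operator mean $\sigma$ corresponds to an operator monotone function $f\ge0$ on $[0,\infty)$ (operator monotone on $(0,\infty)$) with $f(1)=1$, via $A\sigma B:=A^{1/2}f(A^{-1/2}BA^{-1/2})A^{1/2}$ for positive definite $A,B$, extended to positive semidefinite $A,B$ by $A\sigma B:=\lim_{\varepsilon\searrow0}(A+\varepsilon I)\sigma(B+\varepsilon I)$. For a positive semidefinite $A$, $s(A)$ denotes its support projection (the orthogonal projection onto its range), and $\log A$ is defined in the generalized sense: the logarithm of $A$ restricted to the range of $s(A)$ and zero on its orthogonal complement. $P\wedge Q$ is the orthogonal projection onto the intersection of the ranges of $P$ and $Q$. Here $A^p$ ($p>0$) is the usual power. *)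

theory Defs
  imports "HOL-Analysis.Analysis" "Jordan_Normal_Form.Matrix"
begin

definition hermitian_mat :: "complex mat \<Rightarrow> bool" where
  "hermitian_mat A \<longleftrightarrow> A \<in> carrier_mat (dim_row A) (dim_row A) \<and>
     (\<forall>i<dim_row A. \<forall>j<dim_row A. A $$ (i,j) = cnj (A $$ (j,i)))"

definition qform :: "complex mat \<Rightarrow> complex vec \<Rightarrow> complex" where
  "qform A v = (\<Sum>i<dim_vec v. cnj (v $ i) * (A *\<^sub>v v) $ i)"

definition psd_mat :: "complex mat \<Rightarrow> bool" where
  "psd_mat A \<longleftrightarrow> hermitian_mat A \<and>
     (\<forall>v \<in> carrier_vec (dim_row A). Re (qform A v) \<ge> 0)"

definition pd_mat :: "complex mat \<Rightarrow> bool" where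
  "pd_mat A \<longleftrightarrow> hermitian_mat A \<and>
     (\<forall>v \<in> carrier_vec (dim_row A). v \<noteq> 0\<^sub>v (dim_row A) \<longrightarrow> Re (qform A v) > 0)"

definition loewner_le :: "complex mat \<Rightarrow> complex mat \<Rightarrow> bool" where
  "loewner_le A B \<longleftrightarrow> dim_row A = dim_row B \<and> psd_mat (B - A)"

(* Functional calculus for Hermitian matrices: f(A) is the unique matrix acting as
   multiplication by f(\<lambda>) on every eigenvector of A with (real) eigenvalue \<lambda>.
   Since a Hermitian matrix has an orthonormal eigenbasis with real eigenvalues,
   this is the usual f(A) = U diag(f(\<lambda>_i)) U^*. *)
definition matfun :: "(real \<Rightarrow> real) \<Rightarrow> complex mat \<Rightarrow> complex mat" where
  "matfun f A = (THE B. B \<in> carrier_mat (dim_row A) (dim_row A) \<and>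
     (\<forall>v \<in> carrier_vec (dim_row A). \<forall>c::real.
        A *\<^sub>v v = complex_of_real c \<cdot>\<^sub>v v \<longrightarrow> B *\<^sub>v v = complex_of_real (f c) \<cdot>\<^sub>v v))"

(* real power A^p (p > 0 for psd A, any p for pd A) *)
definition mat_powr :: "complex mat \<Rightarrow> real \<Rightarrow> complex mat" where
  "mat_powr A p = matfun (\<lambda>t. t powr p) A"

(* generalized logarithm: log on the range of s(A), zero on its orthogonal complement *)
definition mat_log :: "complex mat \<Rightarrow> complex mat" where
  "mat_log A = matfun (\<lambda>t. if t = 0 then 0 else ln t) A"

definition mat_exp :: "complex mat \<Rightarrow> complex mat" where
  "mat_exp A = matfun exp A"

definition mat_range :: "complex mat \<Rightarrow> complex vec set" where
  "mat_range A = {A *\<^sub>v v | v. v \<in> carrier_vec (dim_col A)}"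

definition is_orth_proj_onto :: "nat \<Rightarrow> complex mat \<Rightarrow> complex vec set \<Rightarrow> bool" where
  "is_orth_proj_onto n P W \<longleftrightarrow> P \<in> carrier_mat n n \<and> hermitian_mat P \<and> P * P = P \<and>
     mat_range P = W"

definition orth_proj :: "nat \<Rightarrow> complex vec set \<Rightarrow> complex mat" where
  "orth_proj n W = (THE P. is_orth_proj_onto n P W)"

definition supp_proj :: "complex mat \<Rightarrow> complex mat" where
  "supp_proj A = orth_proj (dim_row A) (mat_range A)"

definition proj_meet :: "complex mat \<Rightarrow> complex mat \<Rightarrow> complex mat" where
  "proj_meet P Q = orth_proj (dim_row P) (mat_range P \<inter> mat_range Q)"

definition operator_monotone :: "(real \<Rightarrow> real) \<Rightarrow> bool" where
  "operator_monotone f \<longleftrightarrow>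
     (\<forall>n. \<forall>A \<in> carrier_mat n n. \<forall>B \<in> carrier_mat n n.
        pd_mat A \<and> pd_mat B \<and> loewner_le A B \<longrightarrow> loewner_le (matfun f A) (matfun f B))"

definition km_pd :: "(real \<Rightarrow> real) \<Rightarrow> complex mat \<Rightarrow> complex mat \<Rightarrow> complex mat" where
  "km_pd f A B = mat_powr A (1/2) *
     matfun f (mat_powr A (-1/2) * B * mat_powr A (-1/2)) * mat_powr A (1/2)"

(* extension to positive semidefinite A, B:  lim_{\<epsilon>\<searrow>0} (A+\<epsilon>I) \<sigma> (B+\<epsilon>I),
   limit taken entrywise (equivalent to norm convergence in finite dimension) *)
definition kubo_ando :: "(real \<Rightarrow> real) \<Rightarrow> complex mat \<Rightarrow> complex mat \<Rightarrow> complex mat" where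
  "kubo_ando f A B = mat (dim_row A) (dim_row A) (\<lambda>(i,j).
     Lim (at_right 0) (\<lambda>\<epsilon>::real.
        km_pd f (A + complex_of_real \<epsilon> \<cdot>\<^sub>m 1\<^sub>m (dim_row A))
                (B + complex_of_real \<epsilon> \<cdot>\<^sub>m 1\<^sub>m (dim_row A)) $$ (i,j)))"

definition km_function :: "(real \<Rightarrow> real) \<Rightarrow> bool" where
  "km_function f \<longleftrightarrow> (\<forall>t\<ge>0. f t \<ge> 0) \<and> operator_monotone f \<and> f 1 = 1"

end

(* A self-adjoint unitary dilation of a pair (T, S) with T^2 + S^2 = 1 gives Jensen's inequality for
   the operator monotone f. It implies that f is concave and that the mean is monotone in both
   arguments, so the limit defining the mean of semidefinite matrices exists. Since t -> 1/f(1/t) is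
   operator monotone as well, its concavity and that of f place f between the weighted harmonic and
   arithmetic means with weight alpha = f'(1); hence so lies A^p sigma B^p.

   Let H be the exponent on the right-hand side. To second order in p, both the harmonic and the
   arithmetic mean of A^p and B^p are P_0 + p H on the range of P_0; off that range the harmonic mean
   vanishes and the arithmetic one is at most 1 - c. So the quadratic form of Y = A^p sigma B^p lies
   between X = P_0 + p H - C p^2 P_0 and Z = P_0 + p H + C p^2 P_0 + (1 - c)(1 - P_0).
   Since t -> t^(1/p) is not operator monotone, the power 1/p is treated with eigenvectors: if
   Y y = l y and e is a common eigenvector of X and Z with Z e = z e, then the Cauchy-Schwarz
   inequality for Z - Y bounds (z - l)<e, y> by o(p) unless l^(1/p) is negligible, so
   (l^(1/p) - z^(1/p))<e, y> -> 0. *)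

theory Submission
  imports Defs "Jordan_Normal_Form.Schur_Decomposition" "Jordan_Normal_Form.Char_Poly"
    "HOL-Real_Asymp.Real_Asymp"
begin

unbundle no vec_syntax

section \<open>Adjoints and functions of diagonalized matrices\<close>

text \<open>The bounds X and Z agree to O(p^2) on the range of P_0 but differ by a constant off it,
  so eigenvalues of Y cannot simply be squeezed between those of X and Z; the part off the range
  disappears only under the power 1/p, which sends numbers below 1 by a fixed amount to 0. The
  constant c exists because (1-\<alpha>) s(A) + \<alpha> s(B) has norm at most 1 and, as 0 <
  \<alpha> < 1, fixes exactly the vectors in both ranges; finite dimension leaves a gap below the
  eigenvalue 1. Half of this gap pays for the off-diagonal part of p ((1-\<alpha>) log A + \<alpha>
  log B) between the range of P_0 and its complement, which is only O(p): split with a weight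
  proportional to p, it costs O(p^2) on the range and a fixed small amount off it.

  The harmonic mean is never formed, since A and B may be singular. Its quadratic form at v is
  replaced by the concave functional 2 Re<v,x> minus the weighted inverse forms at x, a valid lower
  bound for every x in both ranges; x = (P_0 + p H) v, the maximizer to first order, is accurate
  enough.\<close>

notation mat_adjoint ("(_\<dagger>)" [1000] 1000)

lemma dim_mat_adjoint [simp]:
  "dim_row (A\<dagger>) = dim_col A" "dim_col (A\<dagger>) = dim_row A"
  by (simp_all add: mat_adjoint_def)

lemma index_mat_adjoint [simp]:
  fixes A :: "complex mat"
  assumes "i < dim_col A" "j < dim_row A"
  shows "A\<dagger> $$ (i,j) = cnj (A $$ (j,i))"
  using assms by (simp add: mat_adjoint_def mat_of_rows_index conjugate_complex_def)

lemma mat_adjoint_carrier [simp]: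
  "A\<dagger> \<in> carrier_mat n m \<longleftrightarrow> A \<in> carrier_mat m n"
  unfolding carrier_mat_def mem_Collect_eq dim_mat_adjoint by blast

lemma mat_adjoint_adjoint [simp]: "(A\<dagger>)\<dagger> = (A :: complex mat)"
  by (rule eq_matI) auto

lemma index_mult_mat_sum:
  assumes "A \<in> carrier_mat nr n" "B \<in> carrier_mat n nc" "i < nr" "j < nc"
  shows "(A * B) $$ (i,j) = (\<Sum>k<n. A $$ (i,k) * B $$ (k,j))"
  using assms by (auto simp: scalar_prod_def atLeast0LessThan intro!: sum.cong)

lemma index_mult_mat_vec_sum:
  assumes "A \<in> carrier_mat nr n" "v \<in> carrier_vec n" "i < nr"
  shows "(A *\<^sub>v v) $ i = (\<Sum>k<n. A $$ (i,k) * v $ k)"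
  using assms by (auto simp: scalar_prod_def atLeast0LessThan intro!: sum.cong)

lemma mat_adjoint_mult:
  fixes A B :: "complex mat"
  assumes "A \<in> carrier_mat nr n" "B \<in> carrier_mat n nc"
  shows "(A * B)\<dagger> = B\<dagger> * A\<dagger>"
proof (rule eq_matI)
  fix i j assume "i < dim_row (B\<dagger> * A\<dagger>)" "j < dim_col (B\<dagger> * A\<dagger>)"
  hence ij: "i < nc" "j < nr" using assms by auto
  have "(A * B)\<dagger> $$ (i,j) = cnj (\<Sum>k<n. A $$ (j,k) * B $$ (k,i))"
    using ij assms by (simp add: index_mult_mat_sum[OF assms, symmetric] del: index_mult_mat(1))
  also have "\<dots> = (B\<dagger> * A\<dagger>) $$ (i,j)"
    using ij assms
    by (subst index_mult_mat_sum[where nr = nc and n = n and nc = nr]) (auto simp: mult.commute intro!: sum.cong)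
  finally show "(A * B)\<dagger> $$ (i,j) = (B\<dagger> * A\<dagger>) $$ (i,j)" .
qed (use assms in auto)

definition cip :: "complex vec \<Rightarrow> complex vec \<Rightarrow> complex" where
  "cip v w = (\<Sum>i<dim_vec v. cnj (v $ i) * w $ i)"

lemma qform_cip: "qform A v = cip v (A *\<^sub>v v)"
  by (simp add: qform_def cip_def)

lemma cip_adjoint:
  assumes "A \<in> carrier_mat nr nc" "v \<in> carrier_vec nr" "w \<in> carrier_vec nc"
  shows "cip v (A *\<^sub>v w) = cip (A\<dagger> *\<^sub>v v) w"
proof -
  have "cip v (A *\<^sub>v w) = (\<Sum>i<nr. \<Sum>k<nc. cnj (v $ i) * A $$ (i,k) * w $ k)"
    using assms unfolding cip_def
    by (auto simp: index_mult_mat_vec_sum[OF assms(1,3)] sum_distrib_left mult.assoc intro!: sum.cong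
        simp del: index_mult_mat_vec)
  also have "\<dots> = (\<Sum>k<nc. \<Sum>i<nr. cnj (v $ i) * A $$ (i,k) * w $ k)"
    by (rule sum.swap)
  also have "\<dots> = (\<Sum>k<nc. cnj (\<Sum>i<nr. A\<dagger> $$ (k,i) * v $ i) * w $ k)"
    using assms by (auto simp: sum_distrib_right sum_distrib_left mult_ac intro!: sum.cong)
  also have "\<dots> = cip (A\<dagger> *\<^sub>v v) w"
    using assms unfolding cip_def
    by (auto simp: index_mult_mat_vec_sum[where nr = nc and n = nr] intro!: sum.cong
        simp del: index_mult_mat_vec)
  finally show ?thesis .
qed

lemma cip_adjoint':
  assumes "A \<in> carrier_mat nr nc" "v \<in> carrier_vec nc" "w \<in> carrier_vec nr"
  shows "cip (A *\<^sub>v v) w = cip v (A\<dagger> *\<^sub>v w)"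
  using cip_adjoint[of "A\<dagger>" nc nr v w] assms by simp

lemma cip_commute:
  assumes "dim_vec v = dim_vec w"
  shows "cip v w = cnj (cip w v)"
  using assms by (simp add: cip_def mult.commute)

lemma cip_add_right:
  assumes "v \<in> carrier_vec n" "w \<in> carrier_vec n" "x \<in> carrier_vec n"
  shows "cip v (w + x) = cip v w + cip v x"
  using assms by (simp add: cip_def algebra_simps sum.distrib)

lemma cip_add_left:
  assumes "v \<in> carrier_vec n" "w \<in> carrier_vec n" "x \<in> carrier_vec n"
  shows "cip (w + x) v = cip w v + cip x v"
  using assms by (simp add: cip_def algebra_simps sum.distrib)

lemma cip_minus_right:
  assumes "v \<in> carrier_vec n" "w \<in> carrier_vec n" "x \<in> carrier_vec n"
  shows "cip v (w - x) = cip v w - cip v x"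
  using assms by (simp add: cip_def algebra_simps sum_subtractf)

lemma cip_smult_right:
  assumes "v \<in> carrier_vec n" "w \<in> carrier_vec n"
  shows "cip v (c \<cdot>\<^sub>v w) = c * cip v w"
  using assms by (simp add: cip_def sum_distrib_left mult_ac)

lemma cip_smult_left:
  assumes "v \<in> carrier_vec n" "w \<in> carrier_vec n"
  shows "cip (c \<cdot>\<^sub>v w) v = cnj c * cip w v"
  using assms by (simp add: cip_def sum_distrib_left mult_ac)

definition nsq :: "complex vec \<Rightarrow> real" where
  "nsq v = (\<Sum>i<dim_vec v. (cmod (v $ i))\<^sup>2)"

lemma cip_self: "cip v v = complex_of_real (nsq v)"
  unfolding cip_def nsq_def of_real_sum
  by (intro sum.cong refl) (simp add: complex_norm_square mult.commute del: of_real_power)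

lemma nsq_unit_vec:
  assumes "i < n"
  shows "nsq (unit_vec n i) = 1"
proof -
  have "nsq (unit_vec n i) = (\<Sum>j<n. if j = i then 1 else 0)"
    unfolding nsq_def by (intro sum.cong) (use assms in auto)
  thus ?thesis using assms by simp
qed

lemma nsq_nonneg [simp]: "nsq v \<ge> 0"
  by (simp add: nsq_def sum_nonneg)

lemma nsq_eq_0:
  assumes "v \<in> carrier_vec n"
  shows "nsq v = 0 \<longleftrightarrow> v = 0\<^sub>v n"
proof
  assume "nsq v = 0"
  hence "\<forall>i<dim_vec v. v $ i = 0"
    unfolding nsq_def by (subst (asm) sum_nonneg_eq_0_iff) auto
  thus "v = 0\<^sub>v n" using assms by (intro eq_vecI) auto
next
  assume "v = 0\<^sub>v n" thus "nsq v = 0" by (simp add: nsq_def)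
qed

lemma hermitian_mat_iff:
  assumes "A \<in> carrier_mat n n"
  shows "hermitian_mat A \<longleftrightarrow> A\<dagger> = A"
proof
  assume h: "hermitian_mat A"
  show "A\<dagger> = A"
  proof (rule eq_matI)
    fix i j assume "i < dim_row A" "j < dim_col A"
    hence ij: "i < n" "j < n" using assms by auto
    hence e: "cnj (A $$ (j,i)) = A $$ (i,j)"
      using h assms unfolding hermitian_mat_def by (metis carrier_matD(1))
    show "A\<dagger> $$ (i,j) = A $$ (i,j)" using ij assms e by simp
  qed (use assms in auto)
next
  assume e: "A\<dagger> = A"
  show "hermitian_mat A" unfolding hermitian_mat_def
  proof (intro conjI allI impI)
    fix i j assume "i < dim_row A" "j < dim_row A"
    thus "A $$ (i,j) = cnj (A $$ (j,i))"
      using assms index_mat_adjoint[of i A j] unfolding e by (metis carrier_matD)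
  qed (use assms in auto)
qed

section \<open>Unitary matrices and matrices diagonalized by them\<close>

definition unitary_mat :: "nat \<Rightarrow> complex mat \<Rightarrow> bool" where
  "unitary_mat n U \<longleftrightarrow> U \<in> carrier_mat n n \<and> U\<dagger> * U = 1\<^sub>m n"

lemma unitary_carrier: "unitary_mat n U \<Longrightarrow> U \<in> carrier_mat n n"
  and unitary_left: "unitary_mat n U \<Longrightarrow> U\<dagger> * U = 1\<^sub>m n"
  by (simp_all add: unitary_mat_def)

lemma unitary_right: "unitary_mat n U \<Longrightarrow> U * U\<dagger> = 1\<^sub>m n"
  unfolding unitary_mat_def by (metis mat_adjoint_carrier mat_mult_left_right_inverse)

lemma unitary_adjoint: "unitary_mat n U \<Longrightarrow> unitary_mat n (U\<dagger>)"
  using unitary_right[of n U] by (simp add: unitary_mat_def)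

lemma mat_adjoint_one [simp]: "(1\<^sub>m n)\<dagger> = (1\<^sub>m n :: complex mat)"
  by (rule eq_matI) auto

lemma unitary_one: "unitary_mat n (1\<^sub>m n)"
  by (simp add: unitary_mat_def)

lemma mult_square_carrier [simp]:
  "A \<in> carrier_mat n n \<Longrightarrow> B \<in> carrier_mat n n \<Longrightarrow> A * B \<in> carrier_mat n n"
  by (rule mult_carrier_mat)

lemma mult_square_assoc:
  fixes A B C :: "'a :: semiring_0 mat"
  shows "A \<in> carrier_mat n n \<Longrightarrow> B \<in> carrier_mat n n \<Longrightarrow> C \<in> carrier_mat n n \<Longrightarrow> A * B * C = A * (B * C)"
  by (rule assoc_mult_mat)

lemma dim_mat_diag [simp]: "dim_row (mat_diag n f) = n" "dim_col (mat_diag n f) = n"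
  by (simp_all add: mat_diag_def)

lemma unitary_mult:
  assumes "unitary_mat n U" "unitary_mat n V"
  shows "unitary_mat n (U * V)"
proof -
  note c = unitary_carrier[OF assms(1)] unitary_carrier[OF assms(2)]
  have "(U * V)\<dagger> * (U * V) = V\<dagger> * U\<dagger> * (U * V)"
    using c by (simp add: mat_adjoint_mult[of U n n V n])
  also have "\<dots> = V\<dagger> * (U\<dagger> * U) * V"
    using c by (simp add: mult_square_assoc[of _ n])
  also have "\<dots> = 1\<^sub>m n"
    using c assms by (simp add: unitary_left)
  finally show ?thesis using c by (simp add: unitary_mat_def)
qed

lemma unitary_cancel_vec:
  assumes "unitary_mat n U" "v \<in> carrier_vec n"
  shows "U\<dagger> *\<^sub>v (U *\<^sub>v v) = v" "U *\<^sub>v (U\<dagger> *\<^sub>v v) = v"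
proof -
  note c = unitary_carrier[OF assms(1)]
  show "U\<dagger> *\<^sub>v (U *\<^sub>v v) = v"
    using c assms by (subst assoc_mult_mat_vec[of _ n n _ n, symmetric]) (auto simp: unitary_left)
  show "U *\<^sub>v (U\<dagger> *\<^sub>v v) = v"
    using c assms by (subst assoc_mult_mat_vec[of _ n n _ n, symmetric]) (auto simp: unitary_right)
qed

lemma unitary_nsq:
  assumes "unitary_mat n U" "v \<in> carrier_vec n"
  shows "nsq (U *\<^sub>v v) = nsq v"
proof -
  have "cip (U *\<^sub>v v) (U *\<^sub>v v) = cip v v"
    using assms unitary_carrier[OF assms(1)]
    by (subst cip_adjoint'[where nr = n and nc = n]) (auto simp: unitary_cancel_vec)
  thus ?thesis by (simp add: cip_self)
qed

text \<open>The normal form for all functional calculus below: the columns of \<open>U\<close> are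
  eigenvectors with real eigenvalues \<open>d\<close>, neither ordered nor distinct, so that a
  function acts on \<open>d\<close> alone while \<open>U\<close> stays fixed.\<close>

definition udiag :: "nat \<Rightarrow> complex mat \<Rightarrow> (nat \<Rightarrow> real) \<Rightarrow> complex mat" where
  "udiag n U d = U * mat_diag n (\<lambda>i. complex_of_real (d i)) * U\<dagger>"

lemma udiag_carrier [simp]: "U \<in> carrier_mat n n \<Longrightarrow> udiag n U d \<in> carrier_mat n n"
  by (simp add: udiag_def)

lemma dim_udiag [simp]: "dim_row (udiag n U d) = dim_row U" "dim_col (udiag n U d) = dim_row U"
  by (simp_all add: udiag_def)

lemma mat_diag_vec:
  assumes "v \<in> carrier_vec n"
  shows "mat_diag n f *\<^sub>v v = vec n (\<lambda>i. f i * v $ i)"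
proof (rule eq_vecI)
  fix i assume "i < dim_vec (vec n (\<lambda>i. f i * v $ i))"
  hence i: "i < n" by simp
  have "(mat_diag n f *\<^sub>v v) $ i = (\<Sum>k<n. mat_diag n f $$ (i,k) * v $ k)"
    using assms i by (intro index_mult_mat_vec_sum) auto
  also have "\<dots> = (\<Sum>k<n. if k = i then f i * v $ i else 0)"
    using i by (intro sum.cong) (auto simp: mat_diag_def)
  also have "\<dots> = vec n (\<lambda>i. f i * v $ i) $ i" using i by simp
  finally show "(mat_diag n f *\<^sub>v v) $ i = vec n (\<lambda>i. f i * v $ i) $ i" .
qed (use assms in \<open>auto simp: mat_diag_def\<close>)

lemma udiag_vec:
  assumes "U \<in> carrier_mat n n" "v \<in> carrier_vec n"
  shows "udiag n U d *\<^sub>v v = U *\<^sub>v vec n (\<lambda>i. complex_of_real (d i) * (U\<dagger> *\<^sub>v v) $ i)"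
  using assms unfolding udiag_def
  by (simp add: assoc_mult_mat_vec[of _ n n _ n] mat_diag_vec[of _ n])

lemma cip_udiag:
  assumes "U \<in> carrier_mat n n" "v \<in> carrier_vec n" "w \<in> carrier_vec n"
  shows "cip v (udiag n U d *\<^sub>v w) =
    (\<Sum>k<n. complex_of_real (d k) * (cnj ((U\<dagger> *\<^sub>v v) $ k) * (U\<dagger> *\<^sub>v w) $ k))"
proof -
  have "cip v (udiag n U d *\<^sub>v w) = cip (U\<dagger> *\<^sub>v v) (vec n (\<lambda>i. complex_of_real (d i) * (U\<dagger> *\<^sub>v w) $ i))"
    using assms by (simp add: udiag_vec cip_adjoint[of U n n] del: index_mult_mat_vec)
  thus ?thesis using assms by (simp add: cip_def mult_ac del: index_mult_mat_vec)
qed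

text \<open>Matrix inequalities are stated as pointwise inequalities between these values. For
  self-adjoint matrices this is the Loewner order (\<open>loewner_le_iff\<close>), and limits and
  estimates then concern real numbers only.\<close>

definition rq :: "complex mat \<Rightarrow> complex vec \<Rightarrow> real" where
  "rq A v = Re (cip v (A *\<^sub>v v))"

lemma rq_udiag:
  assumes "U \<in> carrier_mat n n" "v \<in> carrier_vec n"
  shows "rq (udiag n U d) v = (\<Sum>k<n. d k * (cmod ((U\<dagger> *\<^sub>v v) $ k))\<^sup>2)"
proof -
  have "cip v (udiag n U d *\<^sub>v v) = complex_of_real (\<Sum>k<n. d k * (cmod ((U\<dagger> *\<^sub>v v) $ k))\<^sup>2)"
    unfolding cip_udiag[OF assms(1,2,2)] of_real_sum of_real_mult
    by (intro sum.cong refl) (simp add: complex_norm_square mult.commute del: of_real_power index_mult_mat_vec)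
  thus ?thesis by (simp add: rq_def)
qed

lemma mat_adjoint_mat_diag: "(mat_diag n (\<lambda>i. complex_of_real (d i)))\<dagger> = mat_diag n (\<lambda>i. complex_of_real (d i))"
  by (rule eq_matI) (auto simp: mat_diag_def)

lemma udiag_adjoint:
  assumes "U \<in> carrier_mat n n"
  shows "(udiag n U d)\<dagger> = udiag n U d"
  using assms unfolding udiag_def
  by (simp add: mat_adjoint_mult[where nr = n and n = n and nc = n] mat_adjoint_mat_diag mult_square_assoc[of _ n])

lemma udiag_hermitian:
  assumes "U \<in> carrier_mat n n"
  shows "hermitian_mat (udiag n U d)"
  using assms by (simp add: hermitian_mat_iff[of _ n] udiag_adjoint)

lemma udiag_mult:
  assumes "unitary_mat n U"
  shows "udiag n U a * udiag n U b = udiag n U (\<lambda>i. a i * b i)"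
proof -
  note c = unitary_carrier[OF assms]
  let ?D = "\<lambda>a. mat_diag n (\<lambda>i. complex_of_real (a i))"
  have "udiag n U a * udiag n U b = U * ?D a * (U\<dagger> * U) * ?D b * U\<dagger>"
    using c unfolding udiag_def by (simp add: mult_square_assoc[of _ n])
  also have "\<dots> = U * (?D a * ?D b) * U\<dagger>"
    using c assms by (simp add: unitary_left mult_square_assoc[of _ n] del: mat_diag_diag)
  finally show ?thesis by (simp add: udiag_def)
qed

lemma udiag_cong:
  assumes "\<And>i. i < n \<Longrightarrow> a i = b i"
  shows "udiag n U a = udiag n U b"
proof -
  have "mat_diag n (\<lambda>i. complex_of_real (a i)) = mat_diag n (\<lambda>i. complex_of_real (b i))"
    using assms by (intro eq_matI) (auto simp: mat_diag_def)
  thus ?thesis by (simp add: udiag_def)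
qed

lemma udiag_one:
  assumes "unitary_mat n U"
  shows "udiag n U (\<lambda>_. 1) = 1\<^sub>m n"
  using unitary_carrier[OF assms] unitary_right[OF assms] by (simp add: udiag_def)

lemma udiag_inverse:
  assumes "unitary_mat n U" "\<And>i. i < n \<Longrightarrow> a i * b i = 1"
  shows "udiag n U a * udiag n U b = 1\<^sub>m n"
  using assms by (simp add: udiag_mult udiag_one[symmetric] cong: udiag_cong)

lemma udiag_add:
  assumes "U \<in> carrier_mat n n"
  shows "udiag n U a + udiag n U b = udiag n U (\<lambda>i. a i + b i)"
proof -
  have "mat_diag n (\<lambda>i. complex_of_real (a i + b i))
      = mat_diag n (\<lambda>i. complex_of_real (a i)) + mat_diag n (\<lambda>i. complex_of_real (b i))"
    by (intro eq_matI) (auto simp: mat_diag_def)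
  thus ?thesis using assms unfolding udiag_def
    by (simp add: mult_add_distrib_mat[of _ n n _ n] add_mult_distrib_mat[of _ n n _ _ n])
qed

lemma udiag_smult:
  assumes "U \<in> carrier_mat n n"
  shows "complex_of_real c \<cdot>\<^sub>m udiag n U a = udiag n U (\<lambda>i. c * a i)"
proof -
  have "mat_diag n (\<lambda>i. complex_of_real (c * a i)) = complex_of_real c \<cdot>\<^sub>m mat_diag n (\<lambda>i. complex_of_real (a i))"
    by (intro eq_matI) (auto simp: mat_diag_def)
  thus ?thesis using assms unfolding udiag_def
    by (simp add: mult_smult_distrib[of _ n n _ n] mult_smult_assoc_mat[of _ n n _ n])
qed

lemma udiag_conj:
  assumes "V \<in> carrier_mat n n" "U \<in> carrier_mat n n"
  shows "V * udiag n U d * V\<dagger> = udiag n (V * U) d"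
  using assms unfolding udiag_def
  by (simp add: mat_adjoint_mult[where nr = n and n = n and nc = n] mult_square_assoc[of _ n])

lemma mat_eqI_vec:
  fixes A B :: "complex mat"
  assumes "A \<in> carrier_mat n m" "B \<in> carrier_mat n m"
    and "\<And>v. v \<in> carrier_vec m \<Longrightarrow> A *\<^sub>v v = B *\<^sub>v v"
  shows "A = B"
proof (rule mat_col_eqI)
  fix i assume "i < dim_col B"
  hence i: "i < m" using assms by simp
  have "col A i = A *\<^sub>v unit_vec m i" "col B i = B *\<^sub>v unit_vec m i"
    using i assms(1,2) by (auto intro!: eq_vecI)
  thus "col A i = col B i" using assms(3)[of "unit_vec m i"] by simp
qed (use assms in auto)

text \<open>In the coordinates \<open>w\<close> of \<open>v\<close> with respect to the columns of
  \<open>U\<close>, the eigenvalue equation reads \<open>d i * w i = r * w i\<close>. So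
  \<open>w\<close> lives on the indices with \<open>d i = r\<close>, where
  \<open>f (d i) = f r\<close>; repeated eigenvalues are thus covered.\<close>

lemma udiag_eigenvector_fun:
  assumes U: "unitary_mat n U" and v: "v \<in> carrier_vec n"
    and e: "udiag n U d *\<^sub>v v = complex_of_real r \<cdot>\<^sub>v v"
  shows "udiag n U (\<lambda>i. f (d i)) *\<^sub>v v = complex_of_real (f r) \<cdot>\<^sub>v v"
proof -
  note c = unitary_carrier[OF U]
  let ?w = "U\<dagger> *\<^sub>v v"
  have w: "?w \<in> carrier_vec n" using c v by simp
  have "vec n (\<lambda>i. complex_of_real (d i) * ?w $ i) = U\<dagger> *\<^sub>v (complex_of_real r \<cdot>\<^sub>v v)"
    unfolding e[symmetric] udiag_vec[OF c v] using U by (subst unitary_cancel_vec) auto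
  also have "\<dots> = complex_of_real r \<cdot>\<^sub>v ?w"
    using c v by (simp add: mult_mat_vec[of _ n n])
  finally have e2: "vec n (\<lambda>i. complex_of_real (d i) * ?w $ i) = complex_of_real r \<cdot>\<^sub>v ?w" .
  have *: "complex_of_real (d i) * ?w $ i = complex_of_real r * ?w $ i" if "i < n" for i
    using arg_cong[OF e2, of "\<lambda>x. x $ i"] that carrier_vecD[OF w]
    by (simp del: index_mult_mat_vec dim_mult_mat_vec)
  have "vec n (\<lambda>i. complex_of_real (f (d i)) * ?w $ i) = complex_of_real (f r) \<cdot>\<^sub>v ?w"
  proof (rule eq_vecI)
    fix i assume "i < dim_vec (complex_of_real (f r) \<cdot>\<^sub>v ?w)"
    hence i: "i < n" using c by simp
    show "vec n (\<lambda>i. complex_of_real (f (d i)) * ?w $ i) $ i = (complex_of_real (f r) \<cdot>\<^sub>v ?w) $ i"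
      using *[OF i] i w c by (cases "d i = r") (auto simp del: index_mult_mat_vec)
  qed (use w c in auto)
  thus ?thesis
    using c v U w by (simp add: udiag_vec mult_mat_vec[of _ n n] unitary_cancel_vec)
qed

lemma udiag_col_eigenvector:
  assumes "unitary_mat n U" "i < n"
  shows "udiag n U d *\<^sub>v (U *\<^sub>v unit_vec n i) = complex_of_real (d i) \<cdot>\<^sub>v (U *\<^sub>v unit_vec n i)"
proof -
  note c = unitary_carrier[OF assms(1)]
  have "U\<dagger> *\<^sub>v (U *\<^sub>v unit_vec n i) = unit_vec n i"
    by (rule unitary_cancel_vec(1)[OF assms(1)]) simp
  hence "udiag n U d *\<^sub>v (U *\<^sub>v unit_vec n i) = U *\<^sub>v vec n (\<lambda>j. complex_of_real (d j) * unit_vec n i $ j)"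
    using c by (subst udiag_vec) auto
  also have "vec n (\<lambda>j. complex_of_real (d j) * unit_vec n i $ j) = complex_of_real (d i) \<cdot>\<^sub>v unit_vec n i"
    using assms by (intro eq_vecI) auto
  finally show ?thesis using c by (simp add: mult_mat_vec[of _ n n])
qed

text \<open>Both matrices agree after multiplication by \<open>U\<close>, whose columns are the
  prescribed eigenvectors, and \<open>U\<close> is invertible.\<close>

lemma udiag_eqI:
  assumes "unitary_mat n U" "B \<in> carrier_mat n n"
    and ev: "\<And>i. i < n \<Longrightarrow> B *\<^sub>v (U *\<^sub>v unit_vec n i) = complex_of_real (d i) \<cdot>\<^sub>v (U *\<^sub>v unit_vec n i)"
  shows "B = udiag n U d"
proof -
  note c = unitary_carrier[OF assms(1)]
  have "B * U = udiag n U d * U"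
  proof (rule mat_col_eqI)
    fix i assume "i < dim_col (udiag n U d * U)"
    hence i: "i < n" using c by simp
    have 1: "col U i = U *\<^sub>v unit_vec n i" using i c by (auto intro!: eq_vecI)
    show "col (B * U) i = col (udiag n U d * U) i"
      using ev[OF i] udiag_col_eigenvector[OF assms(1) i, of d] c assms(2) i
      by (simp add: col_mult2[of _ n n _ n] 1)
  qed (use c assms(2) in auto)
  hence "B * U * U\<dagger> = udiag n U d * U * U\<dagger>" by simp
  thus ?thesis
    using c assms by (simp add: mult_square_assoc[of _ n] unitary_right)
qed

text \<open>Resolves the definite description in \<open>matfun\<close>: existence concerns every
  eigenvector of the matrix, uniqueness only those in the columns of \<open>U\<close>.\<close>

lemma matfun_udiag:
  assumes U: "unitary_mat n U"
  shows "matfun f (udiag n U d) = udiag n U (\<lambda>i. f (d i))"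
  unfolding matfun_def
proof (rule the_equality)
  note c = unitary_carrier[OF U]
  have dim: "dim_row (udiag n U d) = n" using c by simp
  show "udiag n U (\<lambda>i. f (d i)) \<in> carrier_mat (dim_row (udiag n U d)) (dim_row (udiag n U d)) \<and>
     (\<forall>v \<in> carrier_vec (dim_row (udiag n U d)). \<forall>c::real. udiag n U d *\<^sub>v v = complex_of_real c \<cdot>\<^sub>v v \<longrightarrow>
        udiag n U (\<lambda>i. f (d i)) *\<^sub>v v = complex_of_real (f c) \<cdot>\<^sub>v v)"
    unfolding dim using c udiag_eigenvector_fun[OF U] by simp
  fix B assume "B \<in> carrier_mat (dim_row (udiag n U d)) (dim_row (udiag n U d)) \<and>
     (\<forall>v \<in> carrier_vec (dim_row (udiag n U d)). \<forall>c::real. udiag n U d *\<^sub>v v = complex_of_real c \<cdot>\<^sub>v v \<longrightarrow>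
        B *\<^sub>v v = complex_of_real (f c) \<cdot>\<^sub>v v)"
  thus "B = udiag n U (\<lambda>i. f (d i))"
    unfolding dim using c udiag_col_eigenvector[OF U, of _ d] by (intro udiag_eqI[OF U]) auto
qed

section \<open>The spectral theorem and quadratic forms\<close>

lemma nsq_smult: "nsq (c \<cdot>\<^sub>v v) = (cmod c)\<^sup>2 * nsq v"
  by (simp add: nsq_def norm_mult power_mult_distrib sum_distrib_left)

text \<open>The reflection in the hyperplane orthogonal to \<open>u = v - e_0\<close> exchanges
  \<open>e_0\<close> and \<open>v\<close>, provided that the two have equal norm and a real inner
  product; the latter is the assumption on the first coordinate of \<open>v\<close>.\<close>

lemma householder_unitary:
  assumes v: "v \<in> carrier_vec n" and n: "0 < n" and "nsq v = 1" and re: "Im (v $ 0) = 0"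
  shows "\<exists>W. unitary_mat n W \<and> W *\<^sub>v unit_vec n 0 = v"
proof -
  define u where "u = v - unit_vec n 0"
  define s where "s = nsq u"
  have u: "u \<in> carrier_vec n" using v by (simp add: u_def)
  have ui: "u $ i = v $ i - (if i = 0 then 1 else 0)" if "i < n" for i
    using that v by (simp add: u_def)
  have "s = (\<Sum>i<n. (cmod (v $ i))\<^sup>2 + (if i = 0 then 1 - 2 * Re (v $ 0) else 0))"
    unfolding s_def nsq_def carrier_vecD[OF u]
  proof (intro sum.cong refl)
    fix i assume "i \<in> {..<n}"
    thus "(cmod (u $ i))\<^sup>2 = (cmod (v $ i))\<^sup>2 + (if i = 0 then 1 - 2 * Re (v $ 0) else 0)"
      using re by (cases "i = 0") (simp_all add: ui cmod_power2, simp add: power2_eq_square algebra_simps)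
  qed
  also have "\<dots> = 2 - 2 * Re (v $ 0)"
    using assms by (simp add: sum.distrib nsq_def)
  finally have s: "s = 2 - 2 * Re (v $ 0)" .
  have u0: "u $ 0 = complex_of_real (- s / 2)"
    using ui[OF n] re by (simp add: s complex_eq_iff)
  show ?thesis
  proof (cases "s = 0")
    case True
    hence "u = 0\<^sub>v n" using nsq_eq_0[OF u] s_def by simp
    have "v = unit_vec n 0"
    proof (rule eq_vecI)
      fix i assume "i < dim_vec (unit_vec n 0 :: complex vec)"
      hence i: "i < n" by simp
      have "u $ i = 0" using \<open>u = 0\<^sub>v n\<close> i by simp
      thus "v $ i = unit_vec n 0 $ i" using ui[OF i] i n by auto
    qed (use v in auto)
    thus ?thesis using unitary_one[of n] by (intro exI[of _ "1\<^sub>m n"]) auto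
  next
    case False
    define c where "c = complex_of_real (2 / s)"
    define W where "W = mat n n (\<lambda>(i,j). (if i = j then 1 else 0) - c * (u $ i * cnj (u $ j)))"
    have W: "W \<in> carrier_mat n n" by (simp add: W_def)
    have Wi: "W $$ (i,j) = (if i = j then 1 else 0) - c * (u $ i * cnj (u $ j))"
      if "i < n" "j < n" for i j
      using that by (simp add: W_def)
    have adj: "W\<dagger> = W"
      by (rule eq_matI) (auto simp: W_def c_def)
    have su: "(\<Sum>k<n. cnj (u $ k) * u $ k) = complex_of_real s"
      using cip_self[of u] u by (simp add: cip_def s_def)
    have cs: "c * (c * complex_of_real s) = 2 * c" using False by (simp add: c_def)
    have "W * W = 1\<^sub>m n"
    proof (rule eq_matI)
      fix i j assume "i < dim_row (1\<^sub>m n :: complex mat)" "j < dim_col (1\<^sub>m n :: complex mat)"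
      hence ij: "i < n" "j < n" by auto
      have "(W * W) $$ (i,j) = (\<Sum>k<n. W $$ (i,k) * W $$ (k,j))"
        by (rule index_mult_mat_sum[OF W W ij])
      also have "\<dots> = (\<Sum>k<n. (if k = i then (if i = j then 1 else 0) - c * (u $ i * cnj (u $ j)) else 0)
         + ((if k = j then - c * (u $ i * cnj (u $ j)) else 0)
         + c * c * (u $ i * cnj (u $ j)) * (cnj (u $ k) * u $ k)))"
        by (intro sum.cong refl) (use ij in \<open>auto simp: Wi algebra_simps\<close>)
      also have "\<dots> = (if i = j then 1 else 0) - 2 * c * (u $ i * cnj (u $ j))
         + c * c * (u $ i * cnj (u $ j)) * (\<Sum>k<n. cnj (u $ k) * u $ k)"
        unfolding sum.distrib sum_distrib_left[symmetric] using ij by simp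
      also have "\<dots> = (if i = j then 1 else 0) - 2 * c * (u $ i * cnj (u $ j))
         + c * (c * complex_of_real s) * (u $ i * cnj (u $ j))"
        unfolding su by (simp add: mult_ac)
      also have "\<dots> = (1\<^sub>m n) $$ (i,j)" unfolding cs using ij by simp
      finally show "(W * W) $$ (i,j) = (1\<^sub>m n) $$ (i,j)" .
    qed (use W in auto)
    hence uW: "unitary_mat n W" using W adj by (simp add: unitary_mat_def)
    have "W *\<^sub>v unit_vec n 0 = v"
    proof (rule eq_vecI)
      fix i assume "i < dim_vec v"
      hence i: "i < n" using v by simp
      have "(W *\<^sub>v unit_vec n 0) $ i = W $$ (i,0)" using W i n by simp
      also have "\<dots> = (if i = 0 then 1 else 0) - c * cnj (u $ 0) * u $ i"
        using Wi[OF i n] by (simp add: mult_ac)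
      also have "c * cnj (u $ 0) = -1" unfolding u0 c_def using False by (simp add: field_simps)
      also have "(if i = 0 then 1 else 0) - (-1) * u $ i = v $ i" using ui[OF i] by simp
      finally show "(W *\<^sub>v unit_vec n 0) $ i = v $ i" .
    qed (use W v in auto)
    thus ?thesis using uW by blast
  qed
qed

text \<open>The characteristic polynomial splits over the complex numbers, which gives an
  eigenvector. The scalar factor not only normalizes it but rotates its phase until the first
  coordinate is real, as the Householder reflection requires.\<close>

lemma ex_unit_eigenvector:
  fixes A :: "complex mat"
  assumes A: "A \<in> carrier_mat n n" and n: "0 < n"
  shows "\<exists>v l. v \<in> carrier_vec n \<and> nsq v = 1 \<and> Im (v $ 0) = 0 \<and> A *\<^sub>v v = l \<cdot>\<^sub>v v"
proof -
  obtain as where as: "char_poly A = (\<Prod>a\<leftarrow>as. [:- a, 1:])" "length as = n"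
    using char_poly_factorized[OF A] by blast
  then obtain l as' where "as = l # as'" using n by (cases as) auto
  hence "eigenvalue A l" unfolding eigenvalue_root_char_poly[OF A] as by simp
  then obtain w where w: "w \<in> carrier_vec n" "w \<noteq> 0\<^sub>v n" "A *\<^sub>v w = l \<cdot>\<^sub>v w"
    using A by (auto simp: eigenvalue_def eigenvector_def)
  define ph where "ph = (if w $ 0 = 0 then 1 else cnj (w $ 0) / complex_of_real (cmod (w $ 0)))"
  define c where "c = ph / complex_of_real (sqrt (nsq w))"
  have p: "nsq w > 0" using w nsq_eq_0[OF w(1)] nsq_nonneg[of w] by linarith
  have cp: "cmod ph = 1" by (simp add: ph_def norm_divide)
  have "nsq (c \<cdot>\<^sub>v w) = 1"
    using p cp by (simp add: nsq_smult c_def norm_divide power_divide)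
  moreover have "Im ((c \<cdot>\<^sub>v w) $ 0) = 0"
  proof -
    have "ph * w $ 0 = complex_of_real (cmod (w $ 0))"
      using complex_norm_square[of "w $ 0"]
      by (auto simp: ph_def field_simps power2_eq_square)
    hence "(c \<cdot>\<^sub>v w) $ 0 = complex_of_real (cmod (w $ 0) / sqrt (nsq w))"
      using w n by (simp add: c_def)
    thus ?thesis by simp
  qed
  moreover have "A *\<^sub>v (c \<cdot>\<^sub>v w) = l \<cdot>\<^sub>v (c \<cdot>\<^sub>v w)"
    using A w by (simp add: mult_mat_vec[of _ n n] smult_smult_assoc mult.commute)
  ultimately show ?thesis using w(1) by (intro exI[of _ "c \<cdot>\<^sub>v w"] exI[of _ l]) auto
qed

section \<open>Direct sums of matrices\<close>

definition bdiag :: "complex mat \<Rightarrow> complex mat \<Rightarrow> complex mat" where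
  "bdiag X Y = four_block_mat X (0\<^sub>m (dim_row X) (dim_col Y)) (0\<^sub>m (dim_row Y) (dim_col X)) Y"

lemma bdiag_carrier [simp]:
  "X \<in> carrier_mat n n \<Longrightarrow> Y \<in> carrier_mat m m \<Longrightarrow> bdiag X Y \<in> carrier_mat (n + m) (n + m)"
  by (simp add: bdiag_def)

lemma bdiag_mult:
  assumes "X \<in> carrier_mat n n" "Y \<in> carrier_mat m m" "X' \<in> carrier_mat n n" "Y' \<in> carrier_mat m m"
  shows "bdiag X Y * bdiag X' Y' = bdiag (X * X') (Y * Y')"
  using assms unfolding bdiag_def
  by (subst mult_four_block_mat[of _ n n _ m _ m]) auto

lemma bdiag_adjoint:
  assumes "X \<in> carrier_mat n n" "Y \<in> carrier_mat m m"
  shows "(bdiag X Y)\<dagger> = bdiag (X\<dagger>) (Y\<dagger>)"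
  using assms unfolding bdiag_def by (intro eq_matI) auto

lemma bdiag_one: "bdiag (1\<^sub>m n) (1\<^sub>m m) = 1\<^sub>m (n + m)"
  unfolding bdiag_def by (intro eq_matI) auto

lemma bdiag_vec:
  assumes "X \<in> carrier_mat n n" "Y \<in> carrier_mat m m" "x \<in> carrier_vec n" "y \<in> carrier_vec m"
  shows "bdiag X Y *\<^sub>v (x @\<^sub>v y) = (X *\<^sub>v x) @\<^sub>v (Y *\<^sub>v y)"
  using assms unfolding bdiag_def
  by (subst four_block_mat_mult_vec[of _ n n _ m _ m]) auto

lemma unitary_bdiag:
  assumes "unitary_mat n U" "unitary_mat m V"
  shows "unitary_mat (n + m) (bdiag U V)"
  using unitary_carrier[OF assms(1)] unitary_carrier[OF assms(2)] assms unfolding unitary_mat_def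
  by (auto simp: bdiag_adjoint[of _ n _ m] bdiag_mult[of _ n _ m] bdiag_one)

lemma udiag_bdiag:
  assumes "U \<in> carrier_mat n n" "V \<in> carrier_mat m m"
  shows "udiag (n + m) (bdiag U V) (\<lambda>i. if i < n then a i else b (i - n)) = bdiag (udiag n U a) (udiag m V b)"
proof -
  have "mat_diag (n + m) (\<lambda>i. complex_of_real (if i < n then a i else b (i - n)))
      = bdiag (mat_diag n (\<lambda>i. complex_of_real (a i))) (mat_diag m (\<lambda>i. complex_of_real (b i)))"
    unfolding bdiag_def by (intro eq_matI) (auto simp: mat_diag_def)
  thus ?thesis using assms unfolding udiag_def
    by (simp add: bdiag_adjoint[of _ n _ m] bdiag_mult[of _ n _ m])
qed

lemma sum_lessThan_add:
  fixes f :: "nat \<Rightarrow> 'a :: comm_monoid_add"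
  shows "(\<Sum>i<n + m. f i) = (\<Sum>i<n. f i) + (\<Sum>i<m. f (n + i))"
  by (induction m) (auto simp: add_ac)

lemma cip_append:
  assumes "x \<in> carrier_vec n" "y \<in> carrier_vec m" "x' \<in> carrier_vec n" "y' \<in> carrier_vec m"
  shows "cip (x @\<^sub>v y) (x' @\<^sub>v y') = cip x x' + cip y y'"
proof -
  have "cip (x @\<^sub>v y) (x' @\<^sub>v y') = (\<Sum>i<n + m. cnj ((x @\<^sub>v y) $ i) * (x' @\<^sub>v y') $ i)"
    using assms by (simp add: cip_def)
  also have "\<dots> = (\<Sum>i<n. cnj ((x @\<^sub>v y) $ i) * (x' @\<^sub>v y') $ i)
     + (\<Sum>i<m. cnj ((x @\<^sub>v y) $ (n + i)) * (x' @\<^sub>v y') $ (n + i))"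
    by (rule sum_lessThan_add)
  also have "\<dots> = cip x x' + cip y y'"
    using assms by (simp add: cip_def)
  finally show ?thesis .
qed

text \<open>Deflation: a unitary \<open>W\<close> carries the first basis vector to a unit
  eigenvector, so the first column of the conjugated matrix \<open>M\<close> is \<open>l\<close>
  times that basis vector. Self-adjointness clears the first row as well and makes \<open>l\<close>
  real, which leaves a self-adjoint block of size \<open>m\<close> for the induction.\<close>

theorem hermitian_spectral:
  assumes "A \<in> carrier_mat n n" "A\<dagger> = A"
  shows "\<exists>U d. unitary_mat n U \<and> A = udiag n U d"
  using assms
proof (induction n arbitrary: A)
  case 0
  have "A = udiag 0 (1\<^sub>m 0) (\<lambda>_. 0)"
    using 0 by (intro eq_matI) (auto simp: udiag_def)
  thus ?case using unitary_one by blast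
next
  case (Suc m)
  let ?n = "Suc m" and ?e = "unit_vec (Suc m) 0 :: complex vec"
  note A = Suc.prems(1)
  obtain v l where v: "v \<in> carrier_vec ?n" "nsq v = 1" "Im (v $ 0) = 0" "A *\<^sub>v v = l \<cdot>\<^sub>v v"
    using ex_unit_eigenvector[OF A] by auto
  obtain W where W: "unitary_mat ?n W" "W *\<^sub>v ?e = v"
    using householder_unitary[OF v(1) _ v(2,3)] by auto
  note Wc = unitary_carrier[OF W(1)]
  define M where "M = W\<dagger> * A * W"
  have M: "M \<in> carrier_mat ?n ?n" using A Wc by (simp add: M_def)
  have Madj: "M\<dagger> = M"
    using A Wc Suc.prems(2) unfolding M_def
    by (simp add: mat_adjoint_mult[where nr = ?n and n = ?n and nc = ?n] mult_square_assoc[of _ ?n])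
  have "M *\<^sub>v ?e = W\<dagger> *\<^sub>v (A *\<^sub>v (W *\<^sub>v ?e))"
    using A Wc unfolding M_def by (simp add: assoc_mult_mat_vec[of _ ?n ?n _ ?n])
  also have "\<dots> = l \<cdot>\<^sub>v (W\<dagger> *\<^sub>v (W *\<^sub>v ?e))"
    using v Wc unfolding W(2) by (simp add: mult_mat_vec[of _ ?n ?n])
  also have "\<dots> = l \<cdot>\<^sub>v ?e" using unitary_cancel_vec(1)[OF W(1), of ?e] by simp
  finally have Me: "M *\<^sub>v ?e = l \<cdot>\<^sub>v ?e" .
  have M0: "M $$ (i,0) = (if i = 0 then l else 0)" if "i < ?n" for i
  proof -
    have "M $$ (i,0) = (M *\<^sub>v ?e) $ i" using M that by simp
    thus ?thesis unfolding Me using that by auto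
  qed
  have Mc: "cnj (M $$ (j,i)) = M $$ (i,j)" if "i < ?n" "j < ?n" for i j
    using index_mat_adjoint[of i M j] that M unfolding Madj by simp
  have M0': "M $$ (0,i) = (if i = 0 then l else 0)" if "i < ?n" for i
    using Mc[of 0 i] that M0[OF that] Mc[of 0 0] M0[of 0] by (auto split: if_splits)
  have l: "l = complex_of_real (Re l)"
    using Mc[of 0 0] M0[of 0] by (simp add: complex_eq_iff)
  define A3 where "A3 = mat m m (\<lambda>(i,j). M $$ (Suc i, Suc j))"
  have "A3 \<in> carrier_mat m m" "A3\<dagger> = A3"
    using Mc by (auto simp: A3_def intro!: eq_matI)
  then obtain U3 d3 where U3: "unitary_mat m U3" "A3 = udiag m U3 d3"
    using Suc.IH by blast
  note U3c = unitary_carrier[OF U3(1)]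
  have o: "udiag 1 (1\<^sub>m 1) (\<lambda>_. Re l) = mat 1 1 (\<lambda>_. l)"
    unfolding udiag_def using l by (intro eq_matI) (auto simp: mat_diag_def)
  have "M = bdiag (mat 1 1 (\<lambda>_. l)) A3"
  proof (rule eq_matI)
    fix i j assume "i < dim_row (bdiag (mat 1 1 (\<lambda>_. l)) A3)" "j < dim_col (bdiag (mat 1 1 (\<lambda>_. l)) A3)"
    hence "i < ?n" "j < ?n" by (auto simp: bdiag_def A3_def)
    thus "M $$ (i,j) = bdiag (mat 1 1 (\<lambda>_. l)) A3 $$ (i,j)"
      by (cases i; cases j) (auto simp: bdiag_def A3_def M0 M0')
  qed (use M in \<open>auto simp: bdiag_def A3_def\<close>)
  also have "\<dots> = udiag (1 + m) (bdiag (1\<^sub>m 1) U3) (\<lambda>i. if i < 1 then Re l else d3 (i - 1))"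
    by (simp only: udiag_bdiag[OF one_carrier_mat U3c, where a = "\<lambda>_. Re l" and b = d3] o U3(2))
  finally obtain V d where V: "unitary_mat ?n V" "M = udiag ?n V d"
    using unitary_bdiag[OF unitary_one[of 1] U3(1)] by auto
  have "A = W * M * W\<dagger>"
  proof -
    have "W * M * W\<dagger> = (W * W\<dagger>) * A * (W * W\<dagger>)"
      using A Wc unfolding M_def by (simp add: mult_square_assoc[of _ ?n])
    thus ?thesis using A W(1) by (simp add: unitary_right)
  qed
  also have "\<dots> = udiag ?n (W * V) d"
    unfolding V(2) by (rule udiag_conj[OF Wc unitary_carrier[OF V(1)]])
  finally show ?case using unitary_mult[OF W(1) V(1)] by blast
qed

lemma rq_udiag_col:
  assumes "unitary_mat n U" "i < n"
  shows "rq (udiag n U d) (U *\<^sub>v unit_vec n i) = d i"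
proof -
  have "rq (udiag n U d) (U *\<^sub>v unit_vec n i) = (\<Sum>k<n. d k * (cmod (unit_vec n i $ k))\<^sup>2)"
    using assms unitary_carrier[OF assms(1)]
    by (subst rq_udiag) (auto simp: unitary_cancel_vec simp del: index_unit_vec)
  also have "\<dots> = (\<Sum>k<n. if k = i then d i else 0)"
    using assms by (intro sum.cong) auto
  finally show ?thesis using assms by simp
qed

lemma rq_qform: "rq A v = Re (qform A v)"
  by (simp add: rq_def qform_cip)

lemma psd_iff:
  assumes "A \<in> carrier_mat n n"
  shows "psd_mat A \<longleftrightarrow> A\<dagger> = A \<and> (\<forall>v\<in>carrier_vec n. 0 \<le> rq A v)"
  using assms by (simp add: psd_mat_def rq_qform hermitian_mat_iff[of _ n])

lemma psd_spectral:
  assumes "A \<in> carrier_mat n n" "psd_mat A"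
  obtains U d where "unitary_mat n U" "A = udiag n U d" "\<And>i. i < n \<Longrightarrow> d i \<ge> 0"
proof -
  obtain U d where U: "unitary_mat n U" "A = udiag n U d"
    using hermitian_spectral[of A n] assms by (auto simp: psd_iff[of _ n])
  have "d i \<ge> 0" if "i < n" for i
    using assms rq_udiag_col[OF U(1) that, of d] unitary_carrier[OF U(1)] unfolding U(2)
    by (auto simp: psd_iff[of _ n] dest!: bspec[where x = "U *\<^sub>v unit_vec n i"])
  thus ?thesis using that U by blast
qed

lemma pd_spectral:
  assumes "A \<in> carrier_mat n n" "pd_mat A"
  obtains U d where "unitary_mat n U" "A = udiag n U d" "\<And>i. i < n \<Longrightarrow> d i > 0"
proof -
  obtain U d where U: "unitary_mat n U" "A = udiag n U d"
    using hermitian_spectral[of A n] assms by (auto simp: pd_mat_def hermitian_mat_iff[of _ n])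
  note c = unitary_carrier[OF U(1)]
  have "d i > 0" if i: "i < n" for i
  proof -
    have "U *\<^sub>v unit_vec n i \<noteq> 0\<^sub>v n"
    proof
      assume "U *\<^sub>v unit_vec n i = 0\<^sub>v n"
      hence "nsq (unit_vec n i :: complex vec) = 0"
        using unitary_nsq[OF U(1), of "unit_vec n i"] nsq_eq_0[of "0\<^sub>v n" n] by simp
      hence "(unit_vec n i :: complex vec) = 0\<^sub>v n" by (subst (asm) nsq_eq_0[of _ n]) auto
      thus False using i by simp
    qed
    thus ?thesis
      using assms rq_udiag_col[OF U(1) i, of d] c unfolding U(2) rq_qform
      by (auto simp: pd_mat_def dest!: bspec[where x = "U *\<^sub>v unit_vec n i"])
  qed
  thus ?thesis using that U by blast
qed

lemma psd_udiag:
  assumes "U \<in> carrier_mat n n" "\<And>i. i < n \<Longrightarrow> d i \<ge> 0"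
  shows "psd_mat (udiag n U d)"
  using assms
  by (auto simp: psd_iff[of _ n] udiag_adjoint rq_udiag intro!: sum_nonneg mult_nonneg_nonneg simp del: index_mult_mat_vec)

lemma pd_udiag:
  assumes "unitary_mat n U" "\<And>i. i < n \<Longrightarrow> d i > 0"
  shows "pd_mat (udiag n U d)"
  unfolding pd_mat_def
proof (intro conjI ballI impI)
  note c = unitary_carrier[OF assms(1)]
  show "hermitian_mat (udiag n U d)" by (rule udiag_hermitian[OF c])
  fix v :: "complex vec" assume v: "v \<in> carrier_vec (dim_row (udiag n U d))" "v \<noteq> 0\<^sub>v (dim_row (udiag n U d))"
  have vn: "v \<in> carrier_vec n" "v \<noteq> 0\<^sub>v n" using v carrier_matD(1)[OF udiag_carrier[OF c]] by auto
  have "nsq (U\<dagger> *\<^sub>v v) \<noteq> 0"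
    using vn nsq_eq_0[OF vn(1)] unitary_nsq[OF unitary_adjoint[OF assms(1)] vn(1)] by simp
  have "\<exists>k<n. (U\<dagger> *\<^sub>v v) $ k \<noteq> 0"
  proof (rule ccontr)
    assume "\<not> ?thesis"
    hence "nsq (U\<dagger> *\<^sub>v v) = 0" using c unfolding nsq_def by (simp del: index_mult_mat_vec)
    thus False using \<open>nsq (U\<dagger> *\<^sub>v v) \<noteq> 0\<close> by simp
  qed
  then obtain k where k: "k < n" "(U\<dagger> *\<^sub>v v) $ k \<noteq> 0" by blast
  have "0 < (\<Sum>k<n. d k * (cmod ((U\<dagger> *\<^sub>v v) $ k))\<^sup>2)"
    using k assms(2)
    by (intro sum_pos2[of _ k]) (auto simp: less_imp_le simp del: index_mult_mat_vec)
  thus "0 < Re (qform (udiag n U d) v)"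
    using rq_udiag[OF c vn(1)] by (simp add: rq_qform)
qed

section \<open>Quadratic forms, congruences and the Loewner order\<close>

lemma rq_add:
  assumes "A \<in> carrier_mat n n" "B \<in> carrier_mat n n" "v \<in> carrier_vec n"
  shows "rq (A + B) v = rq A v + rq B v"
  using assms by (simp add: rq_def add_mult_distrib_mat_vec[of _ n n] cip_add_right[of _ n])

lemma rq_minus:
  assumes "A \<in> carrier_mat n n" "B \<in> carrier_mat n n" "v \<in> carrier_vec n"
  shows "rq (A - B) v = rq A v - rq B v"
  using assms by (simp add: rq_def minus_mult_distrib_mat_vec[of _ n n] cip_minus_right[of _ n])

lemma smult_mat_vec:
  assumes "A \<in> carrier_mat n m" "v \<in> carrier_vec m"
  shows "(c \<cdot>\<^sub>m A) *\<^sub>v v = c \<cdot>\<^sub>v (A *\<^sub>v (v :: complex vec))"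
  using assms by (intro eq_vecI) (auto simp: scalar_prod_def sum_distrib_left mult_ac)

lemma rq_smult:
  assumes "A \<in> carrier_mat n n" "v \<in> carrier_vec n"
  shows "rq (complex_of_real c \<cdot>\<^sub>m A) v = c * rq A v"
  using assms by (simp add: rq_def smult_mat_vec[of _ n n] cip_smult_right[of _ n])

lemma rq_congruence:
  assumes "A \<in> carrier_mat n n" "T \<in> carrier_mat n n" "v \<in> carrier_vec n"
  shows "rq (T\<dagger> * A * T) v = rq A (T *\<^sub>v v)"
  using assms
  by (simp add: rq_def assoc_mult_mat_vec[of _ n n _ n] cip_adjoint[of _ n n])

lemma mat_adjoint_minus:
  fixes A B :: "complex mat"
  assumes "A \<in> carrier_mat n m" "B \<in> carrier_mat n m"
  shows "(A - B)\<dagger> = A\<dagger> - B\<dagger>"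
  using assms by (intro eq_matI) auto

lemma mat_adjoint_add:
  fixes A B :: "complex mat"
  assumes "A \<in> carrier_mat n m" "B \<in> carrier_mat n m"
  shows "(A + B)\<dagger> = A\<dagger> + B\<dagger>"
  using assms by (intro eq_matI) auto

lemma mat_adjoint_smult:
  fixes A :: "complex mat"
  shows "(c \<cdot>\<^sub>m A)\<dagger> = cnj c \<cdot>\<^sub>m A\<dagger>"
  by (intro eq_matI) auto

lemma loewner_le_iff:
  assumes "A \<in> carrier_mat n n" "B \<in> carrier_mat n n" "A\<dagger> = A" "B\<dagger> = B"
  shows "loewner_le A B \<longleftrightarrow> (\<forall>v\<in>carrier_vec n. rq A v \<le> rq B v)"
proof -
  have "B - A \<in> carrier_mat n n" using assms by (simp add: minus_carrier_mat)
  thus ?thesis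
    using assms by (simp add: loewner_le_def psd_iff[of _ n] mat_adjoint_minus[of _ n n] rq_minus[of _ n])
qed

section \<open>Dilation of operator monotone functions\<close>

lemma matfun_hermitian:
  assumes "A \<in> carrier_mat n n" "A\<dagger> = A"
  shows "matfun f A \<in> carrier_mat n n" "(matfun f A)\<dagger> = matfun f A"
proof -
  obtain U d where "unitary_mat n U" "A = udiag n U d"
    using hermitian_spectral[OF assms] by blast
  thus "matfun f A \<in> carrier_mat n n" "(matfun f A)\<dagger> = matfun f A"
    by (auto simp: matfun_udiag unitary_carrier udiag_adjoint)
qed

lemma matfun_unitary_conj:
  assumes "A \<in> carrier_mat n n" "A\<dagger> = A" "unitary_mat n V"
  shows "matfun f (V * A * V\<dagger>) = V * matfun f A * V\<dagger>"
proof -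
  obtain U d where U: "unitary_mat n U" "A = udiag n U d"
    using hermitian_spectral[OF assms(1,2)] by blast
  thus ?thesis using assms
    by (simp add: matfun_udiag udiag_conj unitary_carrier unitary_mult)
qed

lemma matfun_bdiag:
  assumes "A \<in> carrier_mat n n" "A\<dagger> = A" "B \<in> carrier_mat m m" "B\<dagger> = B"
  shows "matfun f (bdiag A B) = bdiag (matfun f A) (matfun f B)"
proof -
  obtain U d where U: "unitary_mat n U" "A = udiag n U d"
    using hermitian_spectral[OF assms(1,2)] by blast
  obtain V e where V: "unitary_mat m V" "B = udiag m V e"
    using hermitian_spectral[OF assms(3,4)] by blast
  have "matfun f (bdiag A B) = udiag (n + m) (bdiag U V) (\<lambda>i. f (if i < n then d i else e (i - n)))"
    unfolding U(2) V(2) udiag_bdiag[OF unitary_carrier[OF U(1)] unitary_carrier[OF V(1)], symmetric]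
    by (rule matfun_udiag[OF unitary_bdiag[OF U(1) V(1)]])
  also have "\<dots> = udiag (n + m) (bdiag U V) (\<lambda>i. if i < n then f (d i) else f (e (i - n)))"
    by (rule udiag_cong) simp
  also have "\<dots> = bdiag (matfun f A) (matfun f B)"
    unfolding udiag_bdiag[OF unitary_carrier[OF U(1)] unitary_carrier[OF V(1)], where a = "\<lambda>i. f (d i)" and b = "\<lambda>i. f (e i)"]
    by (simp add: matfun_udiag U V)
  finally show ?thesis .
qed

lemma pd_iff:
  assumes "A \<in> carrier_mat n n"
  shows "pd_mat A \<longleftrightarrow> A\<dagger> = A \<and> (\<forall>v\<in>carrier_vec n. v \<noteq> 0\<^sub>v n \<longrightarrow> 0 < rq A v)"
  using assms by (simp add: pd_mat_def rq_qform hermitian_mat_iff[of _ n])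

lemma pd_adjoint: "A \<in> carrier_mat n n \<Longrightarrow> pd_mat A \<Longrightarrow> A\<dagger> = A"
  by (simp add: pd_iff)

lemma psd_adjoint: "A \<in> carrier_mat n n \<Longrightarrow> psd_mat A \<Longrightarrow> A\<dagger> = A"
  by (simp add: psd_iff)

lemma rq_zero [simp]: "A \<in> carrier_mat n n \<Longrightarrow> rq A (0\<^sub>v n) = 0"
  by (simp add: rq_def cip_def)

lemma pd_imp_psd:
  assumes "A \<in> carrier_mat n n" "pd_mat A"
  shows "psd_mat A"
proof -
  have "0 \<le> rq A v" if "v \<in> carrier_vec n" for v
    using assms that by (cases "v = 0\<^sub>v n") (auto simp: pd_iff[of _ n] intro: less_imp_le)
  thus ?thesis using assms by (simp add: psd_iff[of _ n] pd_adjoint)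
qed

lemma pd_unitary_conj:
  assumes "A \<in> carrier_mat n n" "pd_mat A" "unitary_mat n V"
  shows "pd_mat (V * A * V\<dagger>)"
proof -
  obtain U d where U: "unitary_mat n U" "A = udiag n U d" "\<And>i. i < n \<Longrightarrow> d i > 0"
    using pd_spectral[OF assms(1,2)] by metis
  thus ?thesis using assms
    by (simp add: udiag_conj unitary_carrier pd_udiag unitary_mult)
qed

lemma pd_bdiag:
  assumes "A \<in> carrier_mat n n" "pd_mat A" "B \<in> carrier_mat m m" "pd_mat B"
  shows "pd_mat (bdiag A B)"
proof -
  obtain U d where U: "unitary_mat n U" "A = udiag n U d" "\<And>i. i < n \<Longrightarrow> d i > 0"
    using pd_spectral[OF assms(1,2)] by metis
  obtain V e where V: "unitary_mat m V" "B = udiag m V e" "\<And>i. i < m \<Longrightarrow> e i > 0"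
    using pd_spectral[OF assms(3,4)] by metis
  show ?thesis
    unfolding U(2) V(2) udiag_bdiag[OF unitary_carrier[OF U(1)] unitary_carrier[OF V(1)], symmetric]
    by (rule pd_udiag[OF unitary_bdiag[OF U(1) V(1)]]) (use U(3) V(3) in auto)
qed

lemma pd_congruence:
  assumes "A \<in> carrier_mat n n" "pd_mat A" "T \<in> carrier_mat n n" "R \<in> carrier_mat n n" "R * T = 1\<^sub>m n"
  shows "pd_mat (T\<dagger> * A * T)"
proof -
  have "0 < rq (T\<dagger> * A * T) v" if v: "v \<in> carrier_vec n" "v \<noteq> 0\<^sub>v n" for v
  proof -
    have "T *\<^sub>v v \<noteq> 0\<^sub>v n"
    proof
      assume "T *\<^sub>v v = 0\<^sub>v n"
      hence "R *\<^sub>v (T *\<^sub>v v) = 0\<^sub>v n" using assms by (auto intro!: eq_vecI)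
      moreover have "R *\<^sub>v (T *\<^sub>v v) = v"
        using assms v by (subst assoc_mult_mat_vec[of _ n n _ n, symmetric]) auto
      ultimately show False using v by simp
    qed
    thus ?thesis using assms v by (subst rq_congruence[of _ n]) (auto simp: pd_iff[of _ n])
  qed
  moreover have "(T\<dagger> * A * T)\<dagger> = T\<dagger> * A * T"
    using assms by (simp add: mat_adjoint_mult[where nr = n and n = n and nc = n] mult_square_assoc[of _ n] pd_adjoint)
  ultimately show ?thesis using assms by (subst pd_iff[of _ n]) auto
qed

lemma nsq_unitary_sum:
  assumes "unitary_mat n U" "v \<in> carrier_vec n"
  shows "(\<Sum>k<n. (cmod ((U\<dagger> *\<^sub>v v) $ k))\<^sup>2) = nsq v"
  using unitary_nsq[OF unitary_adjoint[OF assms(1)] assms(2)] unitary_carrier[OF assms(1)]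
  by (simp add: nsq_def del: index_mult_mat_vec)

lemma rq_udiag_const:
  assumes "unitary_mat n U" "v \<in> carrier_vec n"
  shows "rq (udiag n U (\<lambda>_. c)) v = c * nsq v"
  using assms
  by (simp add: rq_udiag unitary_carrier nsq_unitary_sum sum_distrib_left[symmetric] del: index_mult_mat_vec)

lemma rq_udiag_comp:
  assumes "unitary_mat n U" "v \<in> carrier_vec n"
  shows "rq (udiag n U a) (udiag n U b *\<^sub>v v) = rq (udiag n U (\<lambda>i. b i * a i * b i)) v"
proof -
  note c = unitary_carrier[OF assms(1)]
  have "rq (udiag n U a) (udiag n U b *\<^sub>v v) = rq ((udiag n U b)\<dagger> * udiag n U a * udiag n U b) v"
    using c assms by (subst rq_congruence[of _ n]) auto
  thus ?thesis using assms c by (simp add: udiag_adjoint udiag_mult)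
qed

lemma rq_one: "v \<in> carrier_vec n \<Longrightarrow> rq (1\<^sub>m n) v = nsq v"
  by (simp add: rq_def cip_self)

lemma nsq_udiag:
  assumes "unitary_mat n U" "v \<in> carrier_vec n"
  shows "nsq (udiag n U b *\<^sub>v v) = rq (udiag n U (\<lambda>i. b i * b i)) v"
  using rq_udiag_comp[OF assms, of "\<lambda>_. 1" b] assms unitary_carrier[OF assms(1)]
    rq_one[OF mult_mat_vec_carrier[OF udiag_carrier[OF unitary_carrier[OF assms(1)]] assms(2)], of b]
  by (simp add: udiag_one)

lemma rq_udiag_mono:
  assumes "U \<in> carrier_mat n n" "v \<in> carrier_vec n" "\<And>i. i < n \<Longrightarrow> a i \<le> b i"
  shows "rq (udiag n U a) v \<le> rq (udiag n U b) v"
  using assms by (auto simp: rq_udiag intro!: sum_mono mult_right_mono simp del: index_mult_mat_vec)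

lemma hermitian_bounds:
  assumes "A \<in> carrier_mat n n" "A\<dagger> = A"
  obtains M where "M > 0" "\<And>v. v \<in> carrier_vec n \<Longrightarrow> \<bar>rq A v\<bar> \<le> M * nsq v"
proof -
  obtain U d where U: "unitary_mat n U" "A = udiag n U d"
    using hermitian_spectral[OF assms] by blast
  \<comment> \<open>The summand 1 keeps \<open>M\<close> positive even if all eigenvalues
    vanish.\<close>
  define M where "M = 1 + (\<Sum>i<n. \<bar>d i\<bar>)"
  have M: "\<bar>d i\<bar> \<le> M" if "i < n" for i
  proof -
    have "\<bar>d i\<bar> \<le> (\<Sum>i<n. \<bar>d i\<bar>)" using that by (intro member_le_sum[of i "{..<n}" "\<lambda>i. \<bar>d i\<bar>"]) auto
    thus ?thesis by (simp add: M_def)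
  qed
  have "\<bar>rq A v\<bar> \<le> M * nsq v" if v: "v \<in> carrier_vec n" for v
  proof -
    note c = unitary_carrier[OF U(1)]
    have "rq A v \<le> rq (udiag n U (\<lambda>_. M)) v"
      unfolding U(2) using M by (intro rq_udiag_mono[OF c v]) (auto simp: abs_le_iff)
    moreover have "rq (udiag n U (\<lambda>_. - M)) v \<le> rq A v"
      unfolding U(2) using M by (intro rq_udiag_mono[OF c v]) (auto simp: abs_le_iff minus_le_iff)
    ultimately show ?thesis using U v by (simp add: rq_udiag_const abs_le_iff)
  qed
  moreover have "M > 0" unfolding M_def by (intro add_pos_nonneg sum_nonneg) auto
  ultimately show ?thesis using that by blast
qed

lemma ex_pos_lower_bound:
  fixes d :: "nat \<Rightarrow> real"
  assumes "\<And>i. i < n \<Longrightarrow> d i > 0"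
  shows "\<exists>m>0. \<forall>i<n. m \<le> d i"
proof (intro exI conjI allI impI)
  \<comment> \<open>The inserted 1 makes the minimum meaningful for \<open>n = 0\<close>.\<close>
  show "Min (insert 1 (d ` {..<n})) > 0" using assms by (subst Min_gr_iff) auto
  show "Min (insert 1 (d ` {..<n})) \<le> d i" if "i < n" for i using that by (intro Min_le) auto
qed

lemma pd_lower_bound:
  assumes "A \<in> carrier_mat n n" "pd_mat A"
  obtains m where "m > 0" "\<And>v. v \<in> carrier_vec n \<Longrightarrow> m * nsq v \<le> rq A v"
proof -
  obtain U d where U: "unitary_mat n U" "A = udiag n U d" "\<And>i. i < n \<Longrightarrow> d i > 0"
    using pd_spectral[OF assms(1,2)] by metis
  obtain m where m: "m > 0" "\<forall>i<n. m \<le> d i" using ex_pos_lower_bound[of n d] U(3) by blast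
  have "m * nsq v \<le> rq A v" if v: "v \<in> carrier_vec n" for v
    using rq_udiag_mono[OF unitary_carrier[OF U(1)] v, of "\<lambda>_. m" d] m U v
    by (simp add: rq_udiag_const)
  thus ?thesis using that m by blast
qed

text \<open>In eigencoordinates the cross term is split by Young's inequality with a free weight: a
  small \<open>t\<close> makes the factor at \<open>v\<close> close to 1 at the price of a large
  factor at \<open>w\<close>. The dilation and the block estimate \<open>rq_block_bound\<close> both
  rest on this trade-off.\<close>

lemma rq_add_vec_le:
  assumes "A \<in> carrier_mat n n" "psd_mat A" "v \<in> carrier_vec n" "w \<in> carrier_vec n" "t > 0"
  shows "rq A (v + w) \<le> (1 + t) * rq A v + (1 + 1 / t) * rq A w"
proof -
  obtain U d where U: "unitary_mat n U" "A = udiag n U d" "\<And>i. i < n \<Longrightarrow> d i \<ge> 0"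
    using psd_spectral[OF assms(1,2)] by metis
  note c = unitary_carrier[OF U(1)]
  let ?c = "\<lambda>v k. cmod ((U\<dagger> *\<^sub>v v) $ k)"
  have y: "(a + b)\<^sup>2 \<le> (1 + t) * a\<^sup>2 + (1 + 1 / t) * b\<^sup>2" for a b :: real
  proof -
    have "0 \<le> (t * a - b)\<^sup>2 / t" using assms by simp
    also have "\<dots> = t * a\<^sup>2 - 2 * a * b + b\<^sup>2 / t"
      using assms by (simp add: field_simps power2_eq_square)
    finally show ?thesis using assms by (simp add: power2_eq_square algebra_simps)
  qed
  have "rq A (v + w) = (\<Sum>k<n. d k * (?c (v + w) k)\<^sup>2)"
    unfolding U(2) using c assms by (subst rq_udiag) auto
  also have "\<dots> \<le> (\<Sum>k<n. d k * ((1 + t) * (?c v k)\<^sup>2 + (1 + 1 / t) * (?c w k)\<^sup>2))"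
  proof (intro sum_mono mult_left_mono)
    fix k assume k: "k \<in> {..<n}"
    have "(U\<dagger> *\<^sub>v (v + w)) $ k = (U\<dagger> *\<^sub>v v) $ k + (U\<dagger> *\<^sub>v w) $ k"
      using c assms k by (simp add: mult_add_distrib_mat_vec[of _ n n] del: index_mult_mat_vec)
    hence "?c (v + w) k \<le> ?c v k + ?c w k" by (metis norm_triangle_ineq)
    hence "(?c (v + w) k)\<^sup>2 \<le> (?c v k + ?c w k)\<^sup>2" by (intro power_mono) auto
    also have "\<dots> \<le> (1 + t) * (?c v k)\<^sup>2 + (1 + 1 / t) * (?c w k)\<^sup>2" by (rule y)
    finally show "(?c (v + w) k)\<^sup>2 \<le> (1 + t) * (?c v k)\<^sup>2 + (1 + 1 / t) * (?c w k)\<^sup>2" .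
  qed (use U(3) in auto)
  also have "\<dots> = (1 + t) * rq A v + (1 + 1 / t) * rq A w"
    unfolding U(2) rq_udiag[OF c assms(3)] rq_udiag[OF c assms(4)] sum_distrib_left sum.distrib[symmetric]
    by (intro sum.cong refl) (simp add: algebra_simps del: index_mult_mat_vec)
  finally show ?thesis .
qed

lemma rq_uminus_vec:
  assumes "A \<in> carrier_mat n n" "v \<in> carrier_vec n"
  shows "rq A (- v) = rq A v"
proof -
  have "- v = complex_of_real (-1) \<cdot>\<^sub>v v" using assms by (intro eq_vecI) auto
  thus ?thesis using assms
    by (simp add: rq_def mult_mat_vec[of _ n n] cip_smult_right[of _ n] cip_smult_left[of _ n])
qed

lemma rq_bdiag:
  assumes "X \<in> carrier_mat n n" "Y \<in> carrier_mat m m" "x \<in> carrier_vec n" "y \<in> carrier_vec m"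
  shows "rq (bdiag X Y) (x @\<^sub>v y) = rq X x + rq Y y"
  using assms by (simp add: rq_def bdiag_vec[of _ n _ m] cip_append[of _ n _ m])

lemma operator_monotone_rq:
  assumes "operator_monotone f" "A \<in> carrier_mat n n" "B \<in> carrier_mat n n" "pd_mat A" "pd_mat B"
    and "\<And>v. v \<in> carrier_vec n \<Longrightarrow> rq A v \<le> rq B v" and v: "v \<in> carrier_vec n"
  shows "rq (matfun f A) v \<le> rq (matfun f B) v"
proof -
  note adj = pd_adjoint[OF assms(2,4)] pd_adjoint[OF assms(3,5)]
  have "loewner_le A B" using assms adj by (subst loewner_le_iff[of _ n]) auto
  hence "loewner_le (matfun f A) (matfun f B)"
    using assms unfolding operator_monotone_def by blast
  thus ?thesis using v matfun_hermitian[OF assms(2) adj(1)] matfun_hermitian[OF assms(3) adj(2)]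
    by (subst (asm) loewner_le_iff[of _ n]) auto
qed

text \<open>The self-adjoint unitary \<open>W = [[T, S], [S, -T]]\<close> dilates the pair \<open>(T, S)\<close>; compressing
  \<open>f(W (X \<oplus> Z) W) \<le> f(Y \<oplus> \<mu>I)\<close> to the first block gives the claim. The slack \<open>m\<close> absorbs the
  off-diagonal blocks once \<open>\<mu>\<close> is large.\<close>

lemma operator_monotone_dilation:
  assumes om: "operator_monotone f"
    and T: "T \<in> carrier_mat n n" "T\<dagger> = T" and S: "S \<in> carrier_mat n n" "S\<dagger> = S"
    and TS: "T * S = S * T" "T * T + S * S = 1\<^sub>m n"
    and X: "X \<in> carrier_mat n n" "pd_mat X" and Z: "Z \<in> carrier_mat n n" "pd_mat Z"
    and Y: "Y \<in> carrier_mat n n" "pd_mat Y" and m: "m > 0"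
    and le: "\<And>v. v \<in> carrier_vec n \<Longrightarrow> rq X (T *\<^sub>v v) + rq Z (S *\<^sub>v v) + m * nsq v \<le> rq Y v"
    and v: "v \<in> carrier_vec n"
  shows "rq (matfun f X) (T *\<^sub>v v) + rq (matfun f Z) (S *\<^sub>v v) \<le> rq (matfun f Y) v"
proof -
  define W where "W = four_block_mat T S S (- T)"
  have W: "W \<in> carrier_mat (n + n) (n + n)" using T S by (simp add: W_def)
  have Wadj: "W\<dagger> = W"
  proof (rule eq_matI)
    have t: "cnj (T $$ (j,i)) = T $$ (i,j)" if "i < n" "j < n" for i j
      using index_mat_adjoint[of i T j] that T by simp
    have s: "cnj (S $$ (j,i)) = S $$ (i,j)" if "i < n" "j < n" for i j
      using index_mat_adjoint[of i S j] that S by simp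
    fix i j assume "i < dim_row W" "j < dim_col W"
    thus "W\<dagger> $$ (i,j) = W $$ (i,j)" using T(1) S(1) t s by (auto simp: W_def)
  qed (use T S in \<open>auto simp: W_def\<close>)
  have "W * W = four_block_mat (T * T + S * S) (T * S + S * (- T)) (S * T + (- T) * S) (S * S + (- T) * (- T))"
    unfolding W_def using T S by (subst mult_four_block_mat[of _ n n _ n _ n]) auto
  also have "\<dots> = four_block_mat (1\<^sub>m n) (0\<^sub>m n n) (0\<^sub>m n n) (1\<^sub>m n)"
  proof (intro cong_four_block_mat)
    show "T * S + S * (- T) = 0\<^sub>m n n" "S * T + (- T) * S = 0\<^sub>m n n"
      using T S TS(1) by (auto simp: uminus_carrier_mat)
    show "S * S + (- T) * (- T) = 1\<^sub>m n"
      using T S TS(2) comm_add_mat[of "S * S" n n "T * T"] by simp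
  qed (use TS in auto)
  finally have "W * W = 1\<^sub>m (n + n)" by simp
  hence uW: "unitary_mat (n + n) W" using W Wadj by (simp add: unitary_mat_def)
  define G where "G = W * bdiag X Z * W\<dagger>"
  have XZ: "bdiag X Z \<in> carrier_mat (n + n) (n + n)" "pd_mat (bdiag X Z)"
    using X Z by (auto intro: pd_bdiag)
  have G: "G \<in> carrier_mat (n + n) (n + n)" "pd_mat G"
    using XZ W pd_unitary_conj[OF XZ uW] by (auto simp: G_def)
  have rqW: "rq (W * bdiag X' Z' * W\<dagger>) (x @\<^sub>v y) =
      rq X' (T *\<^sub>v x + S *\<^sub>v y) + rq Z' (S *\<^sub>v x + - (T *\<^sub>v y))"
    if "X' \<in> carrier_mat n n" "Z' \<in> carrier_mat n n" "x \<in> carrier_vec n" "y \<in> carrier_vec n" for X' Z' x y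
  proof -
    have "rq (W * bdiag X' Z' * W\<dagger>) (x @\<^sub>v y) = rq (bdiag X' Z') (W *\<^sub>v (x @\<^sub>v y))"
      using rq_congruence[of "bdiag X' Z'" "n + n" "W" "x @\<^sub>v y"] that W Wadj by simp
    also have "W *\<^sub>v (x @\<^sub>v y) = (T *\<^sub>v x + S *\<^sub>v y) @\<^sub>v (S *\<^sub>v x + - (T *\<^sub>v y))"
      unfolding W_def using that T S by (subst four_block_mat_mult_vec[of _ n n _ n _ n]) auto
    also have "rq (bdiag X' Z') \<dots> = rq X' (T *\<^sub>v x + S *\<^sub>v y) + rq Z' (S *\<^sub>v x + - (T *\<^sub>v y))"
      using that T S by (intro rq_bdiag[of _ n _ n]) auto
    finally show ?thesis .
  qed
  obtain MX where MX: "MX > 0" "\<And>v. v \<in> carrier_vec n \<Longrightarrow> \<bar>rq X v\<bar> \<le> MX * nsq v"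
    using hermitian_bounds[OF X(1) pd_adjoint[OF X]] by metis
  obtain MZ where MZ: "MZ > 0" "\<And>v. v \<in> carrier_vec n \<Longrightarrow> \<bar>rq Z v\<bar> \<le> MZ * nsq v"
    using hermitian_bounds[OF Z(1) pd_adjoint[OF Z]] by metis
  \<comment> \<open>Since the squares of \<open>T\<close> and \<open>S\<close> add up to the
    identity, the two matrices split the squared norm, so that a common bound \<open>M\<close> for
    both forms is also a bound for their sum.\<close>
  have split: "nsq (T *\<^sub>v y) + nsq (S *\<^sub>v y) = nsq y" if y: "y \<in> carrier_vec n" for y
  proof -
    have "nsq (T *\<^sub>v y) = rq (T * T) y" "nsq (S *\<^sub>v y) = rq (S * S) y"
      using rq_congruence[of "1\<^sub>m n" n T y] rq_congruence[of "1\<^sub>m n" n S y] T S y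
      by (auto simp: rq_one)
    thus ?thesis using rq_add[of "T * T" n "S * S" y] T S y TS(2) by (simp add: rq_one)
  qed
  define M where "M = max MX MZ"
  have M: "M > 0" using MX by (simp add: M_def)
  have bX: "rq X y \<le> M * nsq y" and bZ: "rq Z y \<le> M * nsq y" if "y \<in> carrier_vec n" for y
  proof -
    have "MX * nsq y \<le> M * nsq y" "MZ * nsq y \<le> M * nsq y"
      by (auto simp: M_def intro!: mult_right_mono)
    thus "rq X y \<le> M * nsq y" "rq Z y \<le> M * nsq y" using MX(2)[OF that] MZ(2)[OF that] by linarith+
  qed
  \<comment> \<open>With this weight the excess \<open>t * (M * nsq x)\<close> uses up exactly the
    slack \<open>m * nsq x\<close>; \<open>\<mu>\<close> is the factor that results in front of
    \<open>nsq y\<close>.\<close>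
  define t where "t = m / M"
  have t: "t > 0" using m M by (simp add: t_def)
  define \<mu> where "\<mu> = (1 + 1 / t) * M"
  have mu: "\<mu> > 0" using t M by (simp add: \<mu>_def add_pos_pos)
  define E where "E = bdiag Y (udiag n (1\<^sub>m n) (\<lambda>_. \<mu>))"
  have I: "udiag n (1\<^sub>m n) (\<lambda>_. \<mu>) \<in> carrier_mat n n" "pd_mat (udiag n (1\<^sub>m n) (\<lambda>_. \<mu>))"
    using mu by (auto intro!: pd_udiag unitary_one)
  have E: "E \<in> carrier_mat (n + n) (n + n)" "pd_mat E"
    using Y(1) I(1) pd_bdiag[OF Y I] by (auto simp: E_def)
  have GE: "rq G u \<le> rq E u" if u: "u \<in> carrier_vec (n + n)" for u
  proof -
    obtain x y where xy: "x \<in> carrier_vec n" "y \<in> carrier_vec n" "u = x @\<^sub>v y"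
      using vec_first_last_append[OF u] vec_first_carrier[of u n] vec_last_carrier[of u n] by metis
    have "rq G u = rq X (T *\<^sub>v x + S *\<^sub>v y) + rq Z (S *\<^sub>v x + - (T *\<^sub>v y))"
      unfolding G_def xy(3) using X Z xy by (intro rqW) auto
    also have "\<dots> \<le> ((1 + t) * rq X (T *\<^sub>v x) + (1 + 1 / t) * rq X (S *\<^sub>v y)) +
        ((1 + t) * rq Z (S *\<^sub>v x) + (1 + 1 / t) * rq Z (- (T *\<^sub>v y)))"
      using X Z T S xy t by (intro add_mono rq_add_vec_le[of _ n] pd_imp_psd) auto
    also have "rq Z (- (T *\<^sub>v y)) = rq Z (T *\<^sub>v y)"
      using Z T xy by (intro rq_uminus_vec[of _ n]) auto
    also have "((1 + t) * rq X (T *\<^sub>v x) + (1 + 1 / t) * rq X (S *\<^sub>v y)) +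
        ((1 + t) * rq Z (S *\<^sub>v x) + (1 + 1 / t) * rq Z (T *\<^sub>v y)) =
        rq X (T *\<^sub>v x) + rq Z (S *\<^sub>v x) + t * (rq X (T *\<^sub>v x) + rq Z (S *\<^sub>v x)) +
        (1 + 1 / t) * (rq X (S *\<^sub>v y) + rq Z (T *\<^sub>v y))"
      by (simp add: algebra_simps)
    also have "\<dots> \<le> rq X (T *\<^sub>v x) + rq Z (S *\<^sub>v x) + t * (M * nsq x) + (1 + 1 / t) * (M * nsq y)"
    proof (intro add_mono mult_left_mono order.refl)
      show "rq X (T *\<^sub>v x) + rq Z (S *\<^sub>v x) \<le> M * nsq x"
        using bX[of "T *\<^sub>v x"] bZ[of "S *\<^sub>v x"] T S xy
        by (simp add: split[OF xy(1), symmetric] distrib_left)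
      show "rq X (S *\<^sub>v y) + rq Z (T *\<^sub>v y) \<le> M * nsq y"
        using bX[of "S *\<^sub>v y"] bZ[of "T *\<^sub>v y"] T S xy
        by (simp add: split[OF xy(2), symmetric] distrib_left)
    qed (use t in auto)
    also have "t * (M * nsq x) = m * nsq x" using M by (simp add: t_def)
    also have "(1 + 1 / t) * (M * nsq y) = \<mu> * nsq y" by (simp add: \<mu>_def)
    also have "rq X (T *\<^sub>v x) + rq Z (S *\<^sub>v x) + m * nsq x + \<mu> * nsq y \<le> rq Y x + \<mu> * nsq y"
      using le[OF xy(1)] by simp
    also have "\<dots> = rq E u"
      unfolding E_def xy(3) using Y I xy
      by (simp add: rq_bdiag[of _ n _ n] rq_udiag_const[OF unitary_one])
    finally show ?thesis .
  qed
  have "rq (matfun f G) (v @\<^sub>v 0\<^sub>v n) \<le> rq (matfun f E) (v @\<^sub>v 0\<^sub>v n)"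
    using v by (intro operator_monotone_rq[OF om G(1) E(1) G(2) E(2) GE]) auto
  also have "matfun f E = bdiag (matfun f Y) (matfun f (udiag n (1\<^sub>m n) (\<lambda>_. \<mu>)))"
    unfolding E_def using Y I by (intro matfun_bdiag[of _ n _ n] pd_adjoint[of _ n]) auto
  also have "rq \<dots> (v @\<^sub>v 0\<^sub>v n) = rq (matfun f Y) v"
    using matfun_hermitian[OF Y(1) pd_adjoint[OF Y], of f] matfun_hermitian[OF I(1) pd_adjoint[OF I], of f] v
    by (simp add: rq_bdiag[of _ n _ n])
  also have "matfun f G = W * bdiag (matfun f X) (matfun f Z) * W\<dagger>"
    unfolding G_def matfun_unitary_conj[OF XZ(1) pd_adjoint[OF XZ] uW]
      matfun_bdiag[OF X(1) pd_adjoint[OF X] Z(1) pd_adjoint[OF Z]] ..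
  also have "rq \<dots> (v @\<^sub>v 0\<^sub>v n) = rq (matfun f X) (T *\<^sub>v v) + rq (matfun f Z) (S *\<^sub>v v)"
  proof -
    have 0: "T *\<^sub>v 0\<^sub>v n = 0\<^sub>v n" "S *\<^sub>v 0\<^sub>v n = 0\<^sub>v n" using T S by (auto intro!: eq_vecI)
    show ?thesis
      using matfun_hermitian[OF X(1) pd_adjoint[OF X], of f] matfun_hermitian[OF Z(1) pd_adjoint[OF Z], of f] v T S
      by (subst rqW) (auto simp: 0)
  qed
  finally show ?thesis .
qed

section \<open>Scalar consequences of operator monotonicity\<close>

lemma mult_square_vec [simp]:
  "A \<in> carrier_mat n n \<Longrightarrow> v \<in> carrier_vec n \<Longrightarrow> A *\<^sub>v v \<in> carrier_vec n"
  by (rule mult_mat_vec_carrier)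

text \<open>Positive scalars are treated as 1 x 1 matrices.\<close>

lemma operator_monotone_mono:
  assumes "operator_monotone f" "0 < x" "x \<le> y"
  shows "f x \<le> f y"
proof -
  note u = unitary_one[of 1]
  let ?e = "unit_vec 1 0 :: complex vec"
  have e: "nsq ?e = 1" by (rule nsq_unit_vec) simp
  have "rq (matfun f (udiag 1 (1\<^sub>m 1) (\<lambda>_. x))) ?e \<le> rq (matfun f (udiag 1 (1\<^sub>m 1) (\<lambda>_. y))) ?e"
    using assms by (intro operator_monotone_rq[of f _ 1] rq_udiag_mono pd_udiag u) auto
  thus ?thesis unfolding matfun_udiag[OF u] by (simp add: rq_udiag_const[OF u] e del: One_nat_def)
qed

text \<open>The dilation with the scalars \<open>T = sqrt t\<close> and
  \<open>S = sqrt (1 - t)\<close>. It demands a positive slack, hence the strict inequality, which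
  is removed once \<open>f\<close> is known to be continuous.\<close>

lemma operator_monotone_concave_strict:
  assumes om: "operator_monotone f" and x: "0 < x" "0 < y" and t: "0 \<le> t" "t \<le> 1"
    and z: "t * x + (1 - t) * y < z"
  shows "t * f x + (1 - t) * f y \<le> f z"
proof -
  note u = unitary_one[of 1]
  let ?D = "\<lambda>c. udiag 1 (1\<^sub>m 1) (\<lambda>_. c :: real)"
  let ?e = "unit_vec 1 0 :: complex vec"
  have e: "nsq ?e = 1" by (rule nsq_unit_vec) simp
  have "0 \<le> t * x + (1 - t) * y" using x t by auto
  hence z0: "z > 0" using z by linarith
  have sq: "sqrt t * c * sqrt t = t * c" "sqrt (1 - t) * c * sqrt (1 - t) = (1 - t) * c" for c
    using t by (simp_all add: mult.commute mult.left_commute)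
  have r: "rq (?D a) (?D b *\<^sub>v v) = b * a * b * nsq v" if "v \<in> carrier_vec 1" for a b v
    unfolding rq_udiag_comp[OF u that] rq_udiag_const[OF u that] ..
  have "rq (matfun f (?D x)) (?D (sqrt t) *\<^sub>v ?e) + rq (matfun f (?D y)) (?D (sqrt (1 - t)) *\<^sub>v ?e)
      \<le> rq (matfun f (?D z)) ?e"
  proof (rule operator_monotone_dilation[OF om, where n = 1 and m = "z - (t * x + (1 - t) * y)"])
    have "?D (sqrt t) * ?D (sqrt t) + ?D (sqrt (1 - t)) * ?D (sqrt (1 - t)) = ?D 1"
      using t unfolding udiag_mult[OF u] by (subst udiag_add) auto
    thus "?D (sqrt t) * ?D (sqrt t) + ?D (sqrt (1 - t)) * ?D (sqrt (1 - t)) = 1\<^sub>m 1"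
      using udiag_one[OF u] by simp
    show "?D (sqrt t) * ?D (sqrt (1 - t)) = ?D (sqrt (1 - t)) * ?D (sqrt t)"
      unfolding udiag_mult[OF u] by (simp add: mult.commute)
    fix v :: "complex vec" assume v: "v \<in> carrier_vec 1"
    show "rq (?D x) (?D (sqrt t) *\<^sub>v v) + rq (?D y) (?D (sqrt (1 - t)) *\<^sub>v v) +
        (z - (t * x + (1 - t) * y)) * nsq v \<le> rq (?D z) v"
      unfolding r[OF v] rq_udiag_const[OF u v] sq by (simp add: algebra_simps)
  qed (use x z z0 in \<open>auto intro!: pd_udiag u simp: udiag_adjoint simp del: One_nat_def\<close>)
  thus ?thesis
    unfolding matfun_udiag[OF u] r[OF unit_vec_carrier] rq_udiag_const[OF u unit_vec_carrier] e sq by simp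
qed

lemma km_function_nonneg: "km_function f \<Longrightarrow> 0 \<le> t \<Longrightarrow> 0 \<le> f t"
  and km_function_om: "km_function f \<Longrightarrow> operator_monotone f"
  and km_function_one: "km_function f \<Longrightarrow> f 1 = 1"
  by (simp_all add: km_function_def)

text \<open>Concavity between \<open>z\<close> and 0, where \<open>f\<close> is nonnegative. Only
  the strict form on the positive axis is at hand, so \<open>c\<close> is first reduced to
  \<open>s * c\<close> with \<open>s < 1\<close>, and 0 is replaced by a small
  \<open>y\<close>.\<close>

lemma km_function_scale:
  assumes f: "km_function f" and z: "0 < z" and c: "0 < c" "c \<le> 1"
  shows "c * f z \<le> f (c * z)"
proof (cases "c = 1")
  case False
  hence c1: "c < 1" using c by simp
  show ?thesis
  proof (rule field_le_mult_one_interval)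
    fix s :: real assume s: "0 < s" "s < 1"
    define t where "t = s * c"
    have t: "0 < t" "t < c" using s c by (auto simp: t_def)
    \<comment> \<open>Small enough for \<open>(1 - t) * y\<close> to stay strictly below the room
      \<open>(c - t) * z\<close> that the reduction of \<open>c\<close> has created.\<close>
    define y where "y = (c - t) * z / 2"
    have y: "0 < y" using t z by (simp add: y_def)
    have "(1 - t) * y \<le> 1 * y" using t y by (intro mult_right_mono) auto
    also have "1 * y < (c - t) * z" using t z by (simp add: y_def)
    finally have "t * z + (1 - t) * y < c * z" by (simp add: algebra_simps)
    hence "t * f z + (1 - t) * f y \<le> f (c * z)"
      using t c1 by (intro operator_monotone_concave_strict km_function_om[OF f] z y) auto
    moreover have "0 \<le> (1 - t) * f y"
      using t c1 km_function_nonneg[OF f, of y] y by auto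
    ultimately show "s * (c * f z) \<le> f (c * z)" by (simp add: t_def mult.assoc)
  qed
qed simp

text \<open>\<open>f\<close> is nondecreasing and, by \<open>km_function_scale\<close>,
  \<open>f t / t\<close> is nonincreasing. Together they trap \<open>f z\<close> between multiples
  of \<open>f x\<close> whose factors tend to 1, which is how continuity is obtained.\<close>

lemma km_function_bounds:
  assumes f: "km_function f" and x: "0 < x" and z: "0 < z"
  shows "min 1 (z / x) * f x \<le> f z" "f z \<le> max 1 (z / x) * f x"
proof -
  show "min 1 (z / x) * f x \<le> f z"
  proof (cases "x \<le> z")
    case True
    thus ?thesis using operator_monotone_mono[OF km_function_om[OF f] x True] x by simp
  next
    case False
    thus ?thesis using km_function_scale[OF f x, of "z / x"] x z by (simp add: min_def)
  qed
  show "f z \<le> max 1 (z / x) * f x"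
  proof (cases "z \<le> x")
    case True
    thus ?thesis using operator_monotone_mono[OF km_function_om[OF f] z True] x by simp
  next
    case False
    thus ?thesis using km_function_scale[OF f z, of "x / z"] x z by (simp add: max_def field_simps)
  qed
qed

lemma km_function_pos:
  assumes f: "km_function f" and z: "0 < z"
  shows "0 < f z"
proof -
  have "0 < min 1 z" using z by simp
  also have "min 1 z \<le> f z" using km_function_bounds(1)[OF f, of 1 z] z km_function_one[OF f] by simp
  finally show ?thesis .
qed

lemma km_function_isCont:
  assumes f: "km_function f" and x: "0 < x"
  shows "isCont f x"
  unfolding isCont_def
proof (rule tendsto_sandwich)
  have ev: "\<forall>\<^sub>F z in at x. 0 < z"
    using order_tendstoD(1)[OF tendsto_ident_at x] .
  show "\<forall>\<^sub>F z in at x. min 1 (z / x) * f x \<le> f z" "\<forall>\<^sub>F z in at x. f z \<le> max 1 (z / x) * f x"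
    using ev by (auto elim!: eventually_mono intro: km_function_bounds[OF f x])
  have "((\<lambda>z. min 1 (z / x) * f x) \<longlongrightarrow> min 1 (x / x) * f x) (at x)"
       "((\<lambda>z. max 1 (z / x) * f x) \<longlongrightarrow> max 1 (x / x) * f x) (at x)"
    by (intro tendsto_intros; use x in simp)+
  thus "((\<lambda>z. min 1 (z / x) * f x) \<longlongrightarrow> f x) (at x)" "((\<lambda>z. max 1 (z / x) * f x) \<longlongrightarrow> f x) (at x)"
    unfolding divide_self[OF less_imp_neq[OF x, symmetric]] by simp_all
qed

text \<open>The strict version holds for every \<open>z\<close> above the convex combination; let
  \<open>z\<close> decrease to it and use continuity.\<close>

lemma km_function_concave:
  assumes f: "km_function f"
  shows "concave_on {0<..} f"
  unfolding concave_on_iff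
proof (intro conjI ballI allI impI)
  fix x y u v :: real assume x: "x \<in> {0<..}" "y \<in> {0<..}" and uv: "0 \<le> u" "0 \<le> v" "u + v = 1"
  let ?w = "u * x + v * y"
  have w: "0 < ?w"
  proof (cases "u = 0")
    case False
    thus ?thesis using x uv by (intro add_pos_nonneg) auto
  qed (use x uv in auto)
  have v: "v = 1 - u" using uv by simp
  have "((\<lambda>z. f z) \<longlongrightarrow> f ?w) (at_right ?w)"
    using km_function_isCont[OF f w] by (auto simp: isCont_def intro: tendsto_mono[OF at_le])
  moreover have "\<forall>\<^sub>F z in at_right ?w. u * f x + v * f y \<le> f z"
    using eventually_at_right_less[of ?w]
  proof (rule eventually_mono)
    fix z assume "?w < z"
    thus "u * f x + v * f y \<le> f z"
      unfolding v using x uv by (intro operator_monotone_concave_strict km_function_om[OF f]) auto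
  qed
  ultimately have "u * f x + v * f y \<le> f ?w"
    by (rule tendsto_lowerbound) simp
  thus "f (u *\<^sub>R x + v *\<^sub>R y) \<ge> u * f x + v * f y" by simp
qed auto

text \<open>A concave function lies below its tangents; the one at 1 has slope \<alpha>. This is the
  scalar form of the arithmetic upper bound.\<close>

lemma km_function_tangent:
  assumes f: "km_function f" and d: "(f has_real_derivative \<alpha>) (at 1)" and t: "0 < t"
  shows "f t \<le> 1 - \<alpha> + \<alpha> * t"
proof -
  have "convex_on {0<..} (\<lambda>x. - f x)" using km_function_concave[OF f] by (simp add: concave_on_def)
  moreover have "((\<lambda>x. - f x) has_real_derivative - \<alpha>) (at 1 within {0<..})"
    using DERIV_minus[OF d] by (rule has_field_derivative_at_within)
  ultimately have "- f t - (- f 1) \<ge> - \<alpha> * (t - 1)"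
    using t by (intro convex_on_imp_above_tangent[of "{0<..}" "\<lambda>x. - f x"]) (auto simp: interior_open)
  thus ?thesis using km_function_one[OF f] by (simp add: algebra_simps)
qed

text \<open>The form of the inverse of \<open>A\<close> at \<open>v\<close> is the maximum over
  \<open>x\<close> of \<open>2 * Re (cip v x) - rq A x\<close>, an expression that decreases when
  \<open>A\<close> grows. The first fact is the inequality for a general \<open>x\<close>; for
  \<open>B\<close> equality is attained at the inverse of \<open>B\<close> applied to
  \<open>v\<close>.\<close>

lemma rq_inverse_antimono:
  assumes A: "A \<in> carrier_mat n n" "pd_mat A" and B: "B \<in> carrier_mat n n" "pd_mat B"
    and le: "\<And>v. v \<in> carrier_vec n \<Longrightarrow> rq A v \<le> rq B v" and v: "v \<in> carrier_vec n"
  shows "rq (matfun inverse B) v \<le> rq (matfun inverse A) v"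
proof -
  have *: "2 * Re (cip v x) - rq A x \<le> rq (matfun inverse A) v"
    if A: "A \<in> carrier_mat n n" "pd_mat A" and x: "x \<in> carrier_vec n" for A x
  proof -
    obtain U d where U: "unitary_mat n U" "A = udiag n U d" "\<And>i. i < n \<Longrightarrow> d i > 0"
      using pd_spectral[OF A] by metis
    note c = unitary_carrier[OF U(1)]
    let ?v = "U\<dagger> *\<^sub>v v" and ?x = "U\<dagger> *\<^sub>v x"
    have "cip v x = cip ?v ?x"
      using c v x by (subst cip_adjoint'[of _ n n]) (auto simp: unitary_cancel_vec[OF U(1)])
    hence "Re (cip v x) = (\<Sum>k<n. Re (cnj (?v $ k) * ?x $ k))"
      using c by (simp add: cip_def Re_sum del: index_mult_mat_vec times_complex.sel)
    hence "2 * Re (cip v x) - rq A x = (\<Sum>k<n. 2 * Re (cnj (?v $ k) * ?x $ k) - d k * (cmod (?x $ k))\<^sup>2)"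
      unfolding U(2) rq_udiag[OF c x] by (simp add: sum_subtractf sum_distrib_left)
    also have "\<dots> \<le> (\<Sum>k<n. inverse (d k) * (cmod (?v $ k))\<^sup>2)"
    proof (rule sum_mono)
      fix k assume "k \<in> {..<n}"
      hence d: "d k > 0" using U(3) by simp
      let ?a = "cmod (?v $ k)" and ?b = "cmod (?x $ k)"
      have "Re (cnj (?v $ k) * ?x $ k) \<le> ?a * ?b"
        using complex_Re_le_cmod[of "cnj (?v $ k) * ?x $ k"] by (simp add: norm_mult)
      moreover have "0 \<le> (?a - d k * ?b)\<^sup>2 / d k" using d by simp
      moreover have "(?a - d k * ?b)\<^sup>2 / d k = inverse (d k) * ?a\<^sup>2 - 2 * (?a * ?b) + d k * ?b\<^sup>2"
        using d by (simp add: field_simps power2_eq_square)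
      ultimately show "2 * Re (cnj (?v $ k) * ?x $ k) - d k * ?b\<^sup>2 \<le> inverse (d k) * ?a\<^sup>2"
        by linarith
    qed
    also have "\<dots> = rq (matfun inverse A) v"
      unfolding U(2) matfun_udiag[OF U(1)] rq_udiag[OF c v] ..
    finally show ?thesis .
  qed
  obtain U d where U: "unitary_mat n U" "B = udiag n U d" "\<And>i. i < n \<Longrightarrow> d i > 0"
    using pd_spectral[OF B] by metis
  note c = unitary_carrier[OF U(1)]
  define x where "x = matfun inverse B *\<^sub>v v"
  have x: "x \<in> carrier_vec n" using c v unfolding x_def U(2) matfun_udiag[OF U(1)] by auto
  have Bx: "B *\<^sub>v x = v"
  proof -
    have "B *\<^sub>v x = (B * matfun inverse B) *\<^sub>v v"
      using c v unfolding x_def U(2) matfun_udiag[OF U(1)] by (subst assoc_mult_mat_vec[of _ n n _ n]) auto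
    also have "B * matfun inverse B = 1\<^sub>m n"
      unfolding U(2) matfun_udiag[OF U(1)] using U(3) by (intro udiag_inverse[OF U(1)]) (auto simp: less_imp_neq[symmetric])
    finally show ?thesis using v by simp
  qed
  have "rq (matfun inverse B) v = Re (cip v x)" by (simp add: rq_def x_def)
  moreover have "rq B x = Re (cip v x)"
    using cip_commute[of v x] v x by (simp add: rq_def Bx)
  ultimately have "rq (matfun inverse B) v = 2 * Re (cip v x) - rq B x" by simp
  also have "\<dots> \<le> 2 * Re (cip v x) - rq A x" using le[OF x] by simp
  also have "\<dots> \<le> rq (matfun inverse A) v" by (rule *[OF A x])
  finally show ?thesis .
qed

text \<open>Inversion reverses the order, so an order-preserving map between two inversions is again
  order-preserving. The tangent bound for this adjoint function is a lower bound for
  \<open>f\<close>.\<close>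

lemma km_function_adjoint:
  assumes f: "km_function f"
  shows "km_function (\<lambda>t. inverse (f (inverse t)))"
  unfolding km_function_def
proof (intro conjI allI impI)
  fix t :: real assume "0 \<le> t"
  thus "0 \<le> inverse (f (inverse t))" using km_function_nonneg[OF f] by simp
next
  show "inverse (f (inverse 1)) = 1" using km_function_one[OF f] by simp
next
  let ?g = "\<lambda>t. inverse (f (inverse t))"
  have pos: "pd_mat (matfun inverse A)" "matfun inverse A \<in> carrier_mat n n"
      "pd_mat (matfun f (matfun inverse A))" "matfun f (matfun inverse A) \<in> carrier_mat n n"
      "matfun inverse (matfun f (matfun inverse A)) = matfun ?g A"
    if A: "A \<in> carrier_mat n n" "pd_mat A" for n A
  proof -
    obtain U d where U: "unitary_mat n U" "A = udiag n U d" "\<And>i. i < n \<Longrightarrow> d i > 0"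
      using pd_spectral[OF A] by metis
    show "pd_mat (matfun inverse A)" "matfun inverse A \<in> carrier_mat n n"
      "pd_mat (matfun f (matfun inverse A))" "matfun f (matfun inverse A) \<in> carrier_mat n n"
      "matfun inverse (matfun f (matfun inverse A)) = matfun ?g A"
      unfolding U(2) matfun_udiag[OF U(1)]
      using U by (auto intro!: pd_udiag km_function_pos[OF f] udiag_carrier simp: unitary_carrier)
  qed
  show "operator_monotone ?g" unfolding operator_monotone_def
  proof (intro allI ballI impI, elim conjE)
    fix n A B assume A: "A \<in> carrier_mat n n" "pd_mat A" and B: "B \<in> carrier_mat n n" "pd_mat B"
      and le: "loewner_le A B"
    have le': "rq A v \<le> rq B v" if "v \<in> carrier_vec n" for v
      using le that unfolding loewner_le_iff[OF A(1) B(1) pd_adjoint[OF A] pd_adjoint[OF B]] by blast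
    have "rq (matfun inverse B) v \<le> rq (matfun inverse A) v" if "v \<in> carrier_vec n" for v
      by (rule rq_inverse_antimono[OF A B le' that])
    hence "rq (matfun f (matfun inverse B)) v \<le> rq (matfun f (matfun inverse A)) v" if "v \<in> carrier_vec n" for v
      using that by (intro operator_monotone_rq[OF km_function_om[OF f] pos(2)[OF B] pos(2)[OF A] pos(1)[OF B] pos(1)[OF A]]) auto
    hence "rq (matfun inverse (matfun f (matfun inverse A))) v \<le> rq (matfun inverse (matfun f (matfun inverse B))) v"
      if "v \<in> carrier_vec n" for v
      using that by (intro rq_inverse_antimono[OF pos(4)[OF B] pos(3)[OF B] pos(4)[OF A] pos(3)[OF A]]) auto
    hence "rq (matfun ?g A) v \<le> rq (matfun ?g B) v" if "v \<in> carrier_vec n" for v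
      using that unfolding pos(5)[OF A] pos(5)[OF B] by blast
    thus "loewner_le (matfun ?g A) (matfun ?g B)"
      using matfun_hermitian[OF A(1) pd_adjoint[OF A], of ?g] matfun_hermitian[OF B(1) pd_adjoint[OF B], of ?g]
      by (subst loewner_le_iff[of _ n]) auto
  qed
qed

text \<open>The adjoint function also has derivative \<alpha> at 1, and its tangent bound at
  \<open>inverse t\<close> is an upper bound on \<open>inverse (f t)\<close>. The product form is
  the one that the completion of the square in \<open>km_pd_lower\<close> uses.\<close>

lemma km_function_harmonic_bound:
  assumes f: "km_function f" and d: "(f has_real_derivative \<alpha>) (at 1)" and t: "0 < t"
  shows "1 \<le> f t * (1 - \<alpha> + \<alpha> / t)"
proof -
  let ?g = "\<lambda>t. inverse (f (inverse t))"
  have "(?g has_real_derivative \<alpha>) (at 1)"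
  proof -
    have "((\<lambda>t. f (inverse t)) has_real_derivative \<alpha> * (- (inverse 1 ^ Suc (Suc 0)))) (at 1)"
      using d by (intro DERIV_chain2[of f] DERIV_inverse) auto
    hence "((\<lambda>t. inverse (f (inverse t))) has_real_derivative - (inverse (f (inverse 1)) * (- \<alpha>) * inverse (f (inverse 1)))) (at 1)"
      using km_function_one[OF f] by (intro DERIV_inverse') auto
    thus ?thesis using km_function_one[OF f] by simp
  qed
  from km_function_tangent[OF km_function_adjoint[OF f] this, of "inverse t"] t
  have "inverse (f t) \<le> 1 - \<alpha> + \<alpha> / t" by (simp add: divide_inverse)
  hence "f t * inverse (f t) \<le> f t * (1 - \<alpha> + \<alpha> / t)"
    using km_function_pos[OF f t] by (intro mult_left_mono) auto
  thus ?thesis using km_function_pos[OF f t] by simp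
qed

section \<open>Monotonicity and bounds for operator means\<close>

lemma mat_powr_udiag:
  "unitary_mat n U \<Longrightarrow> mat_powr (udiag n U d) p = udiag n U (\<lambda>i. d i powr p)"
  by (simp add: mat_powr_def matfun_udiag)

lemma pd_half_powers:
  assumes "A \<in> carrier_mat n n" "pd_mat A"
  defines "a \<equiv> mat_powr A (1/2)" and "b \<equiv> mat_powr A (-1/2)"
  shows "a \<in> carrier_mat n n" "b \<in> carrier_mat n n" "a\<dagger> = a" "b\<dagger> = b"
    "a * a = A" "a * b = 1\<^sub>m n" "b * a = 1\<^sub>m n" "b * b = matfun inverse A" "b * A * b = 1\<^sub>m n"
proof -
  obtain U d where U: "unitary_mat n U" "A = udiag n U d" "\<And>i. i < n \<Longrightarrow> d i > 0"
    using pd_spectral[OF assms(1,2)] by metis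
  note c = unitary_carrier[OF U(1)]
  have a: "a = udiag n U (\<lambda>i. d i powr (1/2))" and b: "b = udiag n U (\<lambda>i. d i powr (-1/2))"
    unfolding a_def b_def U(2) by (rule mat_powr_udiag[OF U(1)])+
  show "a \<in> carrier_mat n n" "b \<in> carrier_mat n n" "a\<dagger> = a" "b\<dagger> = b"
    unfolding a b using c by (auto simp: udiag_adjoint)
  show "a * b = 1\<^sub>m n" "b * a = 1\<^sub>m n" unfolding a b
    using U(3) by (auto intro!: udiag_inverse[OF U(1)] simp: powr_add[symmetric] less_imp_neq[symmetric])
  show "a * a = A" unfolding a U(2) udiag_mult[OF U(1)]
    using U(3) by (intro udiag_cong) (auto simp: powr_add[symmetric] less_imp_le)
  show "b * b = matfun inverse A" unfolding b U(2) udiag_mult[OF U(1)] matfun_udiag[OF U(1)]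
  proof (rule udiag_cong)
    fix i assume "i < n"
    hence d: "0 < d i" by (rule U(3))
    have "d i powr (-1/2) * d i powr (-1/2) = d i powr (-1/2 + -1/2)" by (simp only: powr_add)
    thus "d i powr (-1/2) * d i powr (-1/2) = inverse (d i)" using powr_minus[of "d i" 1] d by simp
  qed
  have "d i powr (- 1 / 2) * d i * d i powr (- 1 / 2) = 1" if "i < n" for i
  proof -
    have "d i powr (- 1 / 2) * d i powr 1 * d i powr (- 1 / 2) = 1"
      using U(3)[OF that] unfolding powr_add[symmetric] by simp
    thus ?thesis using U(3)[OF that] by simp
  qed
  thus "b * A * b = 1\<^sub>m n" unfolding b U(2) udiag_mult[OF U(1)] udiag_one[OF U(1), symmetric]
    by (intro udiag_cong) auto
qed

lemma rq_hermitian_congruence: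
  assumes "A \<in> carrier_mat n n" "T \<in> carrier_mat n n" "T\<dagger> = T" "v \<in> carrier_vec n"
  shows "rq (T * A * T) v = rq A (T *\<^sub>v v)"
  using rq_congruence[OF assms(1,2,4)] assms(3) by simp

lemma hermitian_congruence_adjoint:
  assumes "A \<in> carrier_mat n n" "A\<dagger> = A" "T \<in> carrier_mat n n" "T\<dagger> = (T :: complex mat)"
  shows "(T * A * T)\<dagger> = T * A * T"
  using assms by (simp add: mat_adjoint_mult[where nr = n and n = n and nc = n] mult_square_assoc[of _ n])

lemma mult_vec_cancel:
  assumes "A \<in> carrier_mat n n" "B \<in> carrier_mat n n" "A * B = 1\<^sub>m n" "v \<in> carrier_vec n"
  shows "A *\<^sub>v (B *\<^sub>v v) = (v :: complex vec)"
  using assms by (subst assoc_mult_mat_vec[of _ n n _ n, symmetric]) auto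

lemma km_pd_form:
  assumes A: "A \<in> carrier_mat n n" "pd_mat A" and B: "B \<in> carrier_mat n n" "pd_mat B"
  defines "a \<equiv> mat_powr A (1/2)" and "b \<equiv> mat_powr A (-1/2)"
  shows "b * B * b \<in> carrier_mat n n" "pd_mat (b * B * b)"
    "km_pd f A B \<in> carrier_mat n n" "(km_pd f A B)\<dagger> = km_pd f A B"
    "v \<in> carrier_vec n \<Longrightarrow> rq (km_pd f A B) v = rq (matfun f (b * B * b)) (a *\<^sub>v v)"
proof -
  note h = pd_half_powers[OF A, folded a_def b_def]
  show D: "b * B * b \<in> carrier_mat n n" using h B by auto
  show pD: "pd_mat (b * B * b)" using pd_congruence[OF B h(2,1,6)] h(4) by simp
  note m = matfun_hermitian[OF D pd_adjoint[OF D pD], of f]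
  have km: "km_pd f A B = a * matfun f (b * B * b) * a" by (simp add: km_pd_def a_def b_def)
  show "km_pd f A B \<in> carrier_mat n n" unfolding km using m h by auto
  show "(km_pd f A B)\<dagger> = km_pd f A B" unfolding km
    by (rule hermitian_congruence_adjoint[OF m h(1,3)])
  show "rq (km_pd f A B) v = rq (matfun f (b * B * b)) (a *\<^sub>v v)" if "v \<in> carrier_vec n"
    unfolding km by (rule rq_hermitian_congruence[OF m(1) h(1,3) that])
qed

text \<open>The second argument enters only through a congruence with \<open>b\<close>, which
  preserves the order, and then through \<open>matfun f\<close>.\<close>

lemma km_pd_mono_right:
  assumes f: "km_function f" and A: "A \<in> carrier_mat n n" "pd_mat A"
    and B: "B \<in> carrier_mat n n" "pd_mat B" and B': "B' \<in> carrier_mat n n" "pd_mat B'"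
    and le: "\<And>v. v \<in> carrier_vec n \<Longrightarrow> rq B v \<le> rq B' v" and v: "v \<in> carrier_vec n"
  shows "rq (km_pd f A B) v \<le> rq (km_pd f A B') v"
proof -
  define a where "a = mat_powr A (1/2)"
  define b where "b = mat_powr A (-1/2)"
  note h = pd_half_powers[OF A, folded a_def b_def]
  note D = km_pd_form[OF A B, folded a_def b_def] and D' = km_pd_form[OF A B', folded a_def b_def]
  show ?thesis unfolding D(5)[OF v] D'(5)[OF v]
  proof (rule operator_monotone_rq[OF km_function_om[OF f] D(1) D'(1) D(2) D'(2)])
    show "rq (b * B * b) w \<le> rq (b * B' * b) w" if "w \<in> carrier_vec n" for w
      unfolding rq_hermitian_congruence[OF B(1) h(2,4) that] rq_hermitian_congruence[OF B'(1) h(2,4) that]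
      using h that by (intro le) auto
  qed (use h v in auto)
qed

text \<open>Dilation with \<open>S = (1 - T\<^sup>2)\<^sup>1\<^sup>/\<^sup>2\<close> and \<open>Z = \<delta>I\<close> bounds the left-hand side by
  \<open>f ((1 + \<eta>) T X T)\<close>; this matrix has the same eigenvectors for all \<open>\<eta>\<close>, so that continuity of
  the scalar function \<open>f\<close> suffices for the limit \<open>\<eta> \<rightarrow> 0\<close>.\<close>

lemma operator_jensen_contraction:
  assumes f: "km_function f" and U: "unitary_mat n U" and k: "\<And>i. i < n \<Longrightarrow> 0 < k i \<and> k i \<le> 1"
    and X: "X \<in> carrier_mat n n" "pd_mat X" and v: "v \<in> carrier_vec n"
  defines "T \<equiv> udiag n U (\<lambda>i. sqrt (k i))"
  shows "rq (matfun f X) (T *\<^sub>v v) \<le> rq (matfun f (T * X * T)) v"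
proof -
  note c = unitary_carrier[OF U]
  define S where "S = udiag n U (\<lambda>i. sqrt (1 - k i))"
  have T: "T \<in> carrier_mat n n" "T\<dagger> = T" and S: "S \<in> carrier_mat n n" "S\<dagger> = S"
    using c by (auto simp: T_def S_def udiag_adjoint)
  have inv: "udiag n U (\<lambda>i. 1 / sqrt (k i)) * T = 1\<^sub>m n"
    unfolding T_def using k by (intro udiag_inverse[OF U]) (auto simp: less_imp_neq[symmetric])
  have Q: "T * X * T \<in> carrier_mat n n" "pd_mat (T * X * T)"
    using T X pd_congruence[OF X T(1) udiag_carrier[OF c] inv] by auto
  obtain V y where V: "unitary_mat n V" "T * X * T = udiag n V y" "\<And>i. i < n \<Longrightarrow> y i > 0"
    using pd_spectral[OF Q] by metis
  note cV = unitary_carrier[OF V(1)]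
  obtain m0 where m0: "m0 > 0" "\<And>v. v \<in> carrier_vec n \<Longrightarrow> m0 * nsq v \<le> rq (T * X * T) v"
    using pd_lower_bound[OF Q] by metis
  have TS: "T * S = S * T" "T * T + S * S = 1\<^sub>m n"
  proof -
    show "T * S = S * T" unfolding T_def S_def udiag_mult[OF U] by (simp add: mult.commute)
    show "T * T + S * S = 1\<^sub>m n"
      unfolding T_def S_def udiag_mult[OF U] udiag_add[OF c] udiag_one[OF U, symmetric]
      using k by (intro udiag_cong) (auto simp: less_imp_le)
  qed
  have Sle: "nsq (S *\<^sub>v w) \<le> nsq w" if w: "w \<in> carrier_vec n" for w
  proof -
    have "nsq (S *\<^sub>v w) \<le> rq (udiag n U (\<lambda>_. 1)) w"
      unfolding S_def nsq_udiag[OF U w] using k by (intro rq_udiag_mono[OF c w]) (auto simp: less_imp_le)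
    thus ?thesis by (simp add: rq_udiag_const[OF U w])
  qed
  let ?c = "\<lambda>i. (cmod ((V\<dagger> *\<^sub>v v) $ i))\<^sup>2"
  have le: "rq (matfun f X) (T *\<^sub>v v) \<le> (\<Sum>i<n. f ((1 + e) * y i) * ?c i)" if e: "e > 0" for e
  proof -
    \<comment> \<open>Half of the margin \<open>e * m0\<close> covers the block \<open>?Z\<close>
      compressed by the contraction \<open>S\<close>; the other half is the slack demanded by the
      dilation.\<close>
    define dl where "dl = e * m0 / 2"
    have dl: "dl > 0" using e m0 by (simp add: dl_def)
    let ?Z = "udiag n U (\<lambda>_. dl)" and ?Y = "udiag n V (\<lambda>i. (1 + e) * y i)"
    have Y: "?Y = complex_of_real (1 + e) \<cdot>\<^sub>m (T * X * T)"
      unfolding V(2) udiag_smult[OF cV] ..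
    have "rq (matfun f X) (T *\<^sub>v v) + rq (matfun f ?Z) (S *\<^sub>v v) \<le> rq (matfun f ?Y) v"
    proof (rule operator_monotone_dilation[OF km_function_om[OF f] T S TS X _ _ _ _ dl _ v])
      show "pd_mat ?Z" using dl by (intro pd_udiag U)
      show "pd_mat ?Y" using e V(3) by (intro pd_udiag V) auto
      fix w :: "complex vec" assume w: "w \<in> carrier_vec n"
      have "rq X (T *\<^sub>v w) + rq ?Z (S *\<^sub>v w) + dl * nsq w
          = rq (T * X * T) w + dl * nsq (S *\<^sub>v w) + dl * nsq w"
        using S w by (simp add: rq_hermitian_congruence[OF X(1) T w] rq_udiag_const[OF U])
      also have "\<dots> \<le> rq (T * X * T) w + dl * nsq w + dl * nsq w"
        using Sle[OF w] dl by simp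
      also have "\<dots> = rq (T * X * T) w + e * (m0 * nsq w)" by (simp add: dl_def)
      also have "\<dots> \<le> rq (T * X * T) w + e * rq (T * X * T) w"
        using m0(2)[OF w] e by simp
      also have "\<dots> = rq ?Y w"
        unfolding Y rq_smult[OF Q(1) w] by (simp add: algebra_simps)
      finally show "rq X (T *\<^sub>v w) + rq ?Z (S *\<^sub>v w) + dl * nsq w \<le> rq ?Y w" .
    qed (use c cV in auto)
    moreover have "0 \<le> rq (matfun f ?Z) (S *\<^sub>v v)"
      unfolding matfun_udiag[OF U] rq_udiag_const[OF U mult_square_vec[OF S(1) v]]
      using km_function_pos[OF f dl] by simp
    ultimately show ?thesis
      unfolding matfun_udiag[OF V(1)] rq_udiag[OF cV v] by linarith
  qed
  have "((\<lambda>e. \<Sum>i<n. f ((1 + e) * y i) * ?c i) \<longlongrightarrow> (\<Sum>i<n. f ((1 + 0) * y i) * ?c i)) (at_right 0)"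
  proof (intro tendsto_intros)
    fix i assume "i \<in> {..<n}"
    hence "isCont f ((1 + 0) * y i)" using V(3) by (intro km_function_isCont[OF f]) auto
    moreover have "((\<lambda>e. (1 + e) * y i) \<longlongrightarrow> (1 + 0) * y i) (at_right 0)" by (intro tendsto_intros)
    ultimately show "((\<lambda>e. f ((1 + e) * y i)) \<longlongrightarrow> f ((1 + 0) * y i)) (at_right 0)"
      by (rule isCont_tendsto_compose)
  qed
  moreover have "\<forall>\<^sub>F e in at_right 0. rq (matfun f X) (T *\<^sub>v v) \<le> (\<Sum>i<n. f ((1 + e) * y i) * ?c i)"
    using eventually_at_right_less[of "0::real"] by (rule eventually_mono) (rule le)
  ultimately have "rq (matfun f X) (T *\<^sub>v v) \<le> (\<Sum>i<n. f ((1 + 0) * y i) * ?c i)"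
    by (rule tendsto_lowerbound) simp
  thus ?thesis unfolding V(2) matfun_udiag[OF V(1)] rq_udiag[OF cV v] by simp
qed

text \<open>With \<open>R = A\<^sup>1\<^sup>/\<^sup>2 A'\<^sup>-\<^sup>1\<^sup>/\<^sup>2\<close> the claim is the Jensen inequality for the contraction \<open>R\<close>; the
  polar decomposition \<open>R = V T\<close> reduces it to the positive contraction \<open>T\<close>.\<close>

lemma km_pd_mono_left:
  assumes f: "km_function f" and A: "A \<in> carrier_mat n n" "pd_mat A"
    and A': "A' \<in> carrier_mat n n" "pd_mat A'" and B: "B \<in> carrier_mat n n" "pd_mat B"
    and le: "\<And>v. v \<in> carrier_vec n \<Longrightarrow> rq A v \<le> rq A' v" and v: "v \<in> carrier_vec n"
  shows "rq (km_pd f A B) v \<le> rq (km_pd f A' B) v"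
proof -
  define a where "a = mat_powr A (1/2)"
  define b where "b = mat_powr A (-1/2)"
  define a' where "a' = mat_powr A' (1/2)"
  define b' where "b' = mat_powr A' (-1/2)"
  note h = pd_half_powers[OF A, folded a_def b_def] and h' = pd_half_powers[OF A', folded a'_def b'_def]
  note D = km_pd_form[OF A B, folded a_def b_def] and D' = km_pd_form[OF A' B, folded a'_def b'_def]
  note assoc = mult_square_assoc[of _ n] and adj = mat_adjoint_mult[where nr = n and n = n and nc = n]
  define K where "K = b' * A * b'"
  have K: "K \<in> carrier_mat n n" "pd_mat K"
    using h' A pd_congruence[OF A h'(2,1,6)] by (auto simp: K_def)
  obtain U k where U: "unitary_mat n U" "K = udiag n U k" "\<And>i. i < n \<Longrightarrow> k i > 0"
    using pd_spectral[OF K] by metis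
  note c = unitary_carrier[OF U(1)]
  \<comment> \<open>The order between \<open>A\<close> and \<open>A'\<close> says that
    \<open>K\<close> is at most the identity, so that its square root \<open>T\<close> is a
    contraction.\<close>
  have k1: "k i \<le> 1" if i: "i < n" for i
  proof -
    let ?u = "U *\<^sub>v unit_vec n i"
    have u: "?u \<in> carrier_vec n" using c by simp
    have "k i = rq A (b' *\<^sub>v ?u)"
      using rq_udiag_col[OF U(1) i, of k] rq_hermitian_congruence[OF A(1) h'(2,4) u]
      by (simp add: U(2)[symmetric] K_def)
    also have "\<dots> \<le> rq A' (b' *\<^sub>v ?u)" using h' u by (intro le) auto
    also have "\<dots> = rq (b' * A' * b') ?u" by (rule rq_hermitian_congruence[OF A'(1) h'(2,4) u, symmetric])
    also have "\<dots> = nsq (unit_vec n i :: complex vec)"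
      unfolding h'(9) rq_one[OF u] by (rule unitary_nsq[OF U(1)]) simp
    finally show ?thesis unfolding nsq_unit_vec[OF i] .
  qed
  define T where "T = udiag n U (\<lambda>i. sqrt (k i))"
  define Ti where "Ti = udiag n U (\<lambda>i. 1 / sqrt (k i))"
  have T: "T \<in> carrier_mat n n" "T\<dagger> = T" and Ti: "Ti \<in> carrier_mat n n" "Ti\<dagger> = Ti"
    using c by (auto simp: T_def Ti_def udiag_adjoint)
  have TiT: "Ti * T = 1\<^sub>m n"
    unfolding T_def Ti_def using U(3) by (intro udiag_inverse[OF U(1)]) (auto simp: less_imp_neq[symmetric])
  have TiKTi: "Ti * K * Ti = 1\<^sub>m n"
    unfolding Ti_def U(2) udiag_mult[OF U(1)] udiag_one[OF U(1), symmetric]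
    using U(3) by (intro udiag_cong) (auto simp: less_imp_neq[symmetric] less_imp_le)
  \<comment> \<open>\<open>T\<close> is the absolute value of \<open>a * b'\<close>, since the
    adjoint of \<open>a * b'\<close> times \<open>a * b'\<close> is \<open>K\<close>; dividing by
    \<open>T\<close> leaves the unitary factor.\<close>
  define V where "V = a * b' * Ti"
  have Vc: "V \<in> carrier_mat n n" using h h' Ti by (simp add: V_def)
  have Vadj: "V\<dagger> = Ti * b' * a"
    unfolding V_def using h h' Ti by (simp add: adj assoc)
  have "V\<dagger> * V = Ti * (b' * (a * a) * b') * Ti"
    unfolding Vadj unfolding V_def using h(1,2) h'(1,2) Ti(1) by (simp add: assoc)
  hence VV: "unitary_mat n V"
    unfolding h(5) using Vc TiKTi by (simp add: unitary_mat_def K_def)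
  have VT: "V * T = a * b'"
  proof -
    have "V * T = a * b' * (Ti * T)" unfolding V_def using h(1) h'(2) Ti(1) T(1) by (simp add: assoc)
    thus ?thesis using h(1) h'(2) by (simp add: TiT)
  qed
  \<comment> \<open>Chosen so that the unitary moves into the argument of \<open>f\<close> while
    \<open>T * X * T\<close> becomes \<open>b' * B * b'\<close>, the matrix that belongs to
    \<open>A'\<close>.\<close>
  define X where "X = V\<dagger> * (b * B * b) * V"
  have X: "X \<in> carrier_mat n n" "pd_mat X"
    using Vc D(1) pd_unitary_conj[OF D(1,2) unitary_adjoint[OF VV]] by (auto simp: X_def)
  have fX: "matfun f X = V\<dagger> * matfun f (b * B * b) * V"
    using matfun_unitary_conj[OF D(1) pd_adjoint[OF D(1,2)] unitary_adjoint[OF VV], of f] by (simp add: X_def)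
  have VTa: "T * V\<dagger> = b' * a"
  proof -
    have "T * V\<dagger> = (V * T)\<dagger>" using Vc T by (simp add: adj)
    thus ?thesis unfolding VT using h h' by (simp add: adj)
  qed
  have "T * X * T = (T * V\<dagger>) * (b * B * b) * (V * T)"
    unfolding X_def using T(1) Vc h(2) B(1) by (simp add: assoc)
  also have "\<dots> = b' * (a * b) * B * (b * a) * b'"
    unfolding VT VTa using h(1,2) h'(1,2) B(1) by (simp add: assoc)
  also have "\<dots> = b' * B * b'" unfolding h(6,7) using h'(2) B(1) by simp
  finally have TXT: "T * X * T = b' * B * b'" .
  let ?w = "a' *\<^sub>v v"
  have w: "?w \<in> carrier_vec n" using h' v by simp
  note mD = matfun_hermitian[OF D(1) pd_adjoint[OF D(1,2)], of f]
  have "V *\<^sub>v (T *\<^sub>v ?w) = (V * T) *\<^sub>v ?w" using Vc T w by simp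
  also have "\<dots> = a *\<^sub>v (b' *\<^sub>v ?w)" unfolding VT using h(1) h'(2) w by simp
  also have "b' *\<^sub>v ?w = v" by (rule mult_vec_cancel[OF h'(2,1,7) v])
  finally have VTw: "V *\<^sub>v (T *\<^sub>v ?w) = a *\<^sub>v v" .
  have "rq (km_pd f A B) v = rq (matfun f (b * B * b)) (V *\<^sub>v (T *\<^sub>v ?w))"
    unfolding D(5)[OF v] VTw ..
  also have "\<dots> = rq (matfun f X) (T *\<^sub>v ?w)"
    unfolding fX by (rule rq_congruence[OF mD(1) Vc mult_square_vec[OF T(1) w], symmetric])
  also have "\<dots> \<le> rq (matfun f (T * X * T)) ?w"
    unfolding T_def using U(3) k1 by (intro operator_jensen_contraction[OF f U(1) _ X w]) auto
  also have "\<dots> = rq (km_pd f A' B) v" unfolding TXT D'(5)[OF v] ..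
  finally show ?thesis .
qed

text \<open>The tangent bound for \<open>f\<close> is applied to the eigenvalues of
  \<open>b * B * b\<close>; the congruence with \<open>a\<close> then turns the identity into
  \<open>A\<close> and \<open>b * B * b\<close> into \<open>B\<close>.\<close>

lemma km_pd_upper:
  assumes f: "km_function f" "(f has_real_derivative \<alpha>) (at 1)"
    and A: "A \<in> carrier_mat n n" "pd_mat A" and B: "B \<in> carrier_mat n n" "pd_mat B"
    and v: "v \<in> carrier_vec n"
  shows "rq (km_pd f A B) v \<le> (1 - \<alpha>) * rq A v + \<alpha> * rq B v"
proof -
  define a where "a = mat_powr A (1/2)"
  define b where "b = mat_powr A (-1/2)"
  note h = pd_half_powers[OF A, folded a_def b_def]
  note D = km_pd_form[OF A B, folded a_def b_def]
  obtain V t where V: "unitary_mat n V" "b * B * b = udiag n V t" "\<And>i. i < n \<Longrightarrow> t i > 0"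
    using pd_spectral[OF D(1,2)] by metis
  note c = unitary_carrier[OF V(1)]
  let ?w = "a *\<^sub>v v"
  have w: "?w \<in> carrier_vec n" using h v by simp
  have "rq (km_pd f A B) v = rq (udiag n V (\<lambda>i. f (t i))) ?w"
    unfolding D(5)[OF v] V(2) matfun_udiag[OF V(1)] ..
  also have "\<dots> \<le> rq (udiag n V (\<lambda>i. (1 - \<alpha>) + \<alpha> * t i)) ?w"
    using km_function_tangent[OF f V(3)] by (intro rq_udiag_mono[OF c w]) auto
  also have "\<dots> = (1 - \<alpha>) * nsq ?w + \<alpha> * rq (b * B * b) ?w"
    unfolding V(2) udiag_add[OF c, symmetric] udiag_smult[OF c, symmetric]
    using c w by (simp add: rq_add[of _ n] rq_smult[of _ n] rq_udiag_const[OF V(1)])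
  also have "rq (b * B * b) ?w = rq B (b *\<^sub>v ?w)" by (rule rq_hermitian_congruence[OF B(1) h(2,4) w])
  also have "b *\<^sub>v ?w = v" by (rule mult_vec_cancel[OF h(2,1,7) v])
  also have "nsq ?w = rq (a * 1\<^sub>m n * a) v"
    using rq_hermitian_congruence[OF one_carrier_mat h(1,3) v] rq_one[OF w] by simp
  also have "a * 1\<^sub>m n * a = A" using h(1,5) by simp
  finally show ?thesis .
qed

text \<open>For 0 < \<alpha> < 1 the supremum of the left-hand side over \<open>x\<close> is the
  form of the weighted harmonic mean. Keeping \<open>x\<close> free avoids inverting the sum of the
  inverses and lets the bound pass to singular matrices, with \<open>x\<close> restricted to their
  ranges.\<close>

lemma km_pd_lower:
  assumes f: "km_function f" "(f has_real_derivative \<alpha>) (at 1)"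
    and A: "A \<in> carrier_mat n n" "pd_mat A" and B: "B \<in> carrier_mat n n" "pd_mat B"
    and v: "v \<in> carrier_vec n" and x: "x \<in> carrier_vec n"
  shows "2 * Re (cip v x) - (1 - \<alpha>) * rq (matfun inverse A) x - \<alpha> * rq (matfun inverse B) x
    \<le> rq (km_pd f A B) v"
proof -
  define a where "a = mat_powr A (1/2)"
  define b where "b = mat_powr A (-1/2)"
  note h = pd_half_powers[OF A, folded a_def b_def]
  note D = km_pd_form[OF A B, folded a_def b_def]
  obtain V t where V: "unitary_mat n V" "b * B * b = udiag n V t" "\<And>i. i < n \<Longrightarrow> t i > 0"
    using pd_spectral[OF D(1,2)] by metis
  note c = unitary_carrier[OF V(1)]
  obtain U d where U: "unitary_mat n U" "B = udiag n U d" "\<And>i. i < n \<Longrightarrow> d i > 0"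
    using pd_spectral[OF B] by metis
  let ?Bi = "matfun inverse B"
  have Bi: "?Bi \<in> carrier_mat n n" "B * ?Bi = 1\<^sub>m n"
    unfolding U(2) matfun_udiag[OF U(1)] using U
    by (auto simp: unitary_carrier less_imp_neq[symmetric] intro!: udiag_inverse)
  have inv: "udiag n V (\<lambda>i. inverse (t i)) = a * ?Bi * a"
  proof -
    let ?I = "udiag n V (\<lambda>i. inverse (t i))"
    have I: "?I * (b * B * b) = 1\<^sub>m n"
      unfolding V(2) using V(3) by (intro udiag_inverse[OF V(1)]) (auto simp: less_imp_neq[symmetric])
    have "(b * B * b) * (a * ?Bi * a) = b * B * (b * a) * ?Bi * a"
      using h(1,2) B(1) Bi(1) by (simp add: mult_square_assoc[of _ n])
    also have "\<dots> = b * (B * ?Bi) * a"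
      unfolding h(7) using h(1,2) B(1) Bi(1) by (simp add: mult_square_assoc[of _ n])
    also have "\<dots> = 1\<^sub>m n" unfolding Bi(2) using h(1,2,7) by simp
    finally have "?I * ((b * B * b) * (a * ?Bi * a)) = ?I" using c by simp
    moreover have "?I * ((b * B * b) * (a * ?Bi * a)) = (?I * (b * B * b)) * (a * ?Bi * a)"
      using c D(1) h(1) Bi(1) by (intro mult_square_assoc[of _ n, symmetric]) auto
    moreover have "\<dots> = a * ?Bi * a" unfolding I using h(1) Bi(1) by simp
    ultimately show ?thesis by simp
  qed
  \<comment> \<open>As \<open>a\<close> and \<open>b\<close> are inverse to each other, this
    substitution preserves the pairing of \<open>v\<close> with \<open>x\<close>, and all forms
    become diagonal in the columns of \<open>V\<close>.\<close>
  let ?w = "a *\<^sub>v v" and ?y = "b *\<^sub>v x"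
  have w: "?w \<in> carrier_vec n" and y: "?y \<in> carrier_vec n" using h v x by auto
  have "cip ?w ?y = cip v (a *\<^sub>v ?y)" using cip_adjoint'[OF h(1) v y] h(3) by simp
  also have "a *\<^sub>v ?y = x" by (rule mult_vec_cancel[OF h(1,2,6) x])
  finally have "cip v x = cip (V\<dagger> *\<^sub>v ?w) (V\<dagger> *\<^sub>v ?y)"
    using c w y by (subst cip_adjoint'[of _ n n]) (auto simp: unitary_cancel_vec[OF V(1)])
  hence 1: "Re (cip v x) = (\<Sum>k<n. Re (cnj ((V\<dagger> *\<^sub>v ?w) $ k) * (V\<dagger> *\<^sub>v ?y) $ k))"
    using c by (simp add: cip_def Re_sum del: index_mult_mat_vec times_complex.sel)
  have "rq (udiag n V (\<lambda>i. (1 - \<alpha>) + \<alpha> * inverse (t i))) ?y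
      = (1 - \<alpha>) * nsq ?y + \<alpha> * rq (udiag n V (\<lambda>i. inverse (t i))) ?y"
    unfolding udiag_add[OF c, symmetric] udiag_smult[OF c, symmetric]
    using c y by (simp add: rq_add[of _ n] rq_smult[of _ n] rq_udiag_const[OF V(1)])
  also have "rq (udiag n V (\<lambda>i. inverse (t i))) ?y = rq ?Bi (a *\<^sub>v ?y)"
    unfolding inv by (rule rq_hermitian_congruence[OF Bi(1) h(1,3) y])
  also have "a *\<^sub>v ?y = x" by (rule mult_vec_cancel[OF h(1,2,6) x])
  also have "nsq ?y = rq (b * 1\<^sub>m n * b) x"
    using rq_hermitian_congruence[OF one_carrier_mat h(2,4) x] rq_one[OF y] by simp
  also have "b * 1\<^sub>m n * b = matfun inverse A" using h(2,8) by simp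
  finally have 2: "(1 - \<alpha>) * rq (matfun inverse A) x + \<alpha> * rq ?Bi x
      = (\<Sum>k<n. ((1 - \<alpha>) + \<alpha> * inverse (t k)) * (cmod ((V\<dagger> *\<^sub>v ?y) $ k))\<^sup>2)"
    unfolding rq_udiag[OF c y] by simp
  have 3: "rq (km_pd f A B) v = (\<Sum>k<n. f (t k) * (cmod ((V\<dagger> *\<^sub>v ?w) $ k))\<^sup>2)"
    unfolding D(5)[OF v] V(2) matfun_udiag[OF V(1)] by (rule rq_udiag[OF c w])
  have "2 * Re (cip v x) \<le> (\<Sum>k<n. f (t k) * (cmod ((V\<dagger> *\<^sub>v ?w) $ k))\<^sup>2
      + ((1 - \<alpha>) + \<alpha> * inverse (t k)) * (cmod ((V\<dagger> *\<^sub>v ?y) $ k))\<^sup>2)"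
    unfolding 1 sum_distrib_left
  proof (rule sum_mono)
    fix k assume "k \<in> {..<n}"
    hence t: "t k > 0" using V(3) by simp
    let ?a = "(V\<dagger> *\<^sub>v ?w) $ k" and ?b = "(V\<dagger> *\<^sub>v ?y) $ k" and ?q = "(1 - \<alpha>) + \<alpha> * inverse (t k)"
    have f0: "f (t k) > 0" by (rule km_function_pos[OF f(1) t])
    have fq: "1 \<le> f (t k) * ?q" using km_function_harmonic_bound[OF f t] by (simp add: divide_inverse)
    have "Re (cnj ?a * ?b) \<le> cmod ?a * cmod ?b"
      using complex_Re_le_cmod[of "cnj ?a * ?b"] by (simp add: norm_mult)
    moreover have "0 \<le> f (t k) * (cmod ?a)\<^sup>2 - 2 * (cmod ?a * cmod ?b) + ?q * (cmod ?b)\<^sup>2"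
    proof -
      \<comment> \<open>The square is completed after multiplication by \<open>f (t k)\<close>; the
        rest is nonnegative because \<open>f (t k) * ?q\<close> is at least 1.\<close>
      have "0 \<le> (f (t k) * cmod ?a - cmod ?b)\<^sup>2 + (f (t k) * ?q - 1) * (cmod ?b)\<^sup>2" using fq by simp
      also have "\<dots> = f (t k) * (f (t k) * (cmod ?a)\<^sup>2 - 2 * (cmod ?a * cmod ?b) + ?q * (cmod ?b)\<^sup>2)"
        by (simp add: power2_eq_square algebra_simps)
      finally show ?thesis using f0 by (simp add: zero_le_mult_iff)
    qed
    ultimately show "2 * Re (cnj ?a * ?b) \<le> f (t k) * (cmod ?a)\<^sup>2 + ?q * (cmod ?b)\<^sup>2" by linarith
  qed
  thus ?thesis using 2 3 by (simp add: sum.distrib)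
qed

section \<open>The mean of semidefinite matrices\<close>

lemma tendsto_at_right_bounded_mono:
  fixes g :: "real \<Rightarrow> real"
  assumes mono: "\<And>x y. 0 < x \<Longrightarrow> x \<le> y \<Longrightarrow> g x \<le> g y" and low: "\<And>x. 0 < x \<Longrightarrow> L \<le> g x"
  shows "\<exists>l. (g \<longlongrightarrow> l) (at_right 0)"
proof
  define l where "l = (INF x\<in>{0<..}. g x)"
  have bdd: "bdd_below (g ` {0<..})" using low by (intro bdd_belowI2[of _ L]) auto
  show "(g \<longlongrightarrow> l) (at_right 0)"
  proof (rule order_tendstoI)
    fix a assume "a < l"
    thus "\<forall>\<^sub>F x in at_right 0. a < g x"
      using bdd by (intro eventually_mono[OF eventually_at_right_less[of "0::real"]])
        (auto simp: l_def intro: less_le_trans cINF_lower)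
  next
    fix a assume "l < a"
    then obtain x where x: "0 < x" "g x < a"
      using cINF_less_iff[OF _ bdd, of a] by (auto simp: l_def)
    have "\<forall>\<^sub>F y in at_right 0. y \<in> {0<..<x}" by (rule eventually_at_right_real[OF x(1)])
    thus "\<forall>\<^sub>F y in at_right 0. g y < a"
    proof (rule eventually_mono)
      fix y assume "y \<in> {0<..<x}"
      hence "g y \<le> g x" by (intro mono) auto
      thus "g y < a" using x by simp
    qed
  qed
qed

lemma rq_sum:
  assumes "M \<in> carrier_mat n n" "v \<in> carrier_vec n"
  shows "rq M v = Re (\<Sum>i<n. cnj (v $ i) * (\<Sum>k<n. M $$ (i,k) * v $ k))"
  using assms by (simp add: rq_def cip_def index_mult_mat_vec_sum[OF assms] del: index_mult_mat_vec)

lemma rq_add_vec: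
  assumes M: "M \<in> carrier_mat n n" "M\<dagger> = M" and v: "v \<in> carrier_vec n" and w: "w \<in> carrier_vec n"
  shows "rq M (v + w) = rq M v + rq M w + 2 * Re (cip v (M *\<^sub>v w))"
proof -
  have "cip w (M *\<^sub>v v) = cnj (cip v (M *\<^sub>v w))"
    using cip_commute[of w "M *\<^sub>v v"] cip_adjoint'[OF M(1) v w] M v w by simp
  thus ?thesis using M v w
    by (simp add: rq_def mult_add_distrib_mat_vec[of _ n n] cip_add_left[of _ n] cip_add_right[of _ n])
qed

lemma rq_smult_vec:
  assumes M: "M \<in> carrier_mat n n" and v: "v \<in> carrier_vec n"
  shows "rq M (c \<cdot>\<^sub>v v) = (cmod c)\<^sup>2 * rq M v"
proof -
  have "cip (c \<cdot>\<^sub>v v) (M *\<^sub>v (c \<cdot>\<^sub>v v)) = complex_of_real ((cmod c)\<^sup>2) * cip v (M *\<^sub>v v)"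
    using assms unfolding complex_norm_square
    by (simp add: mult_mat_vec[of _ n n] cip_smult_left[of _ n] cip_smult_right[of _ n])
  thus ?thesis by (simp add: rq_def)
qed

lemma cip_unit_vec:
  assumes "M \<in> carrier_mat n n" "i < n" "j < n"
  shows "cip (unit_vec n i) (M *\<^sub>v unit_vec n j) = M $$ (i,j)"
proof -
  have "cip (unit_vec n i) (M *\<^sub>v unit_vec n j) = (\<Sum>k<n. if k = i then M $$ (i,j) else 0)"
    unfolding cip_def using assms by (intro sum.cong) auto
  thus ?thesis using assms by simp
qed

text \<open>Expresses entries by finitely many values of the form, so that convergence of forms
  yields the entrywise convergence on which \<open>kubo_ando\<close> is based.\<close>

lemma polarization:
  assumes M: "M \<in> carrier_mat n n" "M\<dagger> = M" and ij: "i < n" "j < n"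
  defines "e \<equiv> unit_vec n i" and "g \<equiv> unit_vec n j"
  shows "M $$ (i,j) = Complex ((rq M (e + g) - rq M e - rq M g) / 2)
     ((rq M e + rq M g - rq M (e + \<i> \<cdot>\<^sub>v g)) / 2)"
proof -
  have eg: "e \<in> carrier_vec n" "g \<in> carrier_vec n" by (auto simp: e_def g_def)
  have "rq M (e + g) = rq M e + rq M g + 2 * Re (M $$ (i,j))"
    using rq_add_vec[OF M eg] cip_unit_vec[OF M(1) ij] by (simp add: e_def g_def)
  moreover have "rq M (e + \<i> \<cdot>\<^sub>v g) = rq M e + rq M g - 2 * Im (M $$ (i,j))"
  proof -
    have "cip e (M *\<^sub>v (\<i> \<cdot>\<^sub>v g)) = \<i> * M $$ (i,j)"
      using cip_unit_vec[OF M(1) ij] eg M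
      by (simp add: mult_mat_vec[of _ n n] cip_smult_right[of _ n] e_def g_def)
    thus ?thesis using rq_add_vec[OF M eg(1), of "\<i> \<cdot>\<^sub>v g"] rq_smult_vec[OF M(1) eg(2), of \<i>] eg
      by simp
  qed
  ultimately show ?thesis by (simp add: complex_eq_iff)
qed

text \<open>As \<open>e\<close> decreases to 0 the forms decrease and stay nonnegative, so they
  converge, and polarization carries this over to the entries. Hence every \<open>Lim\<close> in
  \<open>Y\<close> is a genuine limit and not an unspecified value.\<close>

lemma hermitian_monotone_limit:
  fixes M :: "real \<Rightarrow> complex mat"
  assumes M: "\<And>e. 0 < e \<Longrightarrow> M e \<in> carrier_mat n n" "\<And>e. 0 < e \<Longrightarrow> (M e)\<dagger> = M e"
    and mono: "\<And>d e v. 0 < d \<Longrightarrow> d \<le> e \<Longrightarrow> v \<in> carrier_vec n \<Longrightarrow> rq (M d) v \<le> rq (M e) v"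
    and low: "\<And>e v. 0 < e \<Longrightarrow> v \<in> carrier_vec n \<Longrightarrow> 0 \<le> rq (M e) v"
  defines "Y \<equiv> mat n n (\<lambda>(i,j). Lim (at_right 0) (\<lambda>e. M e $$ (i,j)))"
  shows "Y\<dagger> = Y" "\<And>v. v \<in> carrier_vec n \<Longrightarrow> ((\<lambda>e. rq (M e) v) \<longlongrightarrow> rq Y v) (at_right 0)"
proof -
  have ev: "\<forall>\<^sub>F e :: real in at_right 0. 0 < e" by (rule eventually_at_right_less)
  have "\<exists>l. ((\<lambda>e. rq (M e) v) \<longlongrightarrow> l) (at_right 0)" if "v \<in> carrier_vec n" for v
    using that by (intro tendsto_at_right_bounded_mono[of _ 0] mono low)
  then obtain l where l: "((\<lambda>e. rq (M e) v) \<longlongrightarrow> l v) (at_right 0)" if "v \<in> carrier_vec n" for v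
    by metis
  have ent: "((\<lambda>e. M e $$ (i,j)) \<longlongrightarrow> Y $$ (i,j)) (at_right 0)" if ij: "i < n" "j < n" for i j
  proof -
    let ?e = "unit_vec n i :: complex vec" and ?g = "unit_vec n j :: complex vec"
    let ?C = "\<lambda>e. Complex ((rq (M e) (?e + ?g) - rq (M e) ?e - rq (M e) ?g) / 2)
     ((rq (M e) ?e + rq (M e) ?g - rq (M e) (?e + \<i> \<cdot>\<^sub>v ?g)) / 2)"
    let ?L = "Complex ((l (?e + ?g) - l ?e - l ?g) / 2) ((l ?e + l ?g - l (?e + \<i> \<cdot>\<^sub>v ?g)) / 2)"
    have "((\<lambda>e. ?C e) \<longlongrightarrow> ?L) (at_right 0)"
      by (intro tendsto_intros l) auto
    moreover have "\<forall>\<^sub>F e in at_right 0. ?C e = M e $$ (i,j)"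
      using ev by (rule eventually_mono) (use polarization[OF M ij] in auto)
    ultimately have lim: "((\<lambda>e. M e $$ (i,j)) \<longlongrightarrow> ?L) (at_right 0)"
      by (rule Lim_transform_eventually)
    hence "Lim (at_right 0) (\<lambda>e. M e $$ (i,j)) = ?L" by (intro tendsto_Lim) auto
    thus ?thesis using lim ij by (simp add: Y_def)
  qed
  have Y: "Y \<in> carrier_mat n n" by (simp add: Y_def)
  show "Y\<dagger> = Y"
  proof (rule eq_matI)
    fix i j assume "i < dim_row Y" "j < dim_col Y"
    hence ij: "i < n" "j < n" using Y by auto
    have "((\<lambda>e. cnj (M e $$ (j,i))) \<longlongrightarrow> cnj (Y $$ (j,i))) (at_right 0)"
      by (intro tendsto_intros ent ij)
    moreover have "\<forall>\<^sub>F e in at_right 0. cnj (M e $$ (j,i)) = M e $$ (i,j)"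
      using ev
    proof (rule eventually_mono)
      fix e :: real assume e: "0 < e"
      show "cnj (M e $$ (j,i)) = M e $$ (i,j)"
        using index_mat_adjoint[of i "M e" j] M[OF e] ij by simp
    qed
    ultimately have "((\<lambda>e. M e $$ (i,j)) \<longlongrightarrow> cnj (Y $$ (j,i))) (at_right 0)"
      by (rule Lim_transform_eventually)
    hence "cnj (Y $$ (j,i)) = Y $$ (i,j)"
      by (rule tendsto_unique[OF _ _ ent[OF ij], rotated]) simp
    thus "Y\<dagger> $$ (i,j) = Y $$ (i,j)" using ij Y by simp
  qed (use Y in auto)
  show "((\<lambda>e. rq (M e) v) \<longlongrightarrow> rq Y v) (at_right 0)" if v: "v \<in> carrier_vec n" for v
  proof -
    have "((\<lambda>e. Re (\<Sum>i<n. cnj (v $ i) * (\<Sum>k<n. M e $$ (i,k) * v $ k))) \<longlongrightarrow> rq Y v) (at_right 0)"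
      unfolding rq_sum[OF Y v] by (intro tendsto_intros ent) auto
    moreover have "\<forall>\<^sub>F e in at_right 0. Re (\<Sum>i<n. cnj (v $ i) * (\<Sum>k<n. M e $$ (i,k) * v $ k)) = rq (M e) v"
      using ev by (rule eventually_mono) (use rq_sum[OF M(1) v] in auto)
    ultimately show ?thesis by (rule Lim_transform_eventually)
  qed
qed

lemma udiag_plus_eps:
  assumes "unitary_mat n U"
  shows "udiag n U d + complex_of_real e \<cdot>\<^sub>m 1\<^sub>m n = udiag n U (\<lambda>i. d i + e)"
  unfolding udiag_one[OF assms, symmetric] udiag_smult[OF unitary_carrier[OF assms]]
    udiag_add[OF unitary_carrier[OF assms]] by simp

text \<open>Because \<open>inverse 0 = 0\<close>, \<open>matfun inverse A\<close> is the
  pseudo-inverse. The last claim holds since a vector fixed by the support projection has no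
  component with eigenvalue 0, and on the positive eigenvalues adding \<open>e\<close> decreases the
  inverse. It keeps the inverse forms bounded as \<open>e\<close> tends to 0.\<close>

lemma psd_plus_eps:
  assumes A: "A \<in> carrier_mat n n" "psd_mat A" and e: "0 < e"
  defines "Ae \<equiv> A + complex_of_real e \<cdot>\<^sub>m 1\<^sub>m n"
  shows "Ae \<in> carrier_mat n n" "pd_mat Ae" "v \<in> carrier_vec n \<Longrightarrow> rq Ae v = rq A v + e * nsq v"
    "v \<in> carrier_vec n \<Longrightarrow> matfun (\<lambda>t. if t = 0 then 0 else 1) A *\<^sub>v v = v \<Longrightarrow>
      rq (matfun inverse Ae) v \<le> rq (matfun inverse A) v"
proof -
  obtain U d where U: "unitary_mat n U" "A = udiag n U d" "\<And>i. i < n \<Longrightarrow> d i \<ge> 0"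
    using psd_spectral[OF A] by metis
  note c = unitary_carrier[OF U(1)]
  have Ae: "Ae = udiag n U (\<lambda>i. d i + e)" unfolding Ae_def U(2) by (rule udiag_plus_eps[OF U(1)])
  show "Ae \<in> carrier_mat n n" unfolding Ae using c by simp
  show "pd_mat Ae" unfolding Ae using U e by (intro pd_udiag) (auto intro: add_nonneg_pos)
  show "rq Ae v = rq A v + e * nsq v" if v: "v \<in> carrier_vec n"
    unfolding Ae_def using A v by (subst rq_add[of _ n]) (auto simp: rq_smult[OF one_carrier_mat] rq_one)
  show "rq (matfun inverse Ae) v \<le> rq (matfun inverse A) v"
    if v: "v \<in> carrier_vec n" and s: "matfun (\<lambda>t. if t = 0 then 0 else 1) A *\<^sub>v v = v"
  proof -
    let ?v = "U\<dagger> *\<^sub>v v"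
    have z: "?v $ k = 0" if k: "k < n" "d k = 0" for k
    proof -
      have "?v = U\<dagger> *\<^sub>v (U *\<^sub>v vec n (\<lambda>i. complex_of_real (if d i = 0 then 0 else 1) * ?v $ i))"
        using s unfolding U(2) matfun_udiag[OF U(1)] udiag_vec[OF c v] by simp
      also have "\<dots> = vec n (\<lambda>i. complex_of_real (if d i = 0 then 0 else 1) * ?v $ i)"
        by (rule unitary_cancel_vec[OF U(1)]) simp
      finally have "?v $ k = vec n (\<lambda>i. complex_of_real (if d i = 0 then 0 else 1) * ?v $ i) $ k"
        by (rule arg_cong)
      thus ?thesis using k by (simp del: index_mult_mat_vec)
    qed
    have "(\<Sum>k<n. inverse (d k + e) * (cmod (?v $ k))\<^sup>2) \<le> (\<Sum>k<n. inverse (d k) * (cmod (?v $ k))\<^sup>2)"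
    proof (rule sum_mono)
      fix k assume "k \<in> {..<n}"
      hence k: "k < n" by simp
      show "inverse (d k + e) * (cmod (?v $ k))\<^sup>2 \<le> inverse (d k) * (cmod (?v $ k))\<^sup>2"
      proof (cases "d k = 0")
        case False
        hence "d k > 0" using U(3)[OF k] by simp
        thus ?thesis using e by (intro mult_right_mono le_imp_inverse_le) auto
      qed (simp add: z[OF k] del: index_mult_mat_vec)
    qed
    thus ?thesis unfolding Ae unfolding U(2) matfun_udiag[OF U(1)] rq_udiag[OF c v] .
  qed
qed

text \<open>Both bounds for positive definite matrices survive the limit. For the lower one
  \<open>x\<close> has to lie in both ranges, where the inverses of the shifted matrices are
  dominated by the pseudo-inverses.\<close>

lemma kubo_ando_properties:
  assumes f: "km_function f" "(f has_real_derivative \<alpha>) (at 1)" and \<alpha>: "0 < \<alpha>" "\<alpha> < 1"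
    and A: "A \<in> carrier_mat n n" "psd_mat A" and B: "B \<in> carrier_mat n n" "psd_mat B"
  shows "kubo_ando f A B \<in> carrier_mat n n" "psd_mat (kubo_ando f A B)"
    "\<And>v. v \<in> carrier_vec n \<Longrightarrow> rq (kubo_ando f A B) v \<le> (1 - \<alpha>) * rq A v + \<alpha> * rq B v"
    "\<And>v x. v \<in> carrier_vec n \<Longrightarrow> x \<in> carrier_vec n \<Longrightarrow>
       matfun (\<lambda>t. if t = 0 then 0 else 1) A *\<^sub>v x = x \<Longrightarrow>
       matfun (\<lambda>t. if t = 0 then 0 else 1) B *\<^sub>v x = x \<Longrightarrow>
       2 * Re (cip v x) - (1 - \<alpha>) * rq (matfun inverse A) x - \<alpha> * rq (matfun inverse B) x
         \<le> rq (kubo_ando f A B) v"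
proof -
  let ?low = "\<lambda>v x. 2 * Re (cip v x) - (1 - \<alpha>) * rq (matfun inverse A) x - \<alpha> * rq (matfun inverse B) x"
    and ?up = "\<lambda>e v. (1 - \<alpha>) * (rq A v + e * nsq v) + \<alpha> * (rq B v + e * nsq v)"
  define Ae where "Ae e = A + complex_of_real e \<cdot>\<^sub>m 1\<^sub>m n" for e
  define Be where "Be e = B + complex_of_real e \<cdot>\<^sub>m 1\<^sub>m n" for e
  define M where "M e = km_pd f (Ae e) (Be e)" for e
  note a = psd_plus_eps[OF A, folded Ae_def] and b = psd_plus_eps[OF B, folded Be_def]
  have M: "M e \<in> carrier_mat n n" "(M e)\<dagger> = M e" if "0 < e" for e
    unfolding M_def using a[OF that] b[OF that] by (auto intro: km_pd_form)
  have low: "2 * Re (cip v x) - (1 - \<alpha>) * rq (matfun inverse (Ae e)) x - \<alpha> * rq (matfun inverse (Be e)) x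
     \<le> rq (M e) v" if "0 < e" "v \<in> carrier_vec n" "x \<in> carrier_vec n" for e v x
    unfolding M_def using a[OF that(1)] b[OF that(1)] that f by (intro km_pd_lower) auto
  \<comment> \<open>This is the lower bound at \<open>x = 0\<close>.\<close>
  have pos: "0 \<le> rq (M e) v" if e: "0 < e" and v: "v \<in> carrier_vec n" for e v
  proof -
    have "matfun inverse (Ae e) \<in> carrier_mat n n" "matfun inverse (Be e) \<in> carrier_mat n n"
      using a[OF e] b[OF e] by (auto intro: matfun_hermitian pd_adjoint)
    moreover have "cip v (0\<^sub>v n) = 0" using v by (simp add: cip_def)
    ultimately show ?thesis using low[OF e v, of "0\<^sub>v n"] by simp
  qed
  have mono: "rq (M d) v \<le> rq (M e) v" if d: "0 < d" "d \<le> e" and v: "v \<in> carrier_vec n" for d e v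
  proof -
    have e: "0 < e" using d by simp
    have le: "rq (Ae d) w \<le> rq (Ae e) w" "rq (Be d) w \<le> rq (Be e) w" if "w \<in> carrier_vec n" for w
      using a(3)[OF d(1) that] a(3)[OF e that] b(3)[OF d(1) that] b(3)[OF e that] d
      by (auto intro: mult_right_mono)
    have "rq (km_pd f (Ae d) (Be d)) v \<le> rq (km_pd f (Ae d) (Be e)) v"
      by (rule km_pd_mono_right[OF f(1) a(1,2)[OF d(1)] b(1,2)[OF d(1)] b(1,2)[OF e] le(2) v])
    also have "\<dots> \<le> rq (km_pd f (Ae e) (Be e)) v"
      by (rule km_pd_mono_left[OF f(1) a(1,2)[OF d(1)] a(1,2)[OF e] b(1,2)[OF e] le(1) v])
    finally show ?thesis by (simp add: M_def)
  qed
  define Y where "Y = kubo_ando f A B"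
  have Yeq: "Y = mat n n (\<lambda>(i,j). Lim (at_right 0) (\<lambda>e. M e $$ (i,j)))"
    using A(1) by (simp add: Y_def kubo_ando_def M_def Ae_def Be_def)
  have lim: "Y\<dagger> = Y" "\<And>v. v \<in> carrier_vec n \<Longrightarrow> ((\<lambda>e. rq (M e) v) \<longlongrightarrow> rq Y v) (at_right 0)"
    unfolding Yeq by (rule hermitian_monotone_limit[of M n]; use M mono pos in blast)+
  have ev: "\<forall>\<^sub>F e :: real in at_right 0. 0 < e" by (rule eventually_at_right_less)
  show Yc: "kubo_ando f A B \<in> carrier_mat n n" unfolding Y_def[symmetric] Yeq by simp
  have "0 \<le> rq Y v" if v: "v \<in> carrier_vec n" for v
    by (rule tendsto_lowerbound[OF lim(2)[OF v]]) (use ev pos[OF _ v] in \<open>auto elim: eventually_mono\<close>)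
  thus "psd_mat (kubo_ando f A B)"
    using lim(1) Yc unfolding Y_def[symmetric] by (simp add: psd_iff[of _ n])
  show "rq (kubo_ando f A B) v \<le> (1 - \<alpha>) * rq A v + \<alpha> * rq B v" if v: "v \<in> carrier_vec n" for v
    unfolding Y_def[symmetric]
  proof (rule tendsto_le[OF _ _ lim(2)[OF v]])
    have "((\<lambda>e. ?up e v) \<longlongrightarrow>
      (1 - \<alpha>) * (rq A v + 0 * nsq v) + \<alpha> * (rq B v + 0 * nsq v)) (at_right 0)"
      by (intro tendsto_intros)
    thus "((\<lambda>e. ?up e v) \<longlongrightarrow>
      (1 - \<alpha>) * rq A v + \<alpha> * rq B v) (at_right 0)" by simp
    show "\<forall>\<^sub>F e in at_right 0. rq (M e) v \<le> ?up e v"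
      using ev
    proof (rule eventually_mono)
      fix e :: real assume e: "0 < e"
      show "rq (M e) v \<le> ?up e v"
        using km_pd_upper[OF f a(1,2)[OF e] b(1,2)[OF e] v] a(3)[OF e v] b(3)[OF e v] by (simp add: M_def)
    qed
  qed simp
  show "?low v x
         \<le> rq (kubo_ando f A B) v"
    if v: "v \<in> carrier_vec n" and x: "x \<in> carrier_vec n"
      and s: "matfun (\<lambda>t. if t = 0 then 0 else 1) A *\<^sub>v x = x" "matfun (\<lambda>t. if t = 0 then 0 else 1) B *\<^sub>v x = x"
    for v x
    unfolding Y_def[symmetric]
  proof (rule tendsto_lowerbound[OF lim(2)[OF v]])
    show "\<forall>\<^sub>F e in at_right 0. ?low v x
         \<le> rq (M e) v"
      using ev
    proof (rule eventually_mono)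
      fix e :: real assume e: "0 < e"
      have "(1 - \<alpha>) * rq (matfun inverse (Ae e)) x \<le> (1 - \<alpha>) * rq (matfun inverse A) x"
        using \<alpha> a(4)[OF e x s(1)] by (intro mult_left_mono) auto
      moreover have "\<alpha> * rq (matfun inverse (Be e)) x \<le> \<alpha> * rq (matfun inverse B) x"
        using \<alpha> b(4)[OF e x s(2)] by (intro mult_left_mono) auto
      ultimately show "?low v x
         \<le> rq (M e) v"
        using low[OF e v x] by linarith
    qed
  qed simp
qed

section \<open>Powers of sandwiched matrices\<close>

lemma psd_Cauchy_Schwarz:
  assumes G: "G \<in> carrier_mat n n" "psd_mat G" and v: "v \<in> carrier_vec n" and w: "w \<in> carrier_vec n"
  shows "(cmod (cip v (G *\<^sub>v w)))\<^sup>2 \<le> rq G v * rq G w"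
proof -
  obtain U d where U: "unitary_mat n U" "G = udiag n U d" "\<And>i. i < n \<Longrightarrow> d i \<ge> 0"
    using psd_spectral[OF G] by metis
  note c = unitary_carrier[OF U(1)]
  let ?a = "\<lambda>k. (U\<dagger> *\<^sub>v v) $ k" and ?b = "\<lambda>k. (U\<dagger> *\<^sub>v w) $ k"
  have sq: "(sqrt (d k) * cmod x)\<^sup>2 = d k * (cmod x)\<^sup>2" if "k < n" for k x
    using U(3)[OF that] by (simp add: power_mult_distrib)
  have "cmod (cip v (G *\<^sub>v w)) \<le> (\<Sum>k<n. cmod (complex_of_real (d k) * (cnj (?a k) * ?b k)))"
    unfolding U(2) cip_udiag[OF c v w] by (rule norm_sum)
  also have "\<dots> = (\<Sum>k<n. (sqrt (d k) * cmod (?a k)) * (sqrt (d k) * cmod (?b k)))"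
    using U(3) by (intro sum.cong refl) (simp add: norm_mult mult_ac abs_of_nonneg del: index_mult_mat_vec flip: real_sqrt_mult_self)
  finally have "(cmod (cip v (G *\<^sub>v w)))\<^sup>2 \<le> (\<Sum>k<n. (sqrt (d k) * cmod (?a k)) * (sqrt (d k) * cmod (?b k)))\<^sup>2"
    by (intro power_mono) auto
  also have "\<dots> \<le> (\<Sum>k<n. (sqrt (d k) * cmod (?a k))\<^sup>2) * (\<Sum>k<n. (sqrt (d k) * cmod (?b k))\<^sup>2)"
    by (rule Cauchy_Schwarz_ineq_sum)
  also have "\<dots> = rq G v * rq G w"
    unfolding U(2) rq_udiag[OF c v] rq_udiag[OF c w] by (simp add: sq del: index_mult_mat_vec)
  finally show ?thesis .
qed

lemma rq_diag:
  assumes "v \<in> carrier_vec n"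
  shows "rq (udiag n (1\<^sub>m n) z) v = (\<Sum>i<n. z i * (cmod (v $ i))\<^sup>2)"
  using assms by (simp add: rq_udiag[OF one_carrier_mat] del: index_mult_mat_vec)

text \<open>The \<open>i\<close>-th unit vector is an eigenvector of the upper bound and
  \<open>y\<close> is one of \<open>Y\<close>, so the matrix element of their difference
  \<open>G\<close> between the two vectors is \<open>(z i - l) * y $ i\<close>. In the
  Cauchy-Schwarz inequality both forms of \<open>G\<close> are controlled by the width
  \<open>z - x\<close>; the second keeps its sum because in the application this width is not small
  at every index.\<close>

lemma sandwiched_eigenvector:
  assumes Y: "Y \<in> carrier_mat n n" "Y\<dagger> = Y"
    and lo: "\<And>v. v \<in> carrier_vec n \<Longrightarrow> (\<Sum>i<n. x i * (cmod (v $ i))\<^sup>2) \<le> rq Y v"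
    and up: "\<And>v. v \<in> carrier_vec n \<Longrightarrow> rq Y v \<le> (\<Sum>i<n. z i * (cmod (v $ i))\<^sup>2)"
    and y: "y \<in> carrier_vec n" "Y *\<^sub>v y = complex_of_real l \<cdot>\<^sub>v y" and i: "i < n"
  shows "(z i - l)\<^sup>2 * (cmod (y $ i))\<^sup>2 \<le> (z i - x i) * (\<Sum>k<n. (z k - x k) * (cmod (y $ k))\<^sup>2)"
proof -
  let ?Z = "udiag n (1\<^sub>m n) z" and ?e = "unit_vec n i :: complex vec"
  define G where "G = ?Z - Y"
  have G: "G \<in> carrier_mat n n" using Y by (simp add: G_def minus_carrier_mat)
  have rqG: "rq G v = (\<Sum>i<n. z i * (cmod (v $ i))\<^sup>2) - rq Y v" if "v \<in> carrier_vec n" for v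
    unfolding G_def using Y that by (subst rq_minus[of _ n]) (auto simp: rq_diag)
  have psd: "psd_mat G"
  proof -
    have "G\<dagger> = G"
      unfolding G_def using Y by (subst mat_adjoint_minus[of _ n n]) (auto simp: udiag_adjoint[OF one_carrier_mat])
    thus ?thesis unfolding psd_iff[OF G] using rqG up by auto
  qed
  have single: "(\<Sum>k<n. w k * (cmod (?e $ k))\<^sup>2) = w i" for w :: "nat \<Rightarrow> real"
  proof -
    have "(\<Sum>k<n. w k * (cmod (?e $ k))\<^sup>2) = (\<Sum>k<n. if k = i then w i else 0)"
      by (intro sum.cong) (use i in auto)
    thus ?thesis using i by simp
  qed
  have "cip ?e (G *\<^sub>v y) = complex_of_real (z i - l) * y $ i"
  proof -
    have "cip ?e (G *\<^sub>v y) = (\<Sum>k<n. if k = i then (G *\<^sub>v y) $ i else 0)"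
      unfolding cip_def using i by (intro sum.cong) auto
    also have "\<dots> = (G *\<^sub>v y) $ i" using i by simp
    finally have 1: "cip ?e (G *\<^sub>v y) = (G *\<^sub>v y) $ i" .
    have "G *\<^sub>v y = ?Z *\<^sub>v y - Y *\<^sub>v y"
      unfolding G_def using Y y by (subst minus_mult_distrib_mat_vec[of _ n n]) auto
    also have "?Z *\<^sub>v y = vec n (\<lambda>i. complex_of_real (z i) * y $ i)"
      using y(1) by (simp add: udiag_vec[OF one_carrier_mat] del: index_mult_mat_vec)
    finally have 2: "G *\<^sub>v y = vec n (\<lambda>i. complex_of_real (z i) * y $ i) - Y *\<^sub>v y" .
    show ?thesis unfolding 1 unfolding 2 using y i by (simp add: algebra_simps del: index_mult_mat_vec)
  qed
  hence "(z i - l)\<^sup>2 * (cmod (y $ i))\<^sup>2 = (cmod (cip ?e (G *\<^sub>v y)))\<^sup>2"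
    by (simp add: norm_mult power_mult_distrib del: of_real_diff)
  also have "\<dots> \<le> rq G ?e * rq G y"
    by (rule psd_Cauchy_Schwarz[OF G psd _ y(1)]) simp
  also have "\<dots> \<le> (z i - x i) * (\<Sum>k<n. (z k - x k) * (cmod (y $ k))\<^sup>2)"
  proof (rule mult_mono)
    show "rq G ?e \<le> z i - x i" using rqG[of ?e] lo[of ?e] unfolding single by simp
    show "rq G y \<le> (\<Sum>k<n. (z k - x k) * (cmod (y $ k))\<^sup>2)"
      using rqG[OF y(1)] lo[OF y(1)] by (simp add: left_diff_distrib sum_subtractf)
    show "0 \<le> rq G y" using psd y(1) by (simp add: psd_iff[OF G])
    have "0 \<le> rq G ?e" using psd by (simp add: psd_iff[OF G])
    thus "0 \<le> z i - x i" using rqG[of ?e] lo[of ?e] unfolding single by simp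
  qed
  finally show ?thesis .
qed

text \<open>\<open>(1 + p * K) powr (1/p)\<close> never exceeds \<open>exp K\<close>, which bounds
  both the power and, up to the factor \<open>1/p\<close>, its derivative. Hence an error of o(p) in
  an eigenvalue is harmless after the power.\<close>

lemma powr_inverse_bound:
  fixes p K s t :: real
  assumes p: "0 < p" "p \<le> 1" and K: "0 \<le> K" and s: "0 \<le> s" "s \<le> 1 + p * K" and t: "0 \<le> t" "t \<le> 1 + p * K"
  shows "s powr (1/p) \<le> exp K" "\<bar>s powr (1/p) - t powr (1/p)\<bar> \<le> exp K * \<bar>s - t\<bar> / p"
proof -
  have m: "u powr (1/p) \<le> exp K" if u: "0 \<le> u" "u \<le> 1 + p * K" for u
  proof -
    have "u powr (1/p) \<le> (1 + p * K) powr (1/p)" by (rule powr_mono2) (use u p in auto)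
    also have "\<dots> \<le> exp (p * K) powr (1/p)" using p K by (intro powr_mono2 exp_ge_add_one_self) auto
    also have "\<dots> = exp K" using p by (simp add: powr_def)
    finally show ?thesis .
  qed
  show "s powr (1/p) \<le> exp K" by (rule m[OF s])
  have *: "b powr (1/p) - a powr (1/p) \<le> exp K * (b - a) / p"
    if ab: "0 \<le> a" "a \<le> b" "b \<le> 1 + p * K" for a b
  proof (cases "a = b")
    case False
    hence lt: "a < b" using ab by simp
    have q0: "0 \<le> 1 / p - 1" using p by simp
    have "continuous_on {a..b} (\<lambda>x. x powr (1/p))"
      using ab p by (intro continuous_on_powr' continuous_intros) auto
    moreover have der: "((\<lambda>x. x powr (1/p)) has_real_derivative 1 / p * x powr (1/p - 1)) (at x)" if "a < x" for x
      using ab that by (intro has_real_derivative_powr) auto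
    ultimately obtain l c where c: "a < c" "c < b" "((\<lambda>x. x powr (1/p)) has_real_derivative l) (at c)"
        "b powr (1/p) - a powr (1/p) = (b - a) * l"
      using MVT[OF lt] real_differentiable_def by metis
    have l: "l = 1 / p * c powr (1/p - 1)" using DERIV_unique[OF c(3) der[OF c(1)]] .
    have "c powr (1/p - 1) \<le> (1 + p * K) powr (1/p - 1)" using ab c q0 by (intro powr_mono2) auto
    also have "\<dots> \<le> (1 + p * K) powr (1/p)" using p K by (intro powr_mono) auto
    also have "\<dots> \<le> exp K" using p K by (intro m) auto
    finally have "(b - a) * (1 / p * c powr (1/p - 1)) \<le> (b - a) * (1 / p * exp K)"
      using p lt by (intro mult_left_mono) auto
    thus ?thesis unfolding c(4) l by (simp add: mult_ac)
  qed simp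
  show "\<bar>s powr (1/p) - t powr (1/p)\<bar> \<le> exp K * \<bar>s - t\<bar> / p"
    using *[of s t] *[of t s] s t powr_mono2[of "1/p" s t] powr_mono2[of "1/p" t s] p
    by (cases "s \<le> t") (auto simp: abs_if)
qed

text \<open>\<open>r\<close> stands for the modulus of the \<open>i\<close>-th coordinate of a unit eigenvector with eigenvalue \<open>l\<close>,
  and \<open>s\<close> for the total weight of the coordinates outside \<open>J\<close>. Eigenvalues below
  \<open>1 - sqrt p\<close> are killed by the power \<open>1/p\<close>; above this threshold \<open>s = O(sqrt p)\<close>.\<close>

lemma eigenvector_coordinate_bound:
  fixes C K c p l h r s :: real
  assumes C: "0 < C" and K: "1 \<le> K" and c: "0 < c" "c \<le> 1" and p: "0 < p" "p \<le> 1" "sqrt p \<le> 1 / (2 * K)"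
    and l: "0 \<le> l" "l * 1 \<le> (1 + p * K) * (1 - s) + (1 - c) * s" and s: "0 \<le> s" "s \<le> 1"
    and r: "0 \<le> r" "r \<le> 1"
  shows "\<lbrakk>z = 1 + p * h + C * p\<^sup>2; \<bar>h\<bar> + C \<le> K; (z - l)\<^sup>2 * r\<^sup>2 \<le> 2 * C * p\<^sup>2 * (2 * C * p\<^sup>2 + s)\<rbrakk> \<Longrightarrow>
      \<bar>l powr (1/p) - exp h\<bar> * r \<le> exp K * sqrt (2 * C * (2 * C * p\<^sup>2 + (sqrt p + p * K) / c))
        + \<bar>z powr (1/p) - exp h\<bar> + 2 * exp K * sqrt (8 * C * p * (2 * C * p\<^sup>2 + 1))"
    and "r\<^sup>2 \<le> s \<Longrightarrow> l powr (1/p) * r \<le> exp K * sqrt ((sqrt p + p * K) / c) + (1 - sqrt p) powr (1/p)"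
proof -
  let ?X = "sqrt (2 * C * (2 * C * p\<^sup>2 + (sqrt p + p * K) / c))" and ?R = "sqrt (8 * C * p * (2 * C * p\<^sup>2 + 1))" and ?S = "sqrt ((sqrt p + p * K) / c)"
  \<comment> \<open>Ensures that \<open>z\<close>, which is at least \<open>1 - p * K\<close>, lies
    above the threshold \<open>1 - sqrt p\<close> by at least \<open>sqrt p / 2\<close>.\<close>
  have pK: "p * K \<le> sqrt p / 2"
  proof -
    have "sqrt p * (sqrt p * K) \<le> sqrt p * (1/2)"
      using p(3) K p by (intro mult_left_mono) (auto simp: field_simps)
    thus ?thesis using p by (simp add: mult.assoc[symmetric])
  qed
  have l1: "l \<le> 1 + p * K"
  proof -
    have "(1 - c) * s \<le> (1 + p * K) * s" using s c p K by (intro mult_right_mono) (auto intro: order.trans[of _ 0])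
    thus ?thesis using l by (simp add: algebra_simps)
  qed
  \<comment> \<open>The upper bound on \<open>l\<close> equals
    \<open>1 + p * K - (c + p * K) * s\<close>: weight outside \<open>J\<close> lowers it at a rate
    of at least \<open>c\<close>.\<close>
  have large: "s \<le> (sqrt p + p * K) / c" if "1 - sqrt p \<le> l"
  proof -
    have "0 \<le> p * K * s" using s p K by simp
    hence "s * c \<le> sqrt p + p * K" using l that by (simp add: algebra_simps)
    thus ?thesis using c by (simp add: field_simps)
  qed
  have eK: "l powr (1/p) \<le> exp K"
    by (rule powr_inverse_bound(1)[OF p(1,2) _ l(1) l1 l(1) l1]) (use K in simp)
  show "\<bar>l powr (1/p) - exp h\<bar> * r \<le> exp K * ?X
        + \<bar>z powr (1/p) - exp h\<bar> + 2 * exp K * ?R"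
    if z: "z = 1 + p * h + C * p\<^sup>2" and hK: "\<bar>h\<bar> + C \<le> K"
      and b: "(z - l)\<^sup>2 * r\<^sup>2 \<le> 2 * C * p\<^sup>2 * (2 * C * p\<^sup>2 + s)"
  proof -
    have p2: "p\<^sup>2 \<le> p" using p by (simp add: power2_eq_square mult_le_cancel_left1)
    have ph: "\<bar>p * h\<bar> \<le> p * \<bar>h\<bar>" using p by (simp add: abs_mult)
    have phK: "p * \<bar>h\<bar> + C * p \<le> p * K" using mult_left_mono[OF hK, of p] p by (simp add: algebra_simps)
    have Cp: "C * p\<^sup>2 \<le> C * p" using p2 C by simp
    have zle: "z \<le> 1 + p * K" using ph phK Cp by (simp add: z)
    have zge: "1 - p * K \<le> z"
    proof -
      have "0 \<le> C * p\<^sup>2" "0 \<le> C * p" using C p by auto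
      thus ?thesis using ph phK by (simp add: z)
    qed
    have sp: "sqrt p \<le> 1" using p by simp
    have z0: "0 \<le> z" using zge pK sp by linarith
    have T: "0 \<le> \<bar>z powr (1/p) - exp h\<bar>" "0 \<le> 2 * exp K * ?R"
      "0 \<le> exp K * ?X"
      using C K c p by (auto intro!: mult_nonneg_nonneg add_nonneg_nonneg)
    show ?thesis
    proof (cases "1 - sqrt p \<le> l")
      case True
      \<comment> \<open>The error becomes \<open>p\<close> times a quantity that tends to 0, which
        compensates the factor \<open>1/p\<close> in \<open>powr_inverse_bound\<close>.\<close>
      have "(\<bar>l - z\<bar> * r)\<^sup>2 \<le> p\<^sup>2 * (2 * C * (2 * C * p\<^sup>2 + (sqrt p + p * K) / c))"
      proof -
        have "(\<bar>l - z\<bar> * r)\<^sup>2 = (z - l)\<^sup>2 * r\<^sup>2"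
          by (simp add: power_mult_distrib power2_commute)
        also have "\<dots> \<le> 2 * C * p\<^sup>2 * (2 * C * p\<^sup>2 + (sqrt p + p * K) / c)"
          using b large[OF True] C by (elim order.trans) (intro mult_left_mono, auto)
        finally show ?thesis by (simp only: mult_ac)
      qed
      hence "\<bar>l - z\<bar> * r \<le> sqrt (p\<^sup>2 * (2 * C * (2 * C * p\<^sup>2 + (sqrt p + p * K) / c)))"
        by (rule real_le_rsqrt)
      hence A: "\<bar>l - z\<bar> * r \<le> p * ?X"
        using p by (simp only: real_sqrt_mult real_sqrt_abs abs_of_pos)
      have "\<bar>l powr (1/p) - exp h\<bar> * r \<le> (\<bar>l powr (1/p) - z powr (1/p)\<bar> + \<bar>z powr (1/p) - exp h\<bar>) * r"
        using r by (intro mult_right_mono) auto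
      also have "\<dots> \<le> exp K * \<bar>l - z\<bar> / p * r + \<bar>z powr (1/p) - exp h\<bar> * 1"
        unfolding distrib_right using r K
        by (intro add_mono mult_right_mono mult_left_mono powr_inverse_bound(2)[OF p(1,2) _ l(1) l1 z0 zle]) auto
      also have "exp K * \<bar>l - z\<bar> / p * r = exp K * (\<bar>l - z\<bar> * r / p)" by simp
      also have "\<dots> \<le> exp K * ?X"
        using A p by (intro mult_left_mono) (auto simp: field_simps)
      finally show ?thesis using T by simp
    next
      case False
      \<comment> \<open>Here the power of \<open>l\<close> may be far from \<open>exp h\<close>, but
        \<open>r\<close> is small: \<open>z - l\<close> is at least of order \<open>sqrt p\<close>,
        while the right-hand side of the assumed bound is O(p^2).\<close>
      have "sqrt p / 2 \<le> z - l" using False zge pK by linarith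
      hence "(sqrt p / 2)\<^sup>2 \<le> (z - l)\<^sup>2" using p by (intro power_mono) auto
      hence "p / 4 * r\<^sup>2 \<le> (z - l)\<^sup>2 * r\<^sup>2" using p by (intro mult_right_mono) (auto simp: power_divide)
      also have "\<dots> \<le> 2 * C * p\<^sup>2 * (2 * C * p\<^sup>2 + 1)"
        using b s C by (elim order.trans) (intro mult_left_mono, auto)
      finally have "p * r\<^sup>2 \<le> p * (8 * C * p * (2 * C * p\<^sup>2 + 1))"
        by (simp add: power2_eq_square mult_ac)
      hence "r\<^sup>2 \<le> 8 * C * p * (2 * C * p\<^sup>2 + 1)" using p by simp
      hence R: "r \<le> ?R" by (rule real_le_rsqrt)
      have "exp h \<le> exp K" using hK C by simp
      hence "\<bar>l powr (1/p) - exp h\<bar> \<le> 2 * exp K"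
        using eK powr_ge_zero[of l "1/p"] exp_gt_zero[of h] by linarith
      hence "\<bar>l powr (1/p) - exp h\<bar> * r \<le> 2 * exp K * ?R"
        using R r by (intro mult_mono) auto
      thus ?thesis using T by linarith
    qed
  qed
  show "l powr (1/p) * r \<le> exp K * ?S + (1 - sqrt p) powr (1/p)" if rs: "r\<^sup>2 \<le> s"
  proof (cases "1 - sqrt p \<le> l")
    case True
    have "r\<^sup>2 \<le> (sqrt p + p * K) / c" using rs large[OF True] by linarith
    hence "r \<le> ?S" by (rule real_le_rsqrt)
    hence "l powr (1/p) * r \<le> exp K * ?S"
      using eK r by (intro mult_mono) auto
    thus ?thesis using powr_ge_zero[of "1 - sqrt p" "1/p"] by linarith
  next
    case False
    have "l powr (1/p) * r \<le> (1 - sqrt p) powr (1/p) * 1"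
      using False l(1) p r by (intro mult_mono powr_mono2) auto
    moreover have "0 \<le> exp K * ?S" using p K c by simp
    ultimately show ?thesis by linarith
  qed
qed

lemma powr_limit_exp: "((\<lambda>p. (1 + p * h + C * p\<^sup>2) powr (1/p)) \<longlongrightarrow> exp h) (at_right (0::real))"
  by real_asymp

lemma powr_limit_zero: "((\<lambda>p. (1 - sqrt p) powr (1/p)) \<longlongrightarrow> 0) (at_right (0::real))"
  by real_asymp

lemma udiag_entry:
  assumes "U \<in> carrier_mat n n" "i < n" "k < n"
  shows "udiag n U d $$ (i,k) = (\<Sum>j<n. complex_of_real (d j) * (U $$ (i,j) * cnj (U $$ (k,j))))"
proof -
  have "udiag n U d $$ (i,k) = (\<Sum>j<n. (U * mat_diag n (\<lambda>j. complex_of_real (d j))) $$ (i,j) * U\<dagger> $$ (j,k))"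
    unfolding udiag_def using assms by (intro index_mult_mat_sum[of _ n]) auto
  also have "\<dots> = (\<Sum>j<n. complex_of_real (d j) * (U $$ (i,j) * cnj (U $$ (k,j))))"
    using assms by (intro sum.cong refl) (simp add: mat_diag_mult_right[of _ n])
  finally show ?thesis .
qed

text \<open>The entry is expanded in an eigenbasis \<open>R\<close> of \<open>Y p\<close>. In row
  \<open>i\<close> every power \<open>l j powr (1/p)\<close> may be replaced by the same number
  \<open>ell\<close>, at a cost of at most \<open>\<beta> p\<close> after multiplication with the
  coordinate \<open>R $$ (i,j)\<close>. Orthonormality of the rows of \<open>R\<close> then leaves
  \<open>ell\<close> if \<open>i = k\<close> and 0 otherwise.\<close>

lemma sandwiched_power_limit_diagonal:
  fixes Y :: "real \<Rightarrow> complex mat" and J :: "nat \<Rightarrow> bool" and h :: "nat \<Rightarrow> real"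
  assumes C: "0 < C" and c: "0 < c" "c \<le> 1" and p0: "0 < p0"
  defines "x \<equiv> \<lambda>p i. if J i then 1 + p * h i - C * p\<^sup>2 else 0"
    and "z \<equiv> \<lambda>p i. if J i then 1 + p * h i + C * p\<^sup>2 else 1 - c"
  assumes Y: "\<And>p. 0 < p \<Longrightarrow> p < p0 \<Longrightarrow> Y p \<in> carrier_mat n n" "\<And>p. 0 < p \<Longrightarrow> p < p0 \<Longrightarrow> psd_mat (Y p)"
    and lo: "\<And>p v. 0 < p \<Longrightarrow> p < p0 \<Longrightarrow> v \<in> carrier_vec n \<Longrightarrow> (\<Sum>i<n. x p i * (cmod (v $ i))\<^sup>2) \<le> rq (Y p) v"
    and up: "\<And>p v. 0 < p \<Longrightarrow> p < p0 \<Longrightarrow> v \<in> carrier_vec n \<Longrightarrow> rq (Y p) v \<le> (\<Sum>i<n. z p i * (cmod (v $ i))\<^sup>2)"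
    and ik: "i < n" "k < n"
  shows "((\<lambda>p. mat_powr (Y p) (1/p) $$ (i,k)) \<longlongrightarrow> (if i = k \<and> J i then exp (h i) else 0)) (at_right 0)"
proof -
  define K where "K = 1 + C + (\<Sum>i<n. \<bar>h i\<bar>)"
  have hK: "\<bar>h j\<bar> + C \<le> K" if "j < n" for j
  proof -
    have "\<bar>h j\<bar> \<le> (\<Sum>i<n. \<bar>h i\<bar>)" using that by (intro member_le_sum[of j "{..<n}" "\<lambda>i. \<bar>h i\<bar>"]) auto
    thus ?thesis by (simp add: K_def)
  qed
  have K: "1 \<le> K" unfolding K_def using C by (simp add: sum_nonneg)
  define ell where "ell = (if J i then exp (h i) else 0)"
  \<comment> \<open>The sum of the two error bounds of \<open>eigenvector_coordinate_bound\<close>,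
    so that one null function serves indices inside and outside \<open>J\<close>.\<close>
  define \<beta> where "\<beta> p = exp K * sqrt (2 * C * (2 * C * p\<^sup>2 + (sqrt p + p * K) / c))
        + \<bar>(1 + p * h i + C * p\<^sup>2) powr (1/p) - exp (h i)\<bar> + 2 * exp K * sqrt (8 * C * p * (2 * C * p\<^sup>2 + 1))
        + (exp K * sqrt ((sqrt p + p * K) / c) + (1 - sqrt p) powr (1/p))" for p
  have "(\<beta> \<longlongrightarrow> exp K * sqrt (2 * C * (2 * C * 0\<^sup>2 + (sqrt 0 + 0 * K) / c))
        + \<bar>exp (h i) - exp (h i)\<bar> + 2 * exp K * sqrt (8 * C * 0 * (2 * C * 0\<^sup>2 + 1))
        + (exp K * sqrt ((sqrt 0 + 0 * K) / c) + 0)) (at_right 0)"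
    unfolding \<beta>_def by (intro tendsto_intros powr_limit_exp powr_limit_zero) (use c in auto)
  hence \<beta>0: "(\<beta> \<longlongrightarrow> 0) (at_right 0)" by simp
  let ?X = "\<lambda>p. sqrt (2 * C * (2 * C * p\<^sup>2 + (sqrt p + p * K) / c))" and ?R = "\<lambda>p. sqrt (8 * C * p * (2 * C * p\<^sup>2 + 1))" and ?S = "\<lambda>p. sqrt ((sqrt p + p * K) / c)"
    and ?lim = "if i = k \<and> J i then exp (h i) else 0"
  have bound: "cmod (mat_powr (Y p) (1/p) $$ (i,k) - ?lim) \<le> real n * \<beta> p"
    if p: "0 < p" "p < p0" "p \<le> 1" "sqrt p \<le> 1 / (2 * K)" for p
  proof -
    obtain R l where R: "unitary_mat n R" "Y p = udiag n R l" "\<And>i. i < n \<Longrightarrow> l i \<ge> 0"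
      using psd_spectral[OF Y[OF p(1,2)]] by metis
    note cR = unitary_carrier[OF R(1)]
    have coord: "\<bar>l j powr (1/p) - ell\<bar> * cmod (R $$ (i,j)) \<le> \<beta> p" if j: "j < n" for j
    proof -
      let ?y = "R *\<^sub>v unit_vec n j"
      have y: "?y \<in> carrier_vec n" using cR by simp
      have yi: "?y $ m = R $$ (m,j)" if "m < n" for m using cR j that by simp
      have ny: "(\<Sum>m<n. (cmod (R $$ (m,j)))\<^sup>2) = 1"
      proof -
        have "(\<Sum>m<n. (cmod (R $$ (m,j)))\<^sup>2) = nsq ?y"
          unfolding nsq_def carrier_vecD[OF y] by (intro sum.cong) (auto simp: yi simp del: index_mult_mat_vec)
        also have "\<dots> = nsq (unit_vec n j :: complex vec)" by (rule unitary_nsq[OF R(1)]) simp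
        finally show ?thesis unfolding nsq_unit_vec[OF j] .
      qed
      define s where "s = (\<Sum>m<n. if J m then 0 else (cmod (R $$ (m,j)))\<^sup>2)"
      have s: "0 \<le> s" "s \<le> 1"
        unfolding s_def ny[symmetric] by (auto intro!: sum_nonneg sum_mono)
      have s': "(\<Sum>m<n. if J m then (cmod (R $$ (m,j)))\<^sup>2 else 0) = 1 - s"
        unfolding s_def ny[symmetric] sum_subtractf[symmetric] by (intro sum.cong) auto
      have ri: "(cmod (R $$ (i,j)))\<^sup>2 \<le> (\<Sum>m<n. (cmod (R $$ (m,j)))\<^sup>2)"
        using ik by (intro member_le_sum[of i "{..<n}" "\<lambda>m. (cmod (R $$ (m,j)))\<^sup>2"]) auto
      hence r1: "cmod (R $$ (i,j)) \<le> 1" unfolding ny by (simp add: power_le_one_iff)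
      have p2: "p\<^sup>2 \<le> p" using p by (simp add: power2_eq_square mult_le_cancel_left1)
      have ev: "l j = rq (Y p) ?y" unfolding R(2) by (rule rq_udiag_col[OF R(1) j, symmetric])
      also have "\<dots> \<le> (\<Sum>m<n. z p m * (cmod (?y $ m))\<^sup>2)" by (rule up[OF p(1,2) y])
      also have "\<dots> = (\<Sum>m<n. z p m * (cmod (R $$ (m,j)))\<^sup>2)"
        by (intro sum.cong refl) (simp add: yi del: index_mult_mat_vec)
      also have "\<dots> \<le> (\<Sum>m<n. (1 + p * K) * (if J m then (cmod (R $$ (m,j)))\<^sup>2 else 0)
          + (1 - c) * (if J m then 0 else (cmod (R $$ (m,j)))\<^sup>2))"
      proof (rule sum_mono)
        fix m assume "m \<in> {..<n}"
        hence "\<bar>h m\<bar> + C \<le> K" using hK by simp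
        hence "p * h m + p * C \<le> p * K" using p by (simp add: distrib_left[symmetric] abs_le_iff)
        moreover have "C * p\<^sup>2 \<le> p * C" using p2 C by simp
        ultimately show "z p m * (cmod (R $$ (m,j)))\<^sup>2 \<le> (1 + p * K) * (if J m then (cmod (R $$ (m,j)))\<^sup>2 else 0)
          + (1 - c) * (if J m then 0 else (cmod (R $$ (m,j)))\<^sup>2)"
          by (auto simp: z_def intro!: mult_right_mono)
      qed
      also have "\<dots> = (1 + p * K) * (1 - s) + (1 - c) * s"
        unfolding sum.distrib sum_distrib_left[symmetric] s' by (simp add: s_def)
      finally have lj: "l j * 1 \<le> (1 + p * K) * (1 - s) + (1 - c) * s" by simp
      note B = eigenvector_coordinate_bound[OF C K c p(1,3,4) R(3)[OF j] lj s norm_ge_zero r1]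
      have nn: "0 \<le> exp K * ?X p
        + \<bar>(1 + p * h i + C * p\<^sup>2) powr (1/p) - exp (h i)\<bar> + 2 * exp K * ?R p"
        "0 \<le> exp K * ?S p + (1 - sqrt p) powr (1/p)"
        using C K c p by (auto intro!: mult_nonneg_nonneg add_nonneg_nonneg)
      show ?thesis
      proof (cases "J i")
        case True
        have "(z p i - l j)\<^sup>2 * (cmod (?y $ i))\<^sup>2 \<le> (z p i - x p i) * (\<Sum>m<n. (z p m - x p m) * (cmod (?y $ m))\<^sup>2)"
          using Y[OF p(1,2)] udiag_col_eigenvector[OF R(1) j, of l]
          by (intro sandwiched_eigenvector[OF _ _ lo[OF p(1,2)] up[OF p(1,2)] y _ ik(1)])
            (auto simp: psd_adjoint R(2)[symmetric])
        also have "z p i - x p i = 2 * C * p\<^sup>2" using True by (simp add: z_def x_def)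
        finally have main: "(z p i - l j)\<^sup>2 * (cmod (?y $ i))\<^sup>2 \<le> 2 * C * p\<^sup>2 * (\<Sum>m<n. (z p m - x p m) * (cmod (?y $ m))\<^sup>2)" .
        have "(\<Sum>m<n. (z p m - x p m) * (cmod (?y $ m))\<^sup>2)
            \<le> (\<Sum>m<n. 2 * C * p\<^sup>2 * (cmod (R $$ (m,j)))\<^sup>2 + (if J m then 0 else (cmod (R $$ (m,j)))\<^sup>2))"
        proof (rule sum_mono)
          fix m assume "m \<in> {..<n}"
          hence m: "m < n" by simp
          have a: "0 \<le> 2 * C * p\<^sup>2 * (cmod (R $$ (m,j)))\<^sup>2" "0 \<le> c * (cmod (R $$ (m,j)))\<^sup>2"
            using C c by auto
          show "(z p m - x p m) * (cmod (?y $ m))\<^sup>2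
              \<le> 2 * C * p\<^sup>2 * (cmod (R $$ (m,j)))\<^sup>2 + (if J m then 0 else (cmod (R $$ (m,j)))\<^sup>2)"
            unfolding yi[OF m] using a by (auto simp: z_def x_def algebra_simps)
        qed
        also have "\<dots> = 2 * C * p\<^sup>2 * 1 + s"
          unfolding sum.distrib sum_distrib_left[symmetric] ny s_def ..
        finally have "2 * C * p\<^sup>2 * (\<Sum>m<n. (z p m - x p m) * (cmod (?y $ m))\<^sup>2) \<le> 2 * C * p\<^sup>2 * (2 * C * p\<^sup>2 * 1 + s)"
          using C by (intro mult_left_mono) auto
        with main have "(z p i - l j)\<^sup>2 * (cmod (R $$ (i,j)))\<^sup>2 \<le> 2 * C * p\<^sup>2 * (2 * C * p\<^sup>2 + s)"
          unfolding yi[OF ik(1)] by simp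
        hence "\<bar>l j powr (1/p) - exp (h i)\<bar> * cmod (R $$ (i,j)) \<le> exp K * ?X p
          + \<bar>z p i powr (1/p) - exp (h i)\<bar> + 2 * exp K * ?R p"
          using True by (intro B(1)[OF _ hK[OF ik(1)]]) (auto simp: z_def)
        thus ?thesis using nn True by (simp add: \<beta>_def ell_def z_def)
      next
        case False
        have "(cmod (R $$ (i,j)))\<^sup>2 = (if J i then 0 else (cmod (R $$ (i,j)))\<^sup>2)" using False by simp
        also have "\<dots> \<le> s" unfolding s_def
          using ik by (intro member_le_sum[of i "{..<n}" "\<lambda>m. if J m then 0 else (cmod (R $$ (m,j)))\<^sup>2"]) auto
        finally have "l j powr (1/p) * cmod (R $$ (i,j)) \<le> exp K * ?S p + (1 - sqrt p) powr (1/p)"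
          by (rule B(2))
        thus ?thesis using nn False by (simp add: \<beta>_def ell_def)
      qed
    qed
    have Rk: "cmod (R $$ (k,j)) \<le> 1" if j: "j < n" for j
    proof -
      have "(R\<dagger> * R) $$ (j,j) = 1" using unitary_left[OF R(1)] j by simp
      moreover have "(R\<dagger> * R) $$ (j,j) = (\<Sum>m<n. R\<dagger> $$ (j,m) * R $$ (m,j))"
        using cR j by (intro index_mult_mat_sum[of _ n n]) auto
      moreover have "\<dots> = complex_of_real (\<Sum>m<n. (cmod (R $$ (m,j)))\<^sup>2)"
        unfolding of_real_sum using cR j
        by (intro sum.cong refl) (simp add: complex_norm_square mult.commute del: of_real_power)
      ultimately have "(\<Sum>m<n. (cmod (R $$ (m,j)))\<^sup>2) = 1" by (metis of_real_eq_1_iff)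
      moreover have "(cmod (R $$ (k,j)))\<^sup>2 \<le> (\<Sum>m<n. (cmod (R $$ (m,j)))\<^sup>2)"
        using ik by (intro member_le_sum[of k "{..<n}" "\<lambda>m. (cmod (R $$ (m,j)))\<^sup>2"]) auto
      ultimately show ?thesis by (simp add: power_le_one_iff)
    qed
    have one: "(\<Sum>j<n. R $$ (i,j) * cnj (R $$ (k,j))) = (if i = k then 1 else 0)"
      using udiag_entry[OF cR ik, of "\<lambda>_. 1"] ik by (simp add: udiag_one[OF R(1)])
    have "mat_powr (Y p) (1/p) $$ (i,k) - complex_of_real ?lim
      = (\<Sum>j<n. complex_of_real (l j powr (1/p)) * (R $$ (i,j) * cnj (R $$ (k,j))))
        - complex_of_real ell * (\<Sum>j<n. R $$ (i,j) * cnj (R $$ (k,j)))"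
      unfolding one R(2) mat_powr_def matfun_udiag[OF R(1)] udiag_entry[OF cR ik] by (simp add: ell_def)
    also have "\<dots> = (\<Sum>j<n. complex_of_real (l j powr (1/p) - ell) * R $$ (i,j) * cnj (R $$ (k,j)))"
      unfolding sum_distrib_left sum_subtractf[symmetric] by (intro sum.cong refl) (simp add: algebra_simps)
    also have "cmod \<dots> \<le> (\<Sum>j<n. \<beta> p)"
    proof (intro order.trans[OF norm_sum] sum_mono)
      fix j assume "j \<in> {..<n}"
      hence j: "j < n" by simp
      have "cmod (complex_of_real (l j powr (1/p) - ell) * R $$ (i,j) * cnj (R $$ (k,j)))
          = (\<bar>l j powr (1/p) - ell\<bar> * cmod (R $$ (i,j))) * cmod (R $$ (k,j))"
        by (simp add: norm_mult del: of_real_diff)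
      also have "\<dots> \<le> (\<bar>l j powr (1/p) - ell\<bar> * cmod (R $$ (i,j))) * 1"
        using Rk[OF j] by (intro mult_left_mono) auto
      also have "\<dots> \<le> \<beta> p" using coord[OF j] by simp
      finally show "cmod (complex_of_real (l j powr (1/p) - ell) * R $$ (i,j) * cnj (R $$ (k,j))) \<le> \<beta> p" .
    qed
    finally show ?thesis by simp
  qed
  show ?thesis
  proof (rule LIM_zero_cancel, rule Lim_null_comparison)
    \<comment> \<open>The entry \<open>1 / (4 * K\<^sup>2)\<close> is the square of
      \<open>1 / (2 * K)\<close>, the bound required of \<open>sqrt p\<close>.\<close>
    define q where "q = min p0 (min 1 (1 / (4 * K\<^sup>2)))"
    have q: "0 < q" using p0 K by (simp add: q_def)
    show "\<forall>\<^sub>F p in at_right 0. cmod (mat_powr (Y p) (1/p) $$ (i,k) - complex_of_real ?lim)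
      \<le> real n * \<beta> p"
      using eventually_at_right_real[OF q]
    proof (rule eventually_mono)
      fix p assume p: "p \<in> {0<..<q}"
      hence p': "0 < p" "p < p0" "p \<le> 1" "p \<le> 1 / (4 * K\<^sup>2)" by (auto simp: q_def)
      have "sqrt p \<le> sqrt ((1 / (2 * K))\<^sup>2)"
        using p'(4) by (intro real_sqrt_le_mono) (simp add: power_divide power_mult_distrib)
      hence "sqrt p \<le> 1 / (2 * K)" using K by simp
      thus "cmod (mat_powr (Y p) (1/p) $$ (i,k) - complex_of_real ?lim) \<le> real n * \<beta> p"
        using bound[OF p'(1-3)] by simp
    qed
    show "((\<lambda>p. real n * \<beta> p) \<longlongrightarrow> 0) (at_right 0)"
      using tendsto_mult[OF tendsto_const \<beta>0, of "real n"] by simp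
  qed
qed

section \<open>Projections and expansions of powers\<close>

lemma vec_eqI_carrier:
  assumes "v \<in> carrier_vec n" "w \<in> carrier_vec n" "\<And>i. i < n \<Longrightarrow> v $ i = w $ i"
  shows "v = w"
  using assms by (intro eq_vecI) auto

lemma conj_entry:
  assumes "E \<in> carrier_mat n n" "X \<in> carrier_mat n n" "i < n" "k < n"
  shows "(E * X * E\<dagger>) $$ (i,k) = (\<Sum>b<n. (\<Sum>a<n. E $$ (i,a) * X $$ (a,b)) * cnj (E $$ (k,b)))"
proof -
  have "(E * X * E\<dagger>) $$ (i,k) = (\<Sum>b<n. (E * X) $$ (i,b) * E\<dagger> $$ (b,k))"
    by (rule index_mult_mat_sum[of _ n n _ n]) (use assms in auto)
  also have "\<dots> = (\<Sum>b<n. (\<Sum>a<n. E $$ (i,a) * X $$ (a,b)) * cnj (E $$ (k,b)))"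
    using assms by (intro sum.cong refl) (simp add: index_mult_mat_sum[of E n n X n] del: index_mult_mat(1))
  finally show ?thesis .
qed

text \<open>Conjugation with \<open>E\<close> reduces this to the diagonal case: it commutes with
  powers, and each entry of the conjugated matrix is a fixed linear combination of finitely many
  entries.\<close>

theorem sandwiched_power_limit:
  fixes Y :: "real \<Rightarrow> complex mat" and J :: "nat \<Rightarrow> bool" and h :: "nat \<Rightarrow> real"
  assumes E: "unitary_mat n E" and C: "0 < C" and c: "0 < c" "c \<le> 1" and p0: "0 < p0"
    and Y: "\<And>p. 0 < p \<Longrightarrow> p < p0 \<Longrightarrow> Y p \<in> carrier_mat n n" "\<And>p. 0 < p \<Longrightarrow> p < p0 \<Longrightarrow> psd_mat (Y p)"
    and lo: "\<And>p v. 0 < p \<Longrightarrow> p < p0 \<Longrightarrow> v \<in> carrier_vec n \<Longrightarrow>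
      (\<Sum>i<n. (if J i then 1 + p * h i - C * p\<^sup>2 else 0) * (cmod ((E\<dagger> *\<^sub>v v) $ i))\<^sup>2) \<le> rq (Y p) v"
    and up: "\<And>p v. 0 < p \<Longrightarrow> p < p0 \<Longrightarrow> v \<in> carrier_vec n \<Longrightarrow>
      rq (Y p) v \<le> (\<Sum>i<n. (if J i then 1 + p * h i + C * p\<^sup>2 else 1 - c) * (cmod ((E\<dagger> *\<^sub>v v) $ i))\<^sup>2)"
    and ik: "i < n" "k < n"
  shows "((\<lambda>p. mat_powr (Y p) (1/p) $$ (i,k)) \<longlongrightarrow> udiag n E (\<lambda>i. if J i then exp (h i) else 0) $$ (i,k)) (at_right 0)"
proof -
  note cE = unitary_carrier[OF E]
  define Y' where "Y' p = E\<dagger> * Y p * E" for p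
  have Y'c: "Y' p \<in> carrier_mat n n" if "0 < p" "p < p0" for p
    using Y(1)[OF that] cE by (simp add: Y'_def)
  have rqY': "rq (Y' p) v = rq (Y p) (E *\<^sub>v v)" if "0 < p" "p < p0" "v \<in> carrier_vec n" for p v
    unfolding Y'_def by (rule rq_congruence[OF Y(1)[OF that(1,2)] cE that(3)])
  have Y'adj: "(Y' p)\<dagger> = Y' p" if "0 < p" "p < p0" for p
    using Y(1)[OF that] psd_adjoint[OF Y(1)[OF that] Y(2)[OF that]] cE unfolding Y'_def
    by (simp add: mat_adjoint_mult[where nr = n and n = n and nc = n] mult_square_assoc[of _ n])
  have Y'psd: "psd_mat (Y' p)" if "0 < p" "p < p0" for p
    using Y'adj[OF that] Y(2)[OF that] rqY'[OF that] cE
    by (auto simp: psd_iff[OF Y'c[OF that]] psd_iff[OF Y(1)[OF that]])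
  have lim: "((\<lambda>p. mat_powr (Y' p) (1/p) $$ (a,b)) \<longlongrightarrow> (if a = b \<and> J a then exp (h a) else 0)) (at_right 0)"
    if ab: "a < n" "b < n" for a b
  proof (rule sandwiched_power_limit_diagonal[OF C c p0 Y'c Y'psd _ _ ab])
    fix p and v :: "complex vec" assume p: "0 < p" "p < p0" and v: "v \<in> carrier_vec n"
    have "E *\<^sub>v v \<in> carrier_vec n" using cE v by simp
    from lo[OF p this] up[OF p this]
    show "(\<Sum>i<n. (if J i then 1 + p * h i - C * p\<^sup>2 else 0) * (cmod (v $ i))\<^sup>2) \<le> rq (Y' p) v"
      "rq (Y' p) v \<le> (\<Sum>i<n. (if J i then 1 + p * h i + C * p\<^sup>2 else 1 - c) * (cmod (v $ i))\<^sup>2)"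
      unfolding rqY'[OF p v] unitary_cancel_vec(1)[OF E v] .
  qed
  have conj: "mat_powr (Y p) q = E * mat_powr (Y' p) q * E\<dagger>" "mat_powr (Y' p) q \<in> carrier_mat n n"
    if p: "0 < p" "p < p0" for p q
  proof -
    have "Y p = (E * E\<dagger>) * Y p * (E * E\<dagger>)" using Y(1)[OF p] by (simp add: unitary_right[OF E])
    also have "\<dots> = E * Y' p * E\<dagger>"
      using Y(1)[OF p] cE unfolding Y'_def by (simp add: mult_square_assoc[of _ n])
    finally have "mat_powr (Y p) q = mat_powr (E * Y' p * E\<dagger>) q" by simp
    thus "mat_powr (Y p) q = E * mat_powr (Y' p) q * E\<dagger>"
      unfolding mat_powr_def matfun_unitary_conj[OF Y'c[OF p] Y'adj[OF p] E] .
    show "mat_powr (Y' p) q \<in> carrier_mat n n"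
      unfolding mat_powr_def by (rule matfun_hermitian(1)[OF Y'c[OF p] Y'adj[OF p]])
  qed
  let ?S = "\<lambda>p. \<Sum>b<n. (\<Sum>a<n. E $$ (i,a) * mat_powr (Y' p) (1/p) $$ (a,b)) * cnj (E $$ (k,b))"
  let ?U = "\<lambda>b. (\<Sum>a<n. E $$ (i,a) * complex_of_real (if a = b \<and> J a then exp (h a) else 0))"
  let ?T = "\<Sum>b<n. ?U b * cnj (E $$ (k,b))"
  have "((\<lambda>p. ?S p)
    \<longlongrightarrow> ?T) (at_right 0)"
    by (intro tendsto_intros lim) auto
  also have "?T
     = udiag n E (\<lambda>i. if J i then exp (h i) else 0) $$ (i,k)"
    unfolding udiag_entry[OF cE ik]
  proof (intro sum.cong refl)
    fix b assume b: "b \<in> {..<n}"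
    have "?U b
       = (\<Sum>a<n. if a = b then E $$ (i,b) * complex_of_real (if J b then exp (h b) else 0) else 0)"
      by (intro sum.cong) auto
    thus "?U b * cnj (E $$ (k,b))
      = complex_of_real (if J b then exp (h b) else 0) * (E $$ (i,b) * cnj (E $$ (k,b)))"
      using b by simp
  qed
  finally have *: "((\<lambda>p. ?S p)
    \<longlongrightarrow> udiag n E (\<lambda>i. if J i then exp (h i) else 0) $$ (i,k)) (at_right 0)" .
  show ?thesis
  proof (rule Lim_transform_eventually[OF *])
    show "\<forall>\<^sub>F p in at_right 0. ?S p
        = mat_powr (Y p) (1/p) $$ (i,k)"
      using eventually_at_right_real[OF p0]
    proof (rule eventually_mono)
      fix p assume "p \<in> {0<..<p0}"
      hence p: "0 < p" "p < p0" by auto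
      show "?S p
        = mat_powr (Y p) (1/p) $$ (i,k)"
        unfolding conj(1)[OF p] conj_entry[OF cE conj(2)[OF p] ik] ..
    qed
  qed
qed

section \<open>Orthogonal projections, supports and the meet of two ranges\<close>

definition orth_projection :: "nat \<Rightarrow> complex mat \<Rightarrow> bool" where
  "orth_projection n P \<longleftrightarrow> P \<in> carrier_mat n n \<and> P\<dagger> = P \<and> P * P = P"

lemma orth_projection_udiag:
  assumes "unitary_mat n U" "\<And>i. i < n \<Longrightarrow> d i = 0 \<or> d i = 1"
  shows "orth_projection n (udiag n U d)"
proof -
  have "udiag n U (\<lambda>i. d i * d i) = udiag n U d" using assms(2) by (intro udiag_cong) force
  thus ?thesis using unitary_carrier[OF assms(1)]
    by (simp add: orth_projection_def udiag_adjoint udiag_mult[OF assms(1)])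
qed

text \<open>Two projections onto the same range fix each other's images, so \<open>P * Q = Q\<close>
  and \<open>Q * P = P\<close>; taking adjoints identifies them.\<close>

lemma orth_proj_unique:
  assumes "is_orth_proj_onto n P W"
  shows "orth_proj n W = P"
  unfolding orth_proj_def
proof (rule the_equality)
  show "is_orth_proj_onto n P W" by fact
  have *: "A * B = B" if A: "is_orth_proj_onto n A W" and B: "is_orth_proj_onto n B W" for A B
  proof (rule mat_eqI_vec[of _ n n])
    have c: "A \<in> carrier_mat n n" "B \<in> carrier_mat n n" using A B by (auto simp: is_orth_proj_onto_def)
    show "A * B \<in> carrier_mat n n" "B \<in> carrier_mat n n" using c by auto
    fix v :: "complex vec" assume v: "v \<in> carrier_vec n"
    have "B *\<^sub>v v \<in> mat_range A"
      using A B c v by (auto simp: is_orth_proj_onto_def mat_range_def)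
    then obtain x where x: "x \<in> carrier_vec n" "B *\<^sub>v v = A *\<^sub>v x"
      using c by (auto simp: mat_range_def)
    have "A * B *\<^sub>v v = A *\<^sub>v (B *\<^sub>v v)" using c v by simp
    also have "\<dots> = A * A *\<^sub>v x" unfolding x(2) using c x by simp
    also have "\<dots> = B *\<^sub>v v" using A x(2) by (simp add: is_orth_proj_onto_def)
    finally show "A * B *\<^sub>v v = B *\<^sub>v v" .
  qed
  fix Q assume Q: "is_orth_proj_onto n Q W"
  have c: "P \<in> carrier_mat n n" "Q \<in> carrier_mat n n" "P\<dagger> = P" "Q\<dagger> = Q"
    using assms Q by (auto simp: is_orth_proj_onto_def hermitian_mat_iff[of _ n])
  have "Q = P * Q" using *[OF assms Q] by simp
  also have "\<dots> = (Q * P)\<dagger>" using c by (simp add: mat_adjoint_mult[where nr = n and n = n and nc = n])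
  also have "\<dots> = P" using *[OF Q assms] c by simp
  finally show "Q = P" .
qed

lemma is_orth_proj_ontoI:
  assumes "orth_projection n P" "mat_range P = W"
  shows "is_orth_proj_onto n P W"
  using assms by (auto simp: is_orth_proj_onto_def orth_projection_def hermitian_mat_iff[of _ n])

lemma mat_range_mult:
  assumes "A \<in> carrier_mat n n" "B \<in> carrier_mat n n"
  shows "mat_range (A * B) \<subseteq> mat_range A"
proof
  fix w assume "w \<in> mat_range (A * B)"
  then obtain v where v: "v \<in> carrier_vec n" "w = A * B *\<^sub>v v" using assms by (auto simp: mat_range_def)
  have "w = A *\<^sub>v (B *\<^sub>v v)" using v assms by simp
  moreover have "B *\<^sub>v v \<in> carrier_vec (dim_col A)" using v assms by simp
  ultimately show "w \<in> mat_range A" unfolding mat_range_def by blast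
qed

lemma mat_range_orth_projection:
  assumes "orth_projection n P"
  shows "mat_range P = {v \<in> carrier_vec n. P *\<^sub>v v = v}"
proof -
  have c: "P \<in> carrier_mat n n" "P * P = P" using assms by (auto simp: orth_projection_def)
  have pp: "P *\<^sub>v (P *\<^sub>v x) = P *\<^sub>v x" if "x \<in> carrier_vec n" for x
    using c that by (metis assoc_mult_mat_vec)
  show ?thesis
  proof (intro equalityI subsetI)
    fix w assume "w \<in> mat_range P"
    then obtain x where "x \<in> carrier_vec n" "w = P *\<^sub>v x" using c(1) by (auto simp: mat_range_def)
    thus "w \<in> {v \<in> carrier_vec n. P *\<^sub>v v = v}" using pp c(1) by simp
  next
    fix w assume "w \<in> {v \<in> carrier_vec n. P *\<^sub>v v = v}"
    hence "w \<in> carrier_vec (dim_col P)" "w = P *\<^sub>v w" using c(1) by auto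
    thus "w \<in> mat_range P" unfolding mat_range_def by blast
  qed
qed

definition supp_fun :: "real \<Rightarrow> real" where
  "supp_fun t = (if t = 0 then 0 else 1)"

text \<open>\<open>?S * A = A\<close>, and \<open>A\<close> times its pseudo-inverse is
  \<open>?S\<close>; these give the two inclusions between the ranges.\<close>

lemma supp_proj_eq:
  assumes A: "A \<in> carrier_mat n n" "A\<dagger> = A"
  shows "supp_proj A = matfun supp_fun A" "orth_projection n (matfun supp_fun A)"
proof -
  obtain U d where U: "unitary_mat n U" "A = udiag n U d"
    using hermitian_spectral[OF A] by blast
  note c = unitary_carrier[OF U(1)]
  let ?S = "udiag n U (\<lambda>i. supp_fun (d i))"
  have S: "orth_projection n ?S"
    by (rule orth_projection_udiag[OF U(1)]) (auto simp: supp_fun_def)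
  have "?S * A = A" "A * udiag n U (\<lambda>i. inverse (d i)) = ?S"
    unfolding U(2) udiag_mult[OF U(1)] by (auto intro!: udiag_cong simp: supp_fun_def)
  hence "mat_range ?S = mat_range A"
    using mat_range_mult[of ?S n A] mat_range_mult[OF A(1), of "udiag n U (\<lambda>i. inverse (d i))"] c A(1) by auto
  hence "is_orth_proj_onto n ?S (mat_range A)" by (rule is_orth_proj_ontoI[OF S])
  hence "orth_proj n (mat_range A) = ?S" by (rule orth_proj_unique)
  moreover have "?S = matfun supp_fun A" unfolding U(2) matfun_udiag[OF U(1)] ..
  ultimately show "supp_proj A = matfun supp_fun A"
    unfolding supp_proj_def carrier_matD(1)[OF A(1)] by (rule trans)
  show "orth_projection n (matfun supp_fun A)" using S by (simp add: U(2) matfun_udiag[OF U(1)])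
qed

lemma orth_projection_defect:
  assumes P: "orth_projection n P" and v: "v \<in> carrier_vec n"
  shows "nsq (v - P *\<^sub>v v) = nsq v - rq P v"
proof -
  have c: "P \<in> carrier_mat n n" "P\<dagger> = P" "P * P = P" using P by (auto simp: orth_projection_def)
  let ?w = "v - P *\<^sub>v v"
  have Pv: "P *\<^sub>v v \<in> carrier_vec n" using c v by simp
  have w: "?w \<in> carrier_vec n" using v Pv by simp
  have "P *\<^sub>v ?w = P *\<^sub>v v - P *\<^sub>v (P *\<^sub>v v)"
    using c v Pv by (simp add: mult_minus_distrib_mat_vec[of _ n n])
  also have "P *\<^sub>v (P *\<^sub>v v) = P *\<^sub>v v" using c v by (metis assoc_mult_mat_vec)
  finally have Pw: "P *\<^sub>v ?w = 0\<^sub>v n" using Pv by simp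
  have "cip ?w (P *\<^sub>v v) = 0"
    using cip_adjoint[OF c(1) w v] unfolding c(2) Pw using v by (simp add: cip_def)
  hence "cip ?w ?w = cip ?w v" using cip_minus_right[OF w v Pv] by simp
  also have "\<dots> = cnj (cip v v - cip v (P *\<^sub>v v))"
    unfolding cip_commute[OF trans[OF carrier_vecD[OF w] carrier_vecD[OF v, symmetric]]]
      cip_minus_right[OF v v Pv] ..
  finally have "Re (cip ?w ?w) = Re (cip v v) - Re (cip v (P *\<^sub>v v))" by simp
  thus ?thesis by (simp add: cip_self rq_def)
qed

lemma orth_projection_bounds:
  assumes P: "orth_projection n P" and v: "v \<in> carrier_vec n"
  shows "rq P v = nsq (P *\<^sub>v v)" "0 \<le> rq P v" "rq P v \<le> nsq v" "rq P v = nsq v \<Longrightarrow> P *\<^sub>v v = v"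
proof -
  have c: "P \<in> carrier_mat n n" "P\<dagger> = P" "P * P = P" using P by (auto simp: orth_projection_def)
  have Pv: "P *\<^sub>v v \<in> carrier_vec n" using c v by simp
  show 1: "rq P v = nsq (P *\<^sub>v v)"
    using rq_hermitian_congruence[OF one_carrier_mat c(1,2) v] c by (simp add: rq_one[OF Pv])
  show "0 \<le> rq P v" unfolding 1 by simp
  show "rq P v \<le> nsq v" using orth_projection_defect[OF P v] nsq_nonneg[of "v - P *\<^sub>v v"] by linarith
  show "P *\<^sub>v v = v" if "rq P v = nsq v"
  proof -
    have "v - P *\<^sub>v v = 0\<^sub>v n"
      using orth_projection_defect[OF P v] that nsq_eq_0[of "v - P *\<^sub>v v" n] v Pv by simp
    hence "(v - P *\<^sub>v v) $ i = 0" if "i < n" for i using that by simp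
    hence "(P *\<^sub>v v) $ i = v $ i" if "i < n" for i
      using that carrier_vecD[OF Pv] by (simp del: index_mult_mat_vec dim_mult_mat_vec)
    thus ?thesis by (rule vec_eqI_carrier[OF Pv v])
  qed
qed

text \<open>A convex combination of two projections with positive weights fixes a vector only if
  each projection does. The meet is therefore the spectral projection of \<open>M\<close> for 1, the
  largest value an eigenvalue of \<open>M\<close> can have, and \<open>c\<close> is a gap to the
  remaining eigenvalues.\<close>

lemma proj_meet_gap:
  assumes P: "orth_projection n P" and Q: "orth_projection n Q" and \<alpha>: "0 < \<alpha>" "\<alpha> < 1"
  obtains c where "0 < c" "c \<le> 1" "orth_projection n (proj_meet P Q)"
    "P * proj_meet P Q = proj_meet P Q" "Q * proj_meet P Q = proj_meet P Q"
    "\<And>v. v \<in> carrier_vec n \<Longrightarrow> (1 - \<alpha>) * rq P v + \<alpha> * rq Q v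
       \<le> rq (proj_meet P Q) v + (1 - c) * (nsq v - rq (proj_meet P Q) v)"
proof -
  have cP: "P \<in> carrier_mat n n" "P\<dagger> = P" and cQ: "Q \<in> carrier_mat n n" "Q\<dagger> = Q"
    using P Q by (auto simp: orth_projection_def)
  define M where "M = complex_of_real (1 - \<alpha>) \<cdot>\<^sub>m P + complex_of_real \<alpha> \<cdot>\<^sub>m Q"
  have M: "M \<in> carrier_mat n n" "M\<dagger> = M"
    using cP cQ by (auto simp: M_def mat_adjoint_add[of _ n n] mat_adjoint_smult)
  have rqM: "rq M v = (1 - \<alpha>) * rq P v + \<alpha> * rq Q v" if "v \<in> carrier_vec n" for v
    unfolding M_def using cP cQ that by (subst rq_add[of _ n]) (auto simp: rq_smult[of _ n] simp del: of_real_diff)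
  obtain W m where W: "unitary_mat n W" "M = udiag n W m"
    using hermitian_spectral[OF M] by blast
  note cW = unitary_carrier[OF W(1)]
  have m1: "m i \<le> 1" if i: "i < n" for i
  proof -
    let ?u = "W *\<^sub>v unit_vec n i"
    have u: "?u \<in> carrier_vec n" using cW by simp
    have "nsq ?u = nsq (unit_vec n i :: complex vec)" by (rule unitary_nsq[OF W(1)]) simp
    hence n1: "nsq ?u = 1" unfolding nsq_unit_vec[OF i] .
    have "m i = (1 - \<alpha>) * rq P ?u + \<alpha> * rq Q ?u"
      using rqM[OF u] rq_udiag_col[OF W(1) i, of m] W(2) by simp
    also have "\<dots> \<le> (1 - \<alpha>) * 1 + \<alpha> * 1"
      using orth_projection_bounds(3)[OF P u] orth_projection_bounds(3)[OF Q u] \<alpha> unfolding n1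
      by (intro add_mono mult_left_mono) auto
    finally show ?thesis by simp
  qed
  define P0 where "P0 = udiag n W (\<lambda>i. if m i = 1 then 1 else 0)"
  have P0: "orth_projection n P0" unfolding P0_def by (rule orth_projection_udiag[OF W(1)]) auto
  have cP0: "P0 \<in> carrier_mat n n" using P0 by (simp add: orth_projection_def)
  have MP0: "M * P0 = P0" unfolding W(2) P0_def udiag_mult[OF W(1)] by (intro udiag_cong) auto
  have fixed: "P *\<^sub>v v = v \<and> Q *\<^sub>v v = v" if v: "v \<in> carrier_vec n" "M *\<^sub>v v = v" for v
  proof -
    have "rq M v = nsq v" using v by (simp add: rq_def cip_self)
    hence "(1 - \<alpha>) * (nsq v - rq P v) + \<alpha> * (nsq v - rq Q v) = 0"
      using rqM[OF v(1)] by (simp add: algebra_simps)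
    moreover have "0 \<le> (1 - \<alpha>) * (nsq v - rq P v)" "0 \<le> \<alpha> * (nsq v - rq Q v)"
      using orth_projection_bounds(3)[OF P v(1)] orth_projection_bounds(3)[OF Q v(1)] \<alpha> by auto
    ultimately have "(1 - \<alpha>) * (nsq v - rq P v) = 0" "\<alpha> * (nsq v - rq Q v) = 0" by linarith+
    hence "rq P v = nsq v" "rq Q v = nsq v" using \<alpha> by auto
    thus ?thesis using orth_projection_bounds(4)[OF P v(1)] orth_projection_bounds(4)[OF Q v(1)] by blast
  qed
  have P0fix: "P *\<^sub>v (P0 *\<^sub>v v) = P0 *\<^sub>v v \<and> Q *\<^sub>v (P0 *\<^sub>v v) = P0 *\<^sub>v v" if v: "v \<in> carrier_vec n" for v
  proof (rule fixed)
    show "M *\<^sub>v (P0 *\<^sub>v v) = P0 *\<^sub>v v" using MP0 M(1) cP0 v by (metis assoc_mult_mat_vec)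
  qed (use cP0 v in simp)
  have PP0: "P * P0 = P0" "Q * P0 = P0"
    using P0fix cP cQ cP0 by (auto intro!: mat_eqI_vec[of _ n n])
  have "mat_range P0 = mat_range P \<inter> mat_range Q"
    unfolding mat_range_orth_projection[OF P0] mat_range_orth_projection[OF P] mat_range_orth_projection[OF Q]
  proof (intro equalityI subsetI)
    fix v assume "v \<in> {v \<in> carrier_vec n. P0 *\<^sub>v v = v}"
    thus "v \<in> {v \<in> carrier_vec n. P *\<^sub>v v = v} \<inter> {v \<in> carrier_vec n. Q *\<^sub>v v = v}"
      using P0fix[of v] by auto
  next
    fix v assume "v \<in> {v \<in> carrier_vec n. P *\<^sub>v v = v} \<inter> {v \<in> carrier_vec n. Q *\<^sub>v v = v}"
    hence v: "v \<in> carrier_vec n" "P *\<^sub>v v = v" "Q *\<^sub>v v = v" by auto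
    have "M *\<^sub>v v = complex_of_real (1 - \<alpha>) \<cdot>\<^sub>v v + complex_of_real \<alpha> \<cdot>\<^sub>v v"
      unfolding M_def using cP cQ v
      by (simp add: add_mult_distrib_mat_vec[of _ n n] smult_mat_vec[of _ n n] del: of_real_diff)
    also have "\<dots> = v" using v by (intro eq_vecI) (auto simp: algebra_simps)
    finally have "udiag n W m *\<^sub>v v = complex_of_real 1 \<cdot>\<^sub>v v" using v W(2) by simp
    from udiag_eigenvector_fun[OF W(1) v(1) this, of "\<lambda>t. if t = 1 then 1 else 0"]
    show "v \<in> {v \<in> carrier_vec n. P0 *\<^sub>v v = v}" using v(1) by (simp add: P0_def)
  qed
  hence "is_orth_proj_onto n P0 (mat_range P \<inter> mat_range Q)" by (rule is_orth_proj_ontoI[OF P0])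
  hence eq: "proj_meet P Q = P0" using cP by (simp add: proj_meet_def orth_proj_unique)
  \<comment> \<open>At the eigenvalue 1 the difference 0 is replaced by 1, so that a positive
    minimum over all indices exists and measures the gap of the others.\<close>
  have "\<exists>c0>0. \<forall>i<n. c0 \<le> (if m i = 1 then 1 else 1 - m i)"
  proof (rule ex_pos_lower_bound)
    show "0 < (if m i = 1 then 1 else 1 - m i)" if "i < n" for i using m1[OF that] by auto
  qed
  then obtain c0 where c0: "c0 > 0" "\<And>i. i < n \<Longrightarrow> c0 \<le> (if m i = 1 then 1 else 1 - m i)" by blast
  define c where "c = min c0 1"
  have c: "0 < c" "c \<le> 1" using c0 by (auto simp: c_def)
  have bound: "(1 - \<alpha>) * rq P v + \<alpha> * rq Q v \<le> rq P0 v + (1 - c) * (nsq v - rq P0 v)"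
    if v: "v \<in> carrier_vec n" for v
  proof -
    let ?w = "\<lambda>k. (cmod ((W\<dagger> *\<^sub>v v) $ k))\<^sup>2"
    have "(1 - \<alpha>) * rq P v + \<alpha> * rq Q v = rq M v" by (rule rqM[OF v, symmetric])
    also have "\<dots> \<le> rq (udiag n W (\<lambda>i. c * (if m i = 1 then 1 else 0) + (1 - c))) v"
      unfolding W(2)
    proof (rule rq_udiag_mono[OF cW v])
      fix i assume i: "i < n"
      show "m i \<le> c * (if m i = 1 then 1 else 0) + (1 - c)"
        using c0(2)[OF i] by (auto simp: c_def)
    qed
    also have "\<dots> = c * rq P0 v + (1 - c) * nsq v"
      unfolding P0_def rq_udiag[OF cW v] nsq_unitary_sum[OF W(1) v, symmetric] sum_distrib_left sum.distrib[symmetric]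
      by (intro sum.cong refl) (simp add: algebra_simps del: index_mult_mat_vec)
    finally show ?thesis by (simp add: algebra_simps)
  qed
  show ?thesis using that[OF c] P0 PP0 bound unfolding eq by blast
qed

section \<open>Expansions of powers to second order\<close>

lemma exp_le_quadratic:
  fixes y :: real
  assumes "y \<le> 1"
  shows "exp y \<le> 1 + y + y\<^sup>2"
proof (cases "0 \<le> y")
  case True
  thus ?thesis using exp_bound[of y] assms by simp
next
  case False
  define u where "u = - y"
  have u: "0 < u" using False by (simp add: u_def)
  \<comment> \<open>The second factor is the Taylor polynomial that bounds \<open>exp u\<close> from
    below; the first is the claimed bound at \<open>y = - u\<close>.\<close>
  have "1 \<le> (1 - u + u\<^sup>2) * (1 + u + u\<^sup>2 / 2)"
  proof -
    have "(1 - u + u\<^sup>2) * (1 + u + u\<^sup>2 / 2) = 1 + u\<^sup>2 / 2 + u ^ 3 / 2 + u ^ 4 / 2"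
      by (simp add: field_simps power2_eq_square power3_eq_cube power4_eq_xxxx)
    thus ?thesis using u by simp
  qed
  also have "\<dots> \<le> (1 - u + u\<^sup>2) * exp u"
  proof (rule mult_left_mono)
    show "1 + u + u\<^sup>2 / 2 \<le> exp u" using exp_lower_Taylor_quadratic[of u] u by simp
    have "0 \<le> (1 - u / 2)\<^sup>2 + 3 / 4 * u\<^sup>2" by simp
    thus "0 \<le> 1 - u + u\<^sup>2" by (simp add: power2_eq_square algebra_simps)
  qed
  finally have "exp (- u) * 1 \<le> exp (- u) * ((1 - u + u\<^sup>2) * exp u)" by (intro mult_left_mono) auto
  also have "\<dots> = (1 - u + u\<^sup>2) * (exp (- u) * exp u)" by (simp only: mult_ac)
  also have "exp (- u) * exp u = 1" by (simp add: exp_minus)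
  finally show ?thesis by (simp add: u_def)
qed

definition log_fun :: "real \<Rightarrow> real" where
  "log_fun t = (if t = 0 then 0 else ln t)"

text \<open>On a positive eigenvalue the power and its inverse are exponentials of \<open>p\<close>
  and \<open>- p\<close> times the logarithm, so one estimate of \<open>exp\<close> serves both. At
  eigenvalue 0 all terms except the quadratic one vanish, by \<open>0 powr p = 0\<close> and
  \<open>inverse 0 = 0\<close>. Upper bounds suffice, because the inverses enter the lower bound for
  the mean with a minus sign.\<close>

lemma psd_power_expansion:
  assumes A: "A \<in> carrier_mat n n" "psd_mat A"
  obtains C p0 where "0 < C" "0 < p0"
    "\<And>p v. 0 < p \<Longrightarrow> p < p0 \<Longrightarrow> v \<in> carrier_vec n \<Longrightarrow>
      rq (mat_powr A p) v \<le> rq (matfun supp_fun A) v + p * rq (mat_log A) v + C * p\<^sup>2 * nsq v"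
    "\<And>p v. 0 < p \<Longrightarrow> p < p0 \<Longrightarrow> v \<in> carrier_vec n \<Longrightarrow>
      rq (matfun inverse (mat_powr A p)) v \<le> rq (matfun supp_fun A) v - p * rq (mat_log A) v + C * p\<^sup>2 * nsq v"
    "\<And>p. 0 < p \<Longrightarrow> mat_powr A p \<in> carrier_mat n n \<and> psd_mat (mat_powr A p)
       \<and> matfun supp_fun (mat_powr A p) = matfun supp_fun A"
proof -
  obtain U d where U: "unitary_mat n U" "A = udiag n U d" "\<And>i. i < n \<Longrightarrow> d i \<ge> 0"
    using psd_spectral[OF A] by metis
  note c = unitary_carrier[OF U(1)]
  define e where "e i = log_fun (d i)" for i
  \<comment> \<open>Dominates \<open>(e i)\<^sup>2\<close>, for the remainder, and also
    \<open>\<bar>e i\<bar>\<close>, so that \<open>p < 1 / C\<close> brings the exponents into the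
    range of \<open>exp_le_quadratic\<close>.\<close>
  define C where "C = 1 + (\<Sum>i<n. (e i)\<^sup>2)"
  have C: "C > 0" unfolding C_def by (intro add_pos_nonneg sum_nonneg) auto
  have eC: "(e i)\<^sup>2 \<le> C" "\<bar>e i\<bar> \<le> C" if i: "i < n" for i
  proof -
    have 1: "(e i)\<^sup>2 \<le> (\<Sum>i<n. (e i)\<^sup>2)" using i by (intro member_le_sum[of i "{..<n}" "\<lambda>i. (e i)\<^sup>2"]) auto
    have "0 \<le> (\<bar>e i\<bar> - 1/2)\<^sup>2" by simp
    hence "\<bar>e i\<bar> \<le> 1 + (e i)\<^sup>2" by (simp add: power2_eq_square algebra_simps)
    with 1 show "(e i)\<^sup>2 \<le> C" "\<bar>e i\<bar> \<le> C" unfolding C_def by linarith+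
  qed
  have lg: "mat_log A = udiag n U e"
    unfolding mat_log_def U(2) matfun_udiag[OF U(1)] by (intro udiag_cong) (simp add: e_def log_fun_def)
  have sp: "matfun supp_fun A = udiag n U (\<lambda>i. supp_fun (d i))"
    unfolding U(2) matfun_udiag[OF U(1)] ..
  have form: "rq (udiag n U (\<lambda>i. supp_fun (d i))) v + s * rq (udiag n U e) v + C * p\<^sup>2 * nsq v
      = rq (udiag n U (\<lambda>i. supp_fun (d i) + s * e i + C * p\<^sup>2)) v" if "v \<in> carrier_vec n" for s p v
    unfolding rq_udiag[OF c that] nsq_unitary_sum[OF U(1) that, symmetric] sum_distrib_left sum.distrib[symmetric]
    by (intro sum.cong refl) (simp add: algebra_simps del: index_mult_mat_vec)
  have sc: "exp (s * e i) \<le> 1 + s * e i + C * p\<^sup>2" if "i < n" "0 < p" "p < 1 / C" "\<bar>s\<bar> = p" for s p i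
  proof -
    have "\<bar>s * e i\<bar> \<le> p * C" unfolding abs_mult that(4) using eC[OF that(1)] that by (intro mult_left_mono) auto
    also have "\<dots> \<le> 1" using that C by (simp add: field_simps)
    finally have "s * e i \<le> 1" by linarith
    hence "exp (s * e i) \<le> 1 + s * e i + (s * e i)\<^sup>2" by (rule exp_le_quadratic)
    also have "(s * e i)\<^sup>2 = (e i)\<^sup>2 * p\<^sup>2" using that(4) by (metis power2_abs power_mult_distrib mult.commute)
    also have "\<dots> \<le> C * p\<^sup>2" using eC[OF that(1)] by (intro mult_right_mono) auto
    finally show ?thesis by simp
  qed
  show ?thesis
  proof (rule that[of C "1 / C"])
    show "0 < C" "0 < 1 / C" using C by auto
    fix p and v :: "complex vec" assume p: "0 < p" "p < 1 / C" and v: "v \<in> carrier_vec n"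
    have "rq (mat_powr A p) v \<le> rq (udiag n U (\<lambda>i. supp_fun (d i) + p * e i + C * p\<^sup>2)) v"
      unfolding U(2) mat_powr_udiag[OF U(1)]
    proof (rule rq_udiag_mono[OF c v])
      fix i assume i: "i < n"
      show "d i powr p \<le> supp_fun (d i) + p * e i + C * p\<^sup>2"
        using sc[OF i p, of p] p C by (auto simp: e_def log_fun_def supp_fun_def powr_def)
    qed
    thus "rq (mat_powr A p) v \<le> rq (matfun supp_fun A) v + p * rq (mat_log A) v + C * p\<^sup>2 * nsq v"
      unfolding sp lg form[OF v] .
    have "rq (matfun inverse (mat_powr A p)) v \<le> rq (udiag n U (\<lambda>i. supp_fun (d i) + (- p) * e i + C * p\<^sup>2)) v"
      unfolding U(2) mat_powr_udiag[OF U(1)] matfun_udiag[OF U(1)]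
    proof (rule rq_udiag_mono[OF c v])
      fix i assume i: "i < n"
      show "inverse (d i powr p) \<le> supp_fun (d i) + (- p) * e i + C * p\<^sup>2"
        using sc[OF i p, of "- p"] p C by (auto simp: e_def log_fun_def supp_fun_def powr_def exp_minus)
    qed
    thus "rq (matfun inverse (mat_powr A p)) v \<le> rq (matfun supp_fun A) v - p * rq (mat_log A) v + C * p\<^sup>2 * nsq v"
      using form[OF v, of "- p" p] unfolding sp lg by simp
  next
    fix p :: real assume p: "0 < p"
    show "mat_powr A p \<in> carrier_mat n n \<and> psd_mat (mat_powr A p)
       \<and> matfun supp_fun (mat_powr A p) = matfun supp_fun A"
      unfolding U(2) mat_powr_udiag[OF U(1)] matfun_udiag[OF U(1)]
      using c by (auto intro!: psd_udiag udiag_cong simp: supp_fun_def)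
  qed
qed

text \<open>A common eigenbasis is obtained by diagonalizing \<open>H + \<kappa>(I - P)\<close> with \<open>\<kappa>\<close> larger than the norm
  of \<open>H\<close>: its eigenvectors for the eigenvalue \<open>\<kappa>\<close> lie in the kernel of \<open>P\<close>, all others in the range.\<close>

lemma joint_eigenbasis:
  assumes P: "orth_projection n P" and H: "H \<in> carrier_mat n n" "H\<dagger> = H" "P * H = H" "H * P = H"
  obtains E J h where "unitary_mat n E" "P = udiag n E (\<lambda>i. if J i then 1 else 0)" "H = udiag n E h"
    "\<And>i. i < n \<Longrightarrow> \<not> J i \<Longrightarrow> h i = 0"
proof -
  have cP: "P \<in> carrier_mat n n" "P\<dagger> = P" "P * P = P" using P by (auto simp: orth_projection_def)
  obtain K where K: "K > 0" "\<And>v. v \<in> carrier_vec n \<Longrightarrow> \<bar>rq H v\<bar> \<le> K * nsq v"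
    using hermitian_bounds[OF H(1,2)] by metis
  define \<kappa> where "\<kappa> = K + 1"
  define G where "G = H + complex_of_real \<kappa> \<cdot>\<^sub>m (1\<^sub>m n - P)"
  have c1: "1\<^sub>m n - P \<in> carrier_mat n n" using cP by (simp add: minus_carrier_mat)
  have G: "G \<in> carrier_mat n n" "G\<dagger> = G"
    using H cP c1 by (auto simp: G_def mat_adjoint_add[of _ n n] mat_adjoint_smult mat_adjoint_minus[of _ n n])
  obtain E g where E: "unitary_mat n E" "G = udiag n E g"
    using hermitian_spectral[OF G] by blast
  note cE = unitary_carrier[OF E(1)]
  have main: "(g i \<noteq> \<kappa> \<longrightarrow> P *\<^sub>v (E *\<^sub>v unit_vec n i) = E *\<^sub>v unit_vec n i \<and>
       H *\<^sub>v (E *\<^sub>v unit_vec n i) = complex_of_real (g i) \<cdot>\<^sub>v (E *\<^sub>v unit_vec n i)) \<and>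
     (g i = \<kappa> \<longrightarrow> P *\<^sub>v (E *\<^sub>v unit_vec n i) = 0\<^sub>v n \<and> H *\<^sub>v (E *\<^sub>v unit_vec n i) = 0\<^sub>v n)" if i: "i < n" for i
  proof -
    define u where "u = E *\<^sub>v unit_vec n i"
    have u: "u \<in> carrier_vec n" using cE by (simp add: u_def)
    have Pu: "P *\<^sub>v u \<in> carrier_vec n" and Hu: "H *\<^sub>v u \<in> carrier_vec n" using cP H u by auto
    have Gu: "G *\<^sub>v u = complex_of_real (g i) \<cdot>\<^sub>v u"
      unfolding E(2) u_def by (rule udiag_col_eigenvector[OF E(1) i])
    have Gu2: "G *\<^sub>v u = H *\<^sub>v u + complex_of_real \<kappa> \<cdot>\<^sub>v (u - P *\<^sub>v u)"
      unfolding G_def using H c1 cP u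
      by (simp add: add_mult_distrib_mat_vec[of _ n n] smult_mat_vec[of _ n n] minus_mult_distrib_mat_vec[of _ n n])
    have PG: "P * G = H"
    proof -
      have "P * G = P * H + complex_of_real \<kappa> \<cdot>\<^sub>m (P * (1\<^sub>m n - P))"
        unfolding G_def using H(1) c1 cP(1)
        by (simp add: mult_add_distrib_mat[of _ n n _ n] mult_smult_distrib[of _ n n _ n])
      also have "P * (1\<^sub>m n - P) = 0\<^sub>m n n"
        using cP by (simp add: mult_minus_distrib_mat[of _ n n _ n])
      finally show ?thesis using H by simp
    qed
    have HP: "H *\<^sub>v u = complex_of_real (g i) \<cdot>\<^sub>v (P *\<^sub>v u)"
    proof -
      have "H *\<^sub>v u = P *\<^sub>v (G *\<^sub>v u)" using PG cP(1) G(1) u by (metis assoc_mult_mat_vec)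
      thus ?thesis unfolding Gu using cP(1) u by (simp add: mult_mat_vec[of _ n n])
    qed
    \<comment> \<open>Inserting \<open>H u = g P u\<close> into the eigenvalue equation
      \<open>G u = g u\<close> leaves \<open>(\<kappa> - g) (u - P u) = 0\<close>.\<close>
    have coord: "(complex_of_real \<kappa> - complex_of_real (g i)) * (u $ k - (P *\<^sub>v u) $ k) = 0" if k: "k < n" for k
    proof -
      have "(complex_of_real (g i) \<cdot>\<^sub>v u) $ k = (complex_of_real (g i) \<cdot>\<^sub>v (P *\<^sub>v u) + complex_of_real \<kappa> \<cdot>\<^sub>v (u - P *\<^sub>v u)) $ k"
        using Gu Gu2 HP by simp
      thus ?thesis using k u Pu carrier_vecD[OF Pu] carrier_vecD[OF u]
        by (simp add: algebra_simps del: index_mult_mat_vec dim_mult_mat_vec)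
    qed
    have "P *\<^sub>v u = u \<and> H *\<^sub>v u = complex_of_real (g i) \<cdot>\<^sub>v u" if "g i \<noteq> \<kappa>"
    proof -
      have "(P *\<^sub>v u) $ k = u $ k" if "k < n" for k
        using coord[OF that] \<open>g i \<noteq> \<kappa>\<close> by (simp del: index_mult_mat_vec)
      hence "P *\<^sub>v u = u" by (rule vec_eqI_carrier[OF Pu u])
      thus ?thesis using HP by simp
    qed
    \<comment> \<open>A nonzero \<open>P u\<close> would be an eigenvector of \<open>H\<close> with
      eigenvalue \<open>\<kappa>\<close>, which exceeds the bound \<open>K\<close> for the form of
      \<open>H\<close>.\<close>
    moreover have "P *\<^sub>v u = 0\<^sub>v n \<and> H *\<^sub>v u = 0\<^sub>v n" if g: "g i = \<kappa>"
    proof -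
      have "H *\<^sub>v (P *\<^sub>v u) = complex_of_real \<kappa> \<cdot>\<^sub>v (P *\<^sub>v u)"
        using HP g H(1,4) cP(1) u by (metis assoc_mult_mat_vec)
      hence "rq H (P *\<^sub>v u) = \<kappa> * nsq (P *\<^sub>v u)"
        using Pu by (simp add: rq_def cip_smult_right[of _ n] cip_self)
      hence "\<kappa> * nsq (P *\<^sub>v u) \<le> K * nsq (P *\<^sub>v u)" using K(2)[OF Pu] by linarith
      hence "nsq (P *\<^sub>v u) \<le> 0" by (simp add: \<kappa>_def algebra_simps)
      hence "nsq (P *\<^sub>v u) = 0" using nsq_nonneg[of "P *\<^sub>v u"] by linarith
      hence "P *\<^sub>v u = 0\<^sub>v n" using nsq_eq_0[OF Pu] by simp
      thus ?thesis using HP by auto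
    qed
    ultimately show ?thesis unfolding u_def by blast
  qed
  have z: "0\<^sub>v n = complex_of_real 0 \<cdot>\<^sub>v (E *\<^sub>v unit_vec n i)" for i
    using cE by (intro eq_vecI) auto
  show ?thesis
  proof (rule that[of E "\<lambda>i. g i \<noteq> \<kappa>" "\<lambda>i. if g i \<noteq> \<kappa> then g i else 0"])
    show "unitary_mat n E" by (rule E(1))
    show "P = udiag n E (\<lambda>i. if g i \<noteq> \<kappa> then 1 else 0)"
      using main z by (intro udiag_eqI[OF E(1) cP(1)]) auto
    show "H = udiag n E (\<lambda>i. if g i \<noteq> \<kappa> then g i else 0)"
      using main z by (intro udiag_eqI[OF E(1) H(1)]) auto
  qed auto
qed

section \<open>The limit\<close>

lemma compression_properties:
  assumes P: "orth_projection n P" and L: "L \<in> carrier_mat n n" "L\<dagger> = L"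
  shows "P * L * P \<in> carrier_mat n n" "(P * L * P)\<dagger> = P * L * P"
    "P * (P * L * P) = P * L * P" "(P * L * P) * P = P * L * P"
    "v \<in> carrier_vec n \<Longrightarrow> rq (P * L * P) v = rq L (P *\<^sub>v v)"
proof -
  have c: "P \<in> carrier_mat n n" "P\<dagger> = P" "P * P = P" using P by (auto simp: orth_projection_def)
  show "P * L * P \<in> carrier_mat n n" using c L by simp
  show "(P * L * P)\<dagger> = P * L * P" by (rule hermitian_congruence_adjoint[OF L c(1,2)])
  have "P * (P * L * P) = (P * P) * L * P" using c(1) L(1) by (simp add: mult_square_assoc[of _ n])
  thus "P * (P * L * P) = P * L * P" unfolding c(3) .
  have "(P * L * P) * P = P * L * (P * P)" using c(1) L(1) by (simp add: mult_square_assoc[of _ n])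
  thus "(P * L * P) * P = P * L * P" unfolding c(3) .
  show "rq (P * L * P) v = rq L (P *\<^sub>v v)" if "v \<in> carrier_vec n"
    by (rule rq_hermitian_congruence[OF L(1) c(1,2) that])
qed

text \<open>The vector is split into \<open>P v\<close> and the rest. As \<open>N\<close> has no
  sign, Young's inequality is applied to the positive semidefinite \<open>N + K I\<close>, and the
  shift is subtracted again. For \<open>t\<close> of order \<open>p\<close>, and after
  multiplication by \<open>p\<close>, the cross term costs O(p^2) on the range of \<open>P\<close>
  and O(1) off it.\<close>

lemma rq_block_bound:
  assumes P: "orth_projection n P" and N: "N \<in> carrier_mat n n" "N\<dagger> = N"
    and K: "0 < K" "\<And>v. v \<in> carrier_vec n \<Longrightarrow> \<bar>rq N v\<bar> \<le> K * nsq v" and t: "0 < t" and v: "v \<in> carrier_vec n"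
  shows "rq N v \<le> rq N (P *\<^sub>v v) + 2 * t * K * rq P v + (2 + 2 / t) * K * (nsq v - rq P v)"
proof -
  have c: "P \<in> carrier_mat n n" using P by (simp add: orth_projection_def)
  let ?v0 = "P *\<^sub>v v" and ?v1 = "v - P *\<^sub>v v"
  have v0: "?v0 \<in> carrier_vec n" using c v by simp
  hence v1: "?v1 \<in> carrier_vec n" using v by simp
  have dec: "?v0 + ?v1 = v"
    by (rule vec_eqI_carrier[of _ n]) (use v0 v1 v c in \<open>auto simp del: index_mult_mat_vec\<close>)
  have n0: "nsq ?v0 = rq P v" by (rule orth_projection_bounds(1)[OF P v, symmetric])
  have n1: "nsq ?v1 = nsq v - rq P v" by (rule orth_projection_defect[OF P v])
  define G where "G = N + complex_of_real K \<cdot>\<^sub>m 1\<^sub>m n"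
  have G: "G \<in> carrier_mat n n" "G\<dagger> = G"
    using N by (auto simp: G_def mat_adjoint_add[of _ n n] mat_adjoint_smult)
  have rqG: "rq G w = rq N w + K * nsq w" if "w \<in> carrier_vec n" for w
    unfolding G_def using N that by (subst rq_add[of _ n]) (auto simp: rq_smult[of _ n] rq_one)
  have psd: "psd_mat G" unfolding psd_iff[OF G(1)]
  proof (intro conjI ballI)
    fix w :: "complex vec" assume w: "w \<in> carrier_vec n"
    show "0 \<le> rq G w" using rqG[OF w] K(2)[OF w] by linarith
  qed (rule G(2))
  have "rq G v \<le> (1 + t) * rq G ?v0 + (1 + 1 / t) * rq G ?v1"
    using rq_add_vec_le[OF G(1) psd v0 v1 t] unfolding dec .
  also have "\<dots> = rq G ?v0 + t * rq G ?v0 + (1 + 1 / t) * rq G ?v1" by (simp add: algebra_simps)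
  also have "\<dots> \<le> (rq N ?v0 + K * rq P v) + t * (2 * K * rq P v) + (1 + 1 / t) * (2 * K * (nsq v - rq P v))"
    using K(2)[OF v0] K(2)[OF v1] t unfolding n0 n1
    by (intro add_mono mult_left_mono) (auto simp: rqG[OF v0] rqG[OF v1] n0 n1 algebra_simps abs_le_iff)
  finally have "rq N v + K * nsq v \<le> rq N ?v0 + K * rq P v + t * (2 * K * rq P v)
      + (1 + 1 / t) * (2 * K * (nsq v - rq P v))" unfolding rqG[OF v] .
  moreover have "0 \<le> K * (nsq v - rq P v)" using K(1) orth_projection_bounds(3)[OF P v] by simp
  moreover have "K * nsq v = K * rq P v + K * (nsq v - rq P v)" "t * (2 * K * rq P v) = 2 * t * K * rq P v"
    "(1 + 1 / t) * (2 * K * (nsq v - rq P v)) = (2 + 2 / t) * K * (nsq v - rq P v)"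
    using t by (simp_all add: field_simps)
  ultimately show ?thesis by linarith
qed

theorem theoremA1:
  fixes f :: "real \<Rightarrow> real" and \<alpha> :: real and n :: nat and A B :: "complex mat"
  assumes "km_function f"
    and "(f has_real_derivative \<alpha>) (at 1)"
    and "0 < \<alpha>" and "\<alpha> < 1"
    and "A \<in> carrier_mat n n" and "B \<in> carrier_mat n n"
    and "psd_mat A" and "psd_mat B"
  shows "let P0 = proj_meet (supp_proj A) (supp_proj B);
             L = P0 * mat_exp (complex_of_real (1 - \<alpha>) \<cdot>\<^sub>m (P0 * mat_log A * P0)
                              + complex_of_real \<alpha> \<cdot>\<^sub>m (P0 * mat_log B * P0))
         in \<forall>i<n. \<forall>j<n.
              ((\<lambda>p. mat_powr (kubo_ando f (mat_powr A p) (mat_powr B p)) (1/p) $$ (i,j))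
                 \<longlongrightarrow> L $$ (i,j)) (at_right 0)"
proof -
  note f = assms(1,2) and \<alpha> = assms(3,4) and A = assms(5,7) and B = assms(6,8)
  define PA where "PA = matfun supp_fun A"
  define PB where "PB = matfun supp_fun B"
  note sA = supp_proj_eq[OF A(1) psd_adjoint[OF A], folded PA_def]
    and sB = supp_proj_eq[OF B(1) psd_adjoint[OF B], folded PB_def]
  define P where "P = proj_meet PA PB"
  obtain c0 where c0: "0 < c0" "c0 \<le> 1" and P: "orth_projection n P" "PA * P = P" "PB * P = P"
    and gap: "\<And>v. v \<in> carrier_vec n \<Longrightarrow> (1 - \<alpha>) * rq PA v + \<alpha> * rq PB v \<le> rq P v + (1 - c0) * (nsq v - rq P v)"
    using proj_meet_gap[OF sA(2) sB(2) \<alpha>, folded P_def] by metis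
  have cP: "P \<in> carrier_mat n n" "PA \<in> carrier_mat n n" "PB \<in> carrier_mat n n"
    using P(1) sA(2) sB(2) by (auto simp: orth_projection_def)
  have LA: "mat_log A \<in> carrier_mat n n" "(mat_log A)\<dagger> = mat_log A"
    and LB: "mat_log B \<in> carrier_mat n n" "(mat_log B)\<dagger> = mat_log B"
    unfolding mat_log_def
    using matfun_hermitian[OF A(1) psd_adjoint[OF A]] matfun_hermitian[OF B(1) psd_adjoint[OF B]] by auto
  \<comment> \<open>The logarithms enter the expansions of the powers through \<open>N\<close>,
    uncompressed; the exponent \<open>H\<close> is its compression to the range of
    \<open>P\<close>.\<close>
  define N where "N = complex_of_real (1 - \<alpha>) \<cdot>\<^sub>m mat_log A + complex_of_real \<alpha> \<cdot>\<^sub>m mat_log B"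
  have N: "N \<in> carrier_mat n n" "N\<dagger> = N"
    using LA LB by (auto simp: N_def mat_adjoint_add[of _ n n] mat_adjoint_smult)
  have rqN: "rq N v = (1 - \<alpha>) * rq (mat_log A) v + \<alpha> * rq (mat_log B) v" if "v \<in> carrier_vec n" for v
    unfolding N_def using LA LB that by (subst rq_add[of _ n]) (auto simp: rq_smult[of _ n] simp del: of_real_diff)
  define H where "H = complex_of_real (1 - \<alpha>) \<cdot>\<^sub>m (P * mat_log A * P) + complex_of_real \<alpha> \<cdot>\<^sub>m (P * mat_log B * P)"
  have HN: "H = P * N * P"
    unfolding H_def N_def using cP(1) LA LB
    by (simp add: mult_add_distrib_mat[of _ n n _ n] add_mult_distrib_mat[of _ n n _ _ n]
        mult_smult_distrib[of _ n n _ n] mult_smult_assoc_mat[of _ n n _ n] del: of_real_diff)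
  note H = compression_properties[OF P(1) N, folded HN]
  obtain E J h where E: "unitary_mat n E" "P = udiag n E (\<lambda>i. if J i then 1 else 0)" "H = udiag n E h"
    "\<And>i. i < n \<Longrightarrow> \<not> J i \<Longrightarrow> h i = 0"
    using joint_eigenbasis[OF P(1) H(1-4)] by metis
  note cE = unitary_carrier[OF E(1)]
  obtain K where K: "0 < K" "\<And>v. v \<in> carrier_vec n \<Longrightarrow> \<bar>rq N v\<bar> \<le> K * nsq v"
    using hermitian_bounds[OF N] by metis
  obtain CA pA where CA: "0 < CA" "0 < pA"
    "\<And>p v. 0 < p \<Longrightarrow> p < pA \<Longrightarrow> v \<in> carrier_vec n \<Longrightarrow>
      rq (mat_powr A p) v \<le> rq PA v + p * rq (mat_log A) v + CA * p\<^sup>2 * nsq v"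
    "\<And>p v. 0 < p \<Longrightarrow> p < pA \<Longrightarrow> v \<in> carrier_vec n \<Longrightarrow>
      rq (matfun inverse (mat_powr A p)) v \<le> rq PA v - p * rq (mat_log A) v + CA * p\<^sup>2 * nsq v"
    "\<And>p. 0 < p \<Longrightarrow> mat_powr A p \<in> carrier_mat n n \<and> psd_mat (mat_powr A p) \<and> matfun supp_fun (mat_powr A p) = PA"
    using psd_power_expansion[OF A, folded PA_def] by metis
  obtain CB pB where CB: "0 < CB" "0 < pB"
    "\<And>p v. 0 < p \<Longrightarrow> p < pB \<Longrightarrow> v \<in> carrier_vec n \<Longrightarrow>
      rq (mat_powr B p) v \<le> rq PB v + p * rq (mat_log B) v + CB * p\<^sup>2 * nsq v"
    "\<And>p v. 0 < p \<Longrightarrow> p < pB \<Longrightarrow> v \<in> carrier_vec n \<Longrightarrow>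
      rq (matfun inverse (mat_powr B p)) v \<le> rq PB v - p * rq (mat_log B) v + CB * p\<^sup>2 * nsq v"
    "\<And>p. 0 < p \<Longrightarrow> mat_powr B p \<in> carrier_mat n n \<and> psd_mat (mat_powr B p) \<and> matfun supp_fun (mat_powr B p) = PB"
    using psd_power_expansion[OF B, folded PB_def] by metis
  define C1 where "C1 = (1 - \<alpha>) * CA + \<alpha> * CB"
  have C1: "0 < C1" unfolding C1_def using CA CB \<alpha> by (intro add_pos_pos) auto
  \<comment> \<open>With the weight \<open>\<tau> * p\<close> in \<open>rq_block_bound\<close> the
    cross term costs \<open>2 * K / \<tau> = c0 / 8\<close> off the range of
    \<open>P\<close>.\<close>
  define \<tau> where "\<tau> = 16 * K / c0"
  have \<tau>: "0 < \<tau>" "K / \<tau> = c0 / 16" using K c0 by (auto simp: \<tau>_def)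
  \<comment> \<open>Covers the error \<open>2 * \<tau> * K + C1\<close> of the upper bound as well
    as the error \<open>4 * C1\<close> of the lower bound.\<close>
  define C where "C = 2 * \<tau> * K + 5 * C1"
  have C: "0 < C" unfolding C_def using \<tau> K C1 by (intro add_pos_pos) auto
  define h1 where "h1 = 1 + (\<Sum>i<n. \<bar>h i\<bar>)"
  have h1: "1 \<le> h1" unfolding h1_def by (simp add: sum_nonneg)
  have hh: "\<bar>h i\<bar> \<le> h1" if "i < n" for i
  proof -
    have "\<bar>h i\<bar> \<le> (\<Sum>i<n. \<bar>h i\<bar>)" using that by (intro member_le_sum[of i "{..<n}" "\<lambda>i. \<bar>h i\<bar>"]) auto
    thus ?thesis by (simp add: h1_def)
  qed
  \<comment> \<open>The last two entries give \<open>\<bar>p * h i\<bar> \<le> 1\<close> and keep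
    the remaining losses off the range of \<open>P\<close> at or below \<open>c0 / 8\<close>.
    Together with the cross term they consume less than half of the gap, hence the constant
    \<open>c0 / 2\<close> below.\<close>
  define p0 where "p0 = Min {pA, pB, 1, 1 / h1, c0 / (8 * (2 * K + C1))}"
  have p0: "0 < p0" unfolding p0_def using CA CB h1 c0 K C1 by auto
  define Y where "Y p = kubo_ando f (mat_powr A p) (mat_powr B p)" for p
  have sf: "(\<lambda>t :: real. if t = 0 then 0 else 1 :: real) = supp_fun" by (rule ext) (simp add: supp_fun_def)
  have small: "p < pA" "p < pB" "p \<le> 1" "p * h1 \<le> 1" "p * (2 * K + C1) \<le> c0 / 8" if "p < p0" for p
  proof -
    have "p < 1 / h1" "p < c0 / (8 * (2 * K + C1))" using that by (auto simp: p0_def)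
    thus "p * h1 \<le> 1" "p * (2 * K + C1) \<le> c0 / 8" using h1 K C1 by (auto simp: field_simps)
    show "p < pA" "p < pB" "p \<le> 1" using that by (auto simp: p0_def)
  qed
  have Yprop: "Y p \<in> carrier_mat n n" "psd_mat (Y p)"
    "\<And>v. v \<in> carrier_vec n \<Longrightarrow> rq (Y p) v \<le> (1 - \<alpha>) * rq (mat_powr A p) v + \<alpha> * rq (mat_powr B p) v"
    "\<And>v x. v \<in> carrier_vec n \<Longrightarrow> x \<in> carrier_vec n \<Longrightarrow> PA *\<^sub>v x = x \<Longrightarrow> PB *\<^sub>v x = x \<Longrightarrow>
       2 * Re (cip v x) - (1 - \<alpha>) * rq (matfun inverse (mat_powr A p)) x - \<alpha> * rq (matfun inverse (mat_powr B p)) x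
         \<le> rq (Y p) v" if p: "0 < p" for p
    using kubo_ando_properties[OF f \<alpha>, of "mat_powr A p" n "mat_powr B p"] CA(5)[OF p] CB(5)[OF p]
    unfolding sf Y_def by auto
  have "((\<lambda>p. mat_powr (Y p) (1/p) $$ (i,j)) \<longlongrightarrow> udiag n E (\<lambda>i. if J i then exp (h i) else 0) $$ (i,j)) (at_right 0)"
    if ij: "i < n" "j < n" for i j
  proof (rule sandwiched_power_limit[OF E(1) C _ _ p0 Yprop(1,2) _ _ ij, where c = "c0 / 2"])
    show "0 < c0 / 2" "c0 / 2 \<le> 1" using c0 by auto
    fix p and v :: "complex vec" assume p: "0 < p" "p < p0" and v: "v \<in> carrier_vec n"
    note sm = small[OF p(2)]
    let ?w = "\<lambda>k. (cmod ((E\<dagger> *\<^sub>v v) $ k))\<^sup>2"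
    show "rq (Y p) v \<le> (\<Sum>i<n. (if J i then 1 + p * h i + C * p\<^sup>2 else 1 - c0 / 2) * ?w i)"
    proof -
      define a where "a = rq P v"
      define b where "b = nsq v - a"
      have ab: "0 \<le> a" "0 \<le> b" using orth_projection_bounds[OF P(1) v] by (auto simp: a_def b_def)
      have nv: "nsq v = a + b" by (simp add: b_def)
      have "rq (Y p) v \<le> (1 - \<alpha>) * rq (mat_powr A p) v + \<alpha> * rq (mat_powr B p) v"
        by (rule Yprop(3)[OF p(1) v])
      also have "\<dots> \<le> (1 - \<alpha>) * (rq PA v + p * rq (mat_log A) v + CA * p\<^sup>2 * nsq v)
          + \<alpha> * (rq PB v + p * rq (mat_log B) v + CB * p\<^sup>2 * nsq v)"
        using \<alpha> by (intro add_mono mult_left_mono CA(3)[OF p(1) sm(1) v] CB(3)[OF p(1) sm(2) v]) auto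
      also have "\<dots> = ((1 - \<alpha>) * rq PA v + \<alpha> * rq PB v) + p * rq N v + C1 * p\<^sup>2 * nsq v"
        unfolding rqN[OF v] C1_def by (simp add: algebra_simps)
      also have "\<dots> \<le> (a + (1 - c0) * b) + p * (rq N (P *\<^sub>v v) + 2 * (\<tau> * p) * K * a + (2 + 2 / (\<tau> * p)) * K * b)
          + C1 * p\<^sup>2 * nsq v"
      proof -
        have "rq N v \<le> rq N (P *\<^sub>v v) + 2 * (\<tau> * p) * K * a + (2 + 2 / (\<tau> * p)) * K * b"
          unfolding a_def b_def using p \<tau>(1) by (intro rq_block_bound[OF P(1) N K _ v]) auto
        hence "p * rq N v \<le> p * (rq N (P *\<^sub>v v) + 2 * (\<tau> * p) * K * a + (2 + 2 / (\<tau> * p)) * K * b)"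
          using p by (intro mult_left_mono) auto
        thus ?thesis using gap[OF v] unfolding a_def[symmetric] b_def[symmetric] by linarith
      qed
      also have "\<dots> = a + (1 - c0) * b + p * rq H v + 2 * \<tau> * K * p\<^sup>2 * a + (2 * p * K + 2 * (K / \<tau>)) * b
          + C1 * p\<^sup>2 * (a + b)"
        unfolding H(5)[OF v] nv using p \<tau>(1) by (simp add: field_simps power2_eq_square)
      also have "\<dots> = a * (1 + (2 * \<tau> * K + C1) * p\<^sup>2) + p * rq H v + (1 - c0 + c0 / 8 + (2 * p * K + C1 * p\<^sup>2)) * b"
        unfolding \<tau>(2) by (simp add: algebra_simps)
      also have "\<dots> \<le> a * (1 + C * p\<^sup>2) + p * rq H v + (1 - c0 / 2) * b"
      proof (intro add_mono mult_left_mono mult_right_mono order.refl ab)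
        show "2 * \<tau> * K + C1 \<le> C" using C1 by (simp add: C_def)
        have "C1 * p\<^sup>2 \<le> C1 * p" using sm(3) p C1 by (simp add: power2_eq_square mult_le_cancel_left1)
        hence "2 * p * K + C1 * p\<^sup>2 \<le> p * (2 * K + C1)" by (simp add: algebra_simps)
        thus "1 - c0 + c0 / 8 + (2 * p * K + C1 * p\<^sup>2) \<le> 1 - c0 / 2" using sm(5) c0 by linarith
      qed (use p in auto)
      also have "\<dots> = a * (c0 / 2 + C * p\<^sup>2) + p * rq H v + (1 - c0 / 2) * nsq v"
        by (simp add: nv algebra_simps)
      also have "\<dots> = (\<Sum>i<n. (if J i then 1 + p * h i + C * p\<^sup>2 else 1 - c0 / 2) * ?w i)"
        unfolding a_def E(2,3) rq_udiag[OF cE v] nsq_unitary_sum[OF E(1) v, symmetric]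
          sum_distrib_left sum_distrib_right sum.distrib[symmetric]
        by (intro sum.cong refl) (auto simp: E(4) algebra_simps simp del: index_mult_mat_vec)
      finally show ?thesis .
    qed
    show "(\<Sum>i<n. (if J i then 1 + p * h i - C * p\<^sup>2 else 0) * ?w i) \<le> rq (Y p) v"
    proof -
      \<comment> \<open>The vector \<open>x = (P + p H) v\<close> is the maximizer of the lower
        bound to first order: on the range of \<open>P\<close> the weighted inverse powers are
        bounded by \<open>P - p H\<close> up to O(p^2), and \<open>P + p H\<close> inverts this to
        the same accuracy.\<close>
      define b where "b i = (if J i then 1 + p * h i else 0)" for i
      define x where "x = udiag n E b *\<^sub>v v"
      have x: "x \<in> carrier_vec n" using cE v by (simp add: x_def)
      have Px: "P *\<^sub>v x = x"
      proof -
        have "P *\<^sub>v x = (P * udiag n E b) *\<^sub>v v"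
          unfolding x_def using cP(1) cE v by (subst assoc_mult_mat_vec[of _ n n _ n]) auto
        also have "P * udiag n E b = udiag n E b"
          unfolding E(2) udiag_mult[OF E(1)] by (intro udiag_cong) (simp add: b_def)
        finally show ?thesis by (simp add: x_def)
      qed
      have PAx: "PA *\<^sub>v x = x" "PB *\<^sub>v x = x"
        using P(2,3) Px cP x by (metis assoc_mult_mat_vec)+
      have rqx: "rq PA x = nsq x" "rq PB x = nsq x" using PAx by (auto simp: rq_def cip_self)
      have "(\<Sum>i<n. (if J i then 1 + p * h i - C * p\<^sup>2 else 0) * ?w i)
        \<le> (\<Sum>i<n. (2 * b i - (1 + C1 * p\<^sup>2) * (b i * b i) + p * (b i * h i * b i)) * ?w i)"
      proof (intro sum_mono mult_right_mono)
        fix i assume "i \<in> {..<n}"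
        hence i: "i < n" by simp
        show "(if J i then 1 + p * h i - C * p\<^sup>2 else 0)
          \<le> 2 * b i - (1 + C1 * p\<^sup>2) * (b i * b i) + p * (b i * h i * b i)"
        proof (cases "J i")
          case True
          define y where "y = p * h i"
          have "\<bar>y\<bar> \<le> p * h1" unfolding y_def abs_mult using hh[OF i] p by (intro mult_mono) auto
          hence y: "- 1 \<le> y" "y \<le> 1" using sm(4) by linarith+
          have "(1 + y)\<^sup>2 \<le> 2\<^sup>2" using y by (intro power_mono) auto
          hence "C1 * p\<^sup>2 * (1 + y)\<^sup>2 \<le> C1 * p\<^sup>2 * 4" using C1 by (intro mult_left_mono) auto
          moreover have "C1 * p\<^sup>2 * 4 \<le> C * p\<^sup>2"
          proof -
            have "0 < \<tau> * K" using \<tau>(1) K(1) by simp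
            hence "C1 * 4 \<le> C" using C1 by (simp add: C_def)
            hence "C1 * 4 * p\<^sup>2 \<le> C * p\<^sup>2" by (intro mult_right_mono) auto
            thus ?thesis by (simp add: mult_ac)
          qed
          \<comment> \<open>Up to the term with \<open>C1\<close>, this choice of \<open>b\<close>
            gives exactly \<open>1 + y\<close> plus the nonnegative remainder
            \<open>(1 + y) * y\<^sup>2\<close>.\<close>
          moreover have "0 \<le> (1 + y) * y\<^sup>2" using y by simp
          ultimately have "1 + y - C * p\<^sup>2 \<le> 1 + y + (1 + y) * y\<^sup>2 - C1 * p\<^sup>2 * (1 + y)\<^sup>2" by linarith
          also have "\<dots> = 2 * (1 + y) - (1 + C1 * p\<^sup>2) * ((1 + y) * (1 + y)) + y * ((1 + y) * (1 + y))"
            by (simp add: power2_eq_square algebra_simps)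
          finally show ?thesis using True by (simp add: b_def y_def mult_ac)
        qed (simp add: b_def)
      qed simp
      also have "\<dots> = 2 * rq (udiag n E b) v - (1 + C1 * p\<^sup>2) * rq (udiag n E (\<lambda>i. b i * b i)) v
          + p * rq (udiag n E (\<lambda>i. b i * h i * b i)) v"
        unfolding rq_udiag[OF cE v] sum_distrib_left sum.distrib[symmetric] sum_subtractf[symmetric]
        by (intro sum.cong refl) (simp add: algebra_simps del: index_mult_mat_vec)
      also have "\<dots> = 2 * Re (cip v x) - (1 + C1 * p\<^sup>2) * nsq x + p * rq N x"
        using nsq_udiag[OF E(1) v, of b] rq_udiag_comp[OF E(1) v, of h b] H(5)[OF x]
        unfolding E(3)[symmetric] x_def[symmetric] Px by (simp add: rq_def[of "udiag n E b"] x_def[symmetric])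
      also have "\<dots> = 2 * Re (cip v x) - (1 - \<alpha>) * (rq PA x - p * rq (mat_log A) x + CA * p\<^sup>2 * nsq x)
         - \<alpha> * (rq PB x - p * rq (mat_log B) x + CB * p\<^sup>2 * nsq x)"
        unfolding rqN[OF x] rqx C1_def by (simp add: algebra_simps)
      also have "\<dots> \<le> 2 * Re (cip v x) - (1 - \<alpha>) * rq (matfun inverse (mat_powr A p)) x
         - \<alpha> * rq (matfun inverse (mat_powr B p)) x"
        using \<alpha> by (intro diff_mono mult_left_mono order.refl CA(4)[OF p(1) sm(1) x] CB(4)[OF p(1) sm(2) x]) auto
      also have "\<dots> \<le> rq (Y p) v" by (rule Yprop(4)[OF p(1) v x PAx])
      finally show ?thesis .
    qed
  qed
  \<comment> \<open>Off the range of \<open>P\<close> all \<open>h i\<close> vanish, so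
    \<open>mat_exp H\<close> acts there as the identity; the factor \<open>P\<close> turns this into
    0.\<close>
  moreover have "P * mat_exp H = udiag n E (\<lambda>i. if J i then exp (h i) else 0)"
    unfolding mat_exp_def E(2,3) matfun_udiag[OF E(1)] udiag_mult[OF E(1)] by (intro udiag_cong) simp
  ultimately show ?thesis
    unfolding Let_def sA(1) sB(1) P_def[symmetric] H_def[symmetric] Y_def by simp
qed

end
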